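(* Let $G=(V,E)$ be a finite simple connected graph. Fix a generic $h\in\mathcal S(G)$, let $(V_N,h_N,\psi_N,\lambda)$ be critical data for $h$, and suppose that the critical submanifold $F=F(V_N,h_N,\psi_N,\lambda)\subset\mathcal M_h$ is non-empty. Then for any $\epsilon>0$ there is a neighborhood $U_h\subset\mathcal S(G)$ of $h$ such that for every $h'\in U_h$ the torus $\mathcal M_{h'}$ has a critical manifold $F'=F(V_N,h_N',\psi_N',\lambda')\subset \mathcal M_{h'}$ diffeomorphic to $F$, based on the same admissible set $V_N$, and associated to critical data $(V_N,h_N',\psi_N',\lambda')$ for $h'$ satisfying $$\|h_N'-h_N\|<\epsilon,\qquad \|\psi_N'-\psi_N\|<\epsilon,\qquad |\lambda'-\lambda|<\epsilon .$$
   Context: Graphs and matrices. A matrix $h$ indexed by $V$ is supported on $G$ if for $r\ne s$, $h_{rs}\neq0\Rightarrow (rs)\in E$; strictly supported if for $r\neq s$, $h_{rs}\ne0\iff(rs)\in E$. $\mathcal H(G)$, $\mathcal S(G)$, $\mathcal A(G)$ are the spaces of complex Hermitian, real symmetric, real antisymmetric matrices supported on $G$. For an induced subgraph $G_U$ on a vertex set $U$, $h|G_U$ is the principal submatrix with indices in $U$. Magnetic torus. For $h\in\mathcal S(G)$ strictly supported on $G$ and $\alpha\in\mathcal A(G)$ let $(h_\alpha)_{rs}=e^{i\alpha_{rs}}h_{rs}$. Matrices $h',h''\in\mathcal H(G)$ are gauge equivalent if $h''=e^{i\theta}h'e^{-i\theta}$ for some $\theta\in\mathbb R^V$, with $e^{i\theta}=\operatorname{diag}(e^{i\theta_1},\dots,e^{i\theta_n})$.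 $\mathcal M_h$ is the set of gauge equivalence classes $[h_\alpha]$, $\alpha\in\mathcal A(G)$. It is a torus of dimension $|E|-|V|+1$: with $(d\theta)_{rs}=\theta_r-\theta_s$ for $(rs)\in E$, it is the quotient of $\mathcal A(G)$ by $d\mathbb R^V$ and by matrices with entries in $2\pi\mathbb Z$. Genericity. A signing of a real symmetric matrix $h$ is a real symmetric $h'$ with $h'_{rr}=h_{rr}$ and $h'_{rs}=\pm h_{rs}$ for $r\neq s$. $h\in\mathcal S(G)$ is generic if (i) $h$ is strictly supported on $G$; (ii) for any induced subgraph $G_J$ of $G$ (including $G_J=G$) and any signing $h'$ of $h|G_J$, all eigenvalues of $h'$ are simple, and every eigenvector of $h'$ is nowhere vanishing on exactly one connected component of $G_J$. Admissible support. A (nonempty) subset $V_N\subset V$ is an admissible support if the subgraph $G_N$ induced by $V_N$ is connected and each vertex $r\notin V_N$ has either no neighbors in $V_N$ or at least three neighbors in $V_N$. Critical data. Critical data for $h$ is a quadruple $(V_N,h_N,\psi_N,\lambda)$ where $V_N$ is an admissible support, $h_N$ is a signing of $h|G_N$, and $\psi_N\in\mathbb C^{V_N}$ is an eigenvector of $h_N$ with eigenvalue $\lambda$. With $\psi$ the extension of $\psi_N$ by $0$ to $V$, the associated set is $$F(V_N,h_N,\psi_N,\lambda)=\{[h_\alpha]\in\mathcal M_h:\ h_\alpha|G_N=h_N\text{ and }h_\alpha\psi=\lambda\psi\}$$ (the conditions being imposed on some representative $h_\alpha$ of the class). For generic $h$ this set is a smooth submanifold of $\mathcal M_h$, called the critical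 (sub)manifold of the critical data. *)

theory Defs
  imports "HOL-Analysis.Analysis"
begin

section \<open>Graphs and supported matrices\<close>

text \<open>A finite simple graph has the finite type \<open>'v\<close> as vertex set and a symmetric irreflexive
  relation \<open>E\<close> as edge set (so each undirected edge occurs as two pairs).\<close>

definition simple_graph :: "('v::finite \<times> 'v) set \<Rightarrow> bool" where
  "simple_graph E \<longleftrightarrow> sym E \<and> irrefl E"

definition induces_connected :: "('v \<times> 'v) set \<Rightarrow> 'v set \<Rightarrow> bool" where
  "induces_connected E U \<longleftrightarrow> U \<noteq> {} \<and> (\<forall>r\<in>U. \<forall>s\<in>U. (r, s) \<in> (Restr E U)\<^sup>*)"

definition graph_components :: "('v \<times> 'v) set \<Rightarrow> 'v set \<Rightarrow> 'v set set" where
  "graph_components E U = (\<lambda>r. (Restr E U)\<^sup>* `` {r}) ` U"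

definition supported :: "('v::finite \<times> 'v) set \<Rightarrow> 'a::zero^'v^'v \<Rightarrow> bool" where
  "supported E h \<longleftrightarrow> (\<forall>r s. r \<noteq> s \<longrightarrow> h $ r $ s \<noteq> 0 \<longrightarrow> (r, s) \<in> E)"

definition strictly_supported :: "('v::finite \<times> 'v) set \<Rightarrow> 'a::zero^'v^'v \<Rightarrow> bool" where
  "strictly_supported E h \<longleftrightarrow> (\<forall>r s. r \<noteq> s \<longrightarrow> (h $ r $ s \<noteq> 0 \<longleftrightarrow> (r, s) \<in> E))"

definition hermitian_space :: "('v::finite \<times> 'v) set \<Rightarrow> (complex^'v^'v) set" where
  "hermitian_space E = {h. (\<forall>r s. h $ s $ r = cnj (h $ r $ s)) \<and> supported E h}"

definition symmetric_space :: "('v::finite \<times> 'v) set \<Rightarrow> (real^'v^'v) set" where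
  "symmetric_space E = {h. transpose h = h \<and> supported E h}"

definition antisymmetric_space :: "('v::finite \<times> 'v) set \<Rightarrow> (real^'v^'v) set" where
  "antisymmetric_space E = {\<alpha>. transpose \<alpha> = - \<alpha> \<and> supported E \<alpha>}"

text \<open>Matrices indexed by a vertex subset \<open>U\<close> are represented by matrices indexed by all vertices
  whose entries outside \<open>U \<times> U\<close> are zero, and vectors indexed by \<open>U\<close> by their extension by zero.\<close>

definition restrict_matrix :: "'v set \<Rightarrow> 'a::zero^'v^'v \<Rightarrow> 'a^('v::finite)^'v" where
  "restrict_matrix U h = (\<chi> r s. if r \<in> U \<and> s \<in> U then h $ r $ s else 0)"

definition is_signing :: "real^'v^'v \<Rightarrow> real^('v::finite)^'v \<Rightarrow> bool" where
  "is_signing h h' \<longleftrightarrow> transpose h' = h' \<and> (\<forall>r. h' $ r $ r = h $ r $ r) \<and>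
     (\<forall>r s. r \<noteq> s \<longrightarrow> h' $ r $ s = h $ r $ s \<or> h' $ r $ s = - h $ r $ s)"


section \<open>Eigenvectors and genericity\<close>

text \<open>For \<open>A\<close> vanishing outside \<open>U \<times> U\<close> this is the eigenspace of \<open>A\<close> as a matrix indexed by \<open>U\<close>:
  the condition on the support of \<open>\<psi>\<close> removes the spurious kernel vectors created by the zero
  extension of \<open>A\<close>. As the matrices in question are real symmetric, real \<open>\<mu>\<close> suffice.\<close>

definition eigenspace_on :: "'v set \<Rightarrow> real^'v^'v \<Rightarrow> real \<Rightarrow> (complex^('v::finite)) set" where
  "eigenspace_on U A \<mu> = {\<psi>. (\<forall>r. r \<notin> U \<longrightarrow> \<psi> $ r = 0) \<and>
     map_matrix complex_of_real A *v \<psi> = complex_of_real \<mu> *s \<psi>}"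

definition is_eigenvector_on :: "'v set \<Rightarrow> real^'v^'v \<Rightarrow> real \<Rightarrow> complex^('v::finite) \<Rightarrow> bool" where
  "is_eigenvector_on U A \<mu> \<psi> \<longleftrightarrow> \<psi> \<noteq> 0 \<and> \<psi> \<in> eigenspace_on U A \<mu>"

text \<open>Multiplicity is the complex dimension of the eigenspace; for symmetric matrices there is no
  difference between geometric and algebraic multiplicity.\<close>

definition simple_spectrum_on :: "'v set \<Rightarrow> real^'v^('v::finite) \<Rightarrow> bool" where
  "simple_spectrum_on U A \<longleftrightarrow>
     (\<forall>\<mu>. (\<exists>\<psi>. is_eigenvector_on U A \<mu> \<psi>) \<longrightarrow> vec.dim (eigenspace_on U A \<mu>) = 1)"

definition generic :: "('v::finite \<times> 'v) set \<Rightarrow> real^'v^'v \<Rightarrow> bool" where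
  "generic E h \<longleftrightarrow> h \<in> symmetric_space E \<and> strictly_supported E h \<and>
     (\<forall>J h'. is_signing (restrict_matrix J h) h' \<longrightarrow>
        simple_spectrum_on J h' \<and>
        (\<forall>\<mu> \<psi>. is_eigenvector_on J h' \<mu> \<psi> \<longrightarrow>
           (\<exists>!C. C \<in> graph_components E J \<and> (\<forall>r\<in>C. \<psi> $ r \<noteq> 0))))"


section \<open>The magnetic torus\<close>

definition magnetic :: "real^'v^'v \<Rightarrow> real^'v^'v \<Rightarrow> complex^('v::finite)^'v" where
  "magnetic h \<alpha> = (\<chi> r s. exp (\<i> * complex_of_real (\<alpha> $ r $ s)) * complex_of_real (h $ r $ s))"

definition gauge_matrix :: "real^'v \<Rightarrow> complex^('v::finite)^'v" where
  "gauge_matrix \<theta> = (\<chi> r s. if r = s then exp (\<i> * complex_of_real (\<theta> $ r)) else 0)"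

definition gauge_rel :: "('v::finite \<times> 'v) set \<Rightarrow> (complex^'v^'v) rel" where
  "gauge_rel E = {(h', h''). h' \<in> hermitian_space E \<and> h'' \<in> hermitian_space E \<and>
     (\<exists>\<theta>. h'' = gauge_matrix \<theta> ** h' ** gauge_matrix (- \<theta>))}"

definition gauge_class ::
    "('v::finite \<times> 'v) set \<Rightarrow> real^'v^'v \<Rightarrow> real^'v^'v \<Rightarrow> (complex^'v^'v) set" where
  "gauge_class E h \<alpha> = gauge_rel E `` {magnetic h \<alpha>}"

definition magnetic_torus :: "('v::finite \<times> 'v) set \<Rightarrow> real^'v^'v \<Rightarrow> (complex^'v^'v) set set" where
  "magnetic_torus E h = gauge_class E h ` antisymmetric_space E"


section \<open>Critical data\<close>

definition admissible_support :: "('v::finite \<times> 'v) set \<Rightarrow> 'v set \<Rightarrow> bool" where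
  "admissible_support E VN \<longleftrightarrow> VN \<noteq> {} \<and> induces_connected E VN \<and>
     (\<forall>r. r \<notin> VN \<longrightarrow> {s \<in> VN. (r, s) \<in> E} = {} \<or> 3 \<le> card {s \<in> VN. (r, s) \<in> E})"

definition critical_data ::
    "('v::finite \<times> 'v) set \<Rightarrow> real^'v^'v \<Rightarrow> 'v set \<Rightarrow> real^'v^'v \<Rightarrow> complex^'v \<Rightarrow> real \<Rightarrow> bool" where
  "critical_data E h VN hN \<psi> \<mu> \<longleftrightarrow> admissible_support E VN \<and>
     is_signing (restrict_matrix VN h) hN \<and> is_eigenvector_on VN hN \<mu> \<psi>"

definition critical_set ::
    "('v::finite \<times> 'v) set \<Rightarrow> real^'v^'v \<Rightarrow> 'v set \<Rightarrow> real^'v^'v \<Rightarrow> complex^'v \<Rightarrow> real \<Rightarrow>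
      (complex^'v^'v) set set" where
  "critical_set E h VN hN \<psi> \<mu> = {gauge_class E h \<alpha> | \<alpha>. \<alpha> \<in> antisymmetric_space E \<and>
     restrict_matrix VN (magnetic h \<alpha>) = map_matrix complex_of_real hN \<and>
     magnetic h \<alpha> *v \<psi> = complex_of_real \<mu> *s \<psi>}"


section \<open>Smoothness on the magnetic torus\<close>

text \<open>Only meant for open \<open>S\<close>; the directional derivatives along all \<open>v\<close> make up the derivative.\<close>

fun C_k_on :: "nat \<Rightarrow> 'a::euclidean_space set \<Rightarrow> ('a \<Rightarrow> 'b::real_normed_vector) \<Rightarrow> bool" where
  "C_k_on 0 S f \<longleftrightarrow> continuous_on S f"
| "C_k_on (Suc k) S f \<longleftrightarrow> (\<forall>x\<in>S. f differentiable (at x)) \<and>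
     (\<forall>v. C_k_on k S (\<lambda>x. frechet_derivative f (at x) v))"

definition smooth_on :: "'a::euclidean_space set \<Rightarrow> ('a \<Rightarrow> 'b::real_normed_vector) \<Rightarrow> bool" where
  "smooth_on S f \<longleftrightarrow> (\<forall>k. C_k_on k S f)"

text \<open>Embedded submanifold of dimension \<open>d\<close>, by slice charts \<open>\<Phi>\<close> with inverse \<open>\<Psi>\<close>.\<close>

definition smooth_submanifold :: "nat \<Rightarrow> 'a::euclidean_space set \<Rightarrow> bool" where
  "smooth_submanifold d S \<longleftrightarrow> (\<forall>x\<in>S. \<exists>U W L. \<exists>\<Phi> \<Psi> :: 'a \<Rightarrow> 'a.
     open U \<and> x \<in> U \<and> open W \<and> smooth_on U \<Phi> \<and> smooth_on W \<Psi> \<and>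
     (\<forall>y\<in>U. \<Phi> y \<in> W \<and> \<Psi> (\<Phi> y) = y) \<and> (\<forall>z\<in>W. \<Psi> z \<in> U \<and> \<Phi> (\<Psi> z) = z) \<and>
     subspace L \<and> dim L = d \<and> \<Phi> ` (S \<inter> U) = L \<inter> W)"

text \<open>For strictly supported \<open>h\<close> the map \<open>gauge_class E h\<close> presents the magnetic torus as the
  quotient of the vector space \<open>antisymmetric_space E\<close> by coboundaries and matrices with entries in \<open>2\<pi>\<int>\<close>,
  and it is a surjective submersion. Hence a subset of the torus is a submanifold iff its preimage
  is one (of a dimension larger by the dimension of the space of coboundaries), and a map between
  subsets of two tori is smooth (i.e. locally the restriction of a smooth map between the tori)
  iff locally it lifts to a smooth map between the vector spaces.\<close>

definition torus_submanifold ::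
    "('v::finite \<times> 'v) set \<Rightarrow> real^'v^'v \<Rightarrow> (complex^'v^'v) set set \<Rightarrow> bool" where
  "torus_submanifold E h F \<longleftrightarrow> F \<subseteq> magnetic_torus E h \<and>
     (\<exists>d. smooth_submanifold d {\<alpha> \<in> antisymmetric_space E. gauge_class E h \<alpha> \<in> F})"

definition torus_smooth_on ::
    "('v::finite \<times> 'v) set \<Rightarrow> real^'v^'v \<Rightarrow> real^'v^'v \<Rightarrow> (complex^'v^'v) set set \<Rightarrow>
      ((complex^'v^'v) set \<Rightarrow> (complex^'v^'v) set) \<Rightarrow> bool" where
  "torus_smooth_on E h h' F f \<longleftrightarrow>
     (\<forall>\<alpha>\<in>antisymmetric_space E. gauge_class E h \<alpha> \<in> F \<longrightarrow>
       (\<exists>W \<Phi>. open W \<and> \<alpha> \<in> W \<and> smooth_on W \<Phi> \<and>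
         (\<forall>\<beta> \<in> W \<inter> antisymmetric_space E. \<Phi> \<beta> \<in> antisymmetric_space E \<and>
           (gauge_class E h \<beta> \<in> F \<longrightarrow> gauge_class E h' (\<Phi> \<beta>) = f (gauge_class E h \<beta>)))))"

definition torus_diffeomorphic ::
    "('v::finite \<times> 'v) set \<Rightarrow> real^'v^'v \<Rightarrow> (complex^'v^'v) set set \<Rightarrow>
      real^'v^'v \<Rightarrow> (complex^'v^'v) set set \<Rightarrow> bool" where
  "torus_diffeomorphic E h F h' F' \<longleftrightarrow> F \<subseteq> magnetic_torus E h \<and> F' \<subseteq> magnetic_torus E h' \<and>
     (\<exists>f. bij_betw f F F' \<and> torus_smooth_on E h h' F f \<and>
        torus_smooth_on E h' h F' (inv_into F f))"

end

theory Submission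
  imports Defs
begin

text \<open>After fixing the gauge on \<open>VN\<close>, the preimage of the critical set in the space of antisymmetric
  matrices consists of planar linkages: for each vertex \<open>r\<close> outside \<open>VN\<close> the unit vectors
  \<open>z\<^sub>s = \<plusminus> cis (\<alpha>\<^sub>r\<^sub>s)\<close> close up, \<open>\<Sum>\<^sub>s m\<^sub>r\<^sub>s z\<^sub>s = 0\<close>, with lengths \<open>m\<^sub>r\<^sub>s = \<bar>h\<^sub>r\<^sub>s \<psi>\<^sub>s\<bar>\<close>. Genericity of \<open>h\<close> on
  \<open>insert r VN\<close> says precisely that no such linkage is collinear, so the closing conditions are
  submersive. Under a perturbation of \<open>h\<close> the simple eigenpair moves smoothly, hence the lengths \<open>m\<close>
  move slightly to \<open>m'\<close>. A configuration closed for \<open>m\<close> is carried to one closed for \<open>m'\<close> by the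
  unique Moebius map \<open>z \<mapsto> (z + w) / (1 + cnj w z)\<close> of the disc that balances it for the weights \<open>m'\<close>
  (conformal barycentre). This needs no flow: the map is equivariant under rotations, hence under
  gauge transformations, smooth by the implicit function theorem, and inverted by exchanging \<open>m\<close> and
  \<open>m'\<close>, because the inverse of the Moebius map with parameter \<open>w\<close> has parameter \<open>- w\<close>.\<close>

section \<open>Smooth maps and the inverse function theorem\<close>

text \<open>Genericity is used at \<open>h\<close> only. What passes to a nearby \<open>h'\<close>
  are open conditions: nonzero entries stay nonzero, and the finitely many signed sums of lengths
  keep a positive gap. Beyond this, closeness of the two length functions matters only for the
  existence of the balancing map, where a field pointing outward along a circle has to keep doing
  so; uniqueness and smooth dependence hold for all nondegenerate positive lengths. As submanifolds
  and smooth maps of the torus are expressed through antisymmetric matrices, everything is carried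
  out on the full preimage of the critical set, not on representatives equal to
  \<open>\<alpha>0\<close> on \<open>VN\<close>. Path sums towards a root vertex supply the
  normalising phases as linear functions of the matrix. Angles are corrected by principal logarithms
  of numbers with positive real part, which makes the transport a map of matrices, and not merely of
  phases, with an exact inverse. The signs of the real products \<open>h u\<close> are absorbed once
  for all into the directions, because the monotonicity argument needs positive lengths.\<close>

lemma C_k_on_cong:
  assumes "open S" "\<And>x. x \<in> S \<Longrightarrow> f x = g x" "C_k_on k S f"
  shows "C_k_on k S g"
  using assms(2,3)
proof (induction k arbitrary: f g)
  case 0
  then show ?case by (simp cong: continuous_on_cong)
next
  case (Suc k)
  have diff: "f differentiable at x" if "x \<in> S" for x
    using Suc.prems that by simp
  have "g differentiable at x" if "x \<in> S" for x
    using diff[OF that] has_derivative_transform_within_open[OF _ \<open>open S\<close> that, of f _ UNIV g] Suc.prems(1)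
    unfolding differentiable_def by blast
  moreover have "C_k_on k S (\<lambda>x. frechet_derivative g (at x) v)" for v
  proof (rule Suc.IH)
    show "C_k_on k S (\<lambda>x. frechet_derivative f (at x) v)"
      using Suc.prems by simp
    show "frechet_derivative f (at x) v = frechet_derivative g (at x) v" if "x \<in> S" for x
      by (rule fun_cong[OF frechet_derivative_transform_within_open[OF diff[OF that] \<open>open S\<close> that]])
        (use Suc.prems in auto)
  qed
  ultimately show ?case by simp
qed

lemma C_k_on_SucI:
  assumes "open S" "\<And>x. x \<in> S \<Longrightarrow> (f has_derivative f' x) (at x)"
    and "\<And>v. C_k_on k S (\<lambda>x. f' x v)"
  shows "C_k_on (Suc k) S f"
proof -
  have "C_k_on k S (\<lambda>x. frechet_derivative f (at x) v)" for v
    using assms(2) by (intro C_k_on_cong[OF \<open>open S\<close> _ assms(3)[of v]])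
      (metis frechet_derivative_at)
  then show ?thesis
    using assms(2) unfolding C_k_on.simps differentiable_def by blast
qed

lemma C_k_on_has_derivative:
  assumes "C_k_on (Suc k) S f" "x \<in> S"
  shows "(f has_derivative frechet_derivative f (at x)) (at x)"
  using assms frechet_derivative_works by auto

lemma C_k_on_continuous:
  assumes "C_k_on k S f"
  shows "continuous_on S f"
proof (cases k)
  case (Suc l)
  then show ?thesis
    using assms by (auto intro!: continuous_at_imp_continuous_on differentiable_imp_continuous_within)
qed (use assms in auto)

lemma C_k_on_SucD:
  assumes "C_k_on (Suc k) S f"
  shows "C_k_on k S f"
  using assms
proof (induction k arbitrary: f)
  case 0
  from C_k_on_continuous[OF this] show ?case by simp
qed auto

lemma C_k_on_subset:
  assumes "C_k_on k S f" "T \<subseteq> S"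
  shows "C_k_on k T f"
  using assms
  by (induction k arbitrary: f) (auto intro: continuous_on_subset)

lemma C_k_on_const: "C_k_on k S (\<lambda>x. c)"
  by (induction k arbitrary: c) auto

lemma C_k_on_bounded_linear:
  assumes "open S" "bounded_linear L" "C_k_on k S f"
  shows "C_k_on k S (\<lambda>x. L (f x))"
  using assms(3)
proof (induction k arbitrary: f)
  case 0
  then show ?case using bounded_linear.continuous_on[OF assms(2)] by auto
next
  case (Suc k)
  show ?case
    by (rule C_k_on_SucI[OF \<open>open S\<close> bounded_linear.has_derivative[OF assms(2)
            C_k_on_has_derivative[OF Suc.prems]]])
      (use Suc in auto)
qed

lemma C_k_on_linear:
  assumes "open S" "bounded_linear L"
  shows "C_k_on k S L"
proof (cases k)
  case 0
  then show ?thesis using assms(2) by (simp add: linear_continuous_on)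
next
  case (Suc l)
  then show ?thesis
    by (auto intro!: C_k_on_SucI[OF \<open>open S\<close> bounded_linear_imp_has_derivative[OF assms(2)]]
        C_k_on_const simp del: C_k_on.simps)
qed

lemma C_k_on_add:
  assumes "open S" "C_k_on k S f" "C_k_on k S g"
  shows "C_k_on k S (\<lambda>x. f x + g x)"
  using assms(2,3)
proof (induction k arbitrary: f g)
  case 0
  then show ?case by (simp add: continuous_on_add)
next
  case (Suc k)
  show ?case
    by (rule C_k_on_SucI[OF \<open>open S\<close> has_derivative_add[OF C_k_on_has_derivative[OF Suc.prems(1)]
            C_k_on_has_derivative[OF Suc.prems(2)]]])
      (use Suc in auto)
qed

lemma C_k_on_sum:
  assumes "open S" "\<And>i. i \<in> I \<Longrightarrow> C_k_on k S (f i)"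
  shows "C_k_on k S (\<lambda>x. \<Sum>i\<in>I. f i x)"
  using assms(2)
  by (induction I rule: infinite_finite_induct) (simp_all add: C_k_on_const C_k_on_add[OF \<open>open S\<close>])

lemma C_k_on_bilinear:
  assumes "open S" "bounded_bilinear pr" "C_k_on k S f" "C_k_on k S g"
  shows "C_k_on k S (\<lambda>x. pr (f x) (g x))"
  using assms(3,4)
proof (induction k arbitrary: f g)
  case 0
  then show ?case using bounded_bilinear.continuous_on[OF assms(2)] by auto
next
  case (Suc k)
  show ?case
  proof (rule C_k_on_SucI[OF \<open>open S\<close> bounded_bilinear.FDERIV[OF assms(2)
          C_k_on_has_derivative[OF Suc.prems(1)] C_k_on_has_derivative[OF Suc.prems(2)]]])
    fix v
    show "C_k_on k S (\<lambda>x. pr (f x) (frechet_derivative g (at x) v) +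
        pr (frechet_derivative f (at x) v) (g x))"
      by (intro C_k_on_add Suc.IH assms(1)) (use Suc.prems C_k_on_SucD in auto)
  qed auto
qed

lemma C_k_on_compose:
  fixes f :: "'a::euclidean_space \<Rightarrow> 'b::euclidean_space"
    and g :: "'b \<Rightarrow> 'c::real_normed_vector"
  assumes "open S" "open T" "f ` S \<subseteq> T" "C_k_on k S f" "C_k_on k T g"
  shows "C_k_on k S (\<lambda>x. g (f x))"
  using assms(4,5)
proof (induction k arbitrary: g)
  case 0
  then show ?case
    using assms(3) by (auto intro!: continuous_on_compose2[of T g])
next
  case (Suc k)
  have df: "(f has_derivative frechet_derivative f (at x)) (at x)" if "x \<in> S" for x
    using C_k_on_has_derivative[OF Suc.prems(1) that] .
  have dg: "(g has_derivative frechet_derivative g (at y)) (at y)" if "y \<in> T" for y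
    using C_k_on_has_derivative[OF Suc.prems(2) that] .
  show ?case
  proof (rule C_k_on_SucI[OF \<open>open S\<close>])
    fix x assume x: "x \<in> S"
    show "((\<lambda>x. g (f x)) has_derivative
        (\<lambda>v. frechet_derivative g (at (f x)) (frechet_derivative f (at x) v))) (at x)"
      using has_derivative_compose[OF df[OF x] dg] assms(3) x by blast
  next
    fix v
    \<comment> \<open>Expanding the inner derivative in the basis turns the chain rule into sums of
      products, to which the induction hypothesis for the directional derivatives of
      \<open>g\<close> applies.\<close>
    have "C_k_on k S (\<lambda>x. \<Sum>b\<in>Basis. (frechet_derivative f (at x) v \<bullet> b) *\<^sub>R
        frechet_derivative g (at (f x)) b)"
      by (intro C_k_on_sum C_k_on_bilinear[OF \<open>open S\<close> bounded_bilinear_scaleR] assms(1)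
          C_k_on_bounded_linear[OF \<open>open S\<close> bounded_linear_inner_left]
          Suc.IH[where g = "\<lambda>y. frechet_derivative g (at y) _"])
        (use Suc.prems C_k_on_SucD in auto)
    then show "C_k_on k S (\<lambda>x. frechet_derivative g (at (f x)) (frechet_derivative f (at x) v))"
    proof (rule C_k_on_cong[OF \<open>open S\<close>, rotated])
      fix x assume "x \<in> S"
      then have l: "linear (frechet_derivative g (at (f x)))"
        using dg assms(3) has_derivative_linear by blast
      show "(\<Sum>b\<in>Basis. (frechet_derivative f (at x) v \<bullet> b) *\<^sub>R frechet_derivative g (at (f x)) b) =
          frechet_derivative g (at (f x)) (frechet_derivative f (at x) v)"
        unfolding linear_cmul[OF l, symmetric] linear_sum[OF l, symmetric]
        by (simp add: euclidean_representation)
    qed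
  qed
qed

text \<open>A finite basis assembles the directional derivatives of \<open>C_k_on\<close> into an
  operator-valued derivative, as a sum of rank-one operators. In this form a derivative can be
  inverted.\<close>

lemma C_k_on_blinfun_derivative:
  fixes f :: "'a::euclidean_space \<Rightarrow> 'b::real_normed_vector"
  assumes "open S" "C_k_on (Suc k) S f"
  shows "C_k_on k S (\<lambda>x. Blinfun (frechet_derivative f (at x)))"
proof (rule C_k_on_cong[OF \<open>open S\<close>])
  show "C_k_on k S (\<lambda>x. \<Sum>b\<in>Basis. blinfun_scaleR_left (frechet_derivative f (at x) b) o\<^sub>L
      blinfun_inner_left b)"
    by (intro C_k_on_sum C_k_on_bounded_linear[OF \<open>open S\<close>
          bounded_bilinear.bounded_linear_left[OF bounded_bilinear_blinfun_compose]]
        C_k_on_bounded_linear[OF \<open>open S\<close> bounded_linear_blinfun_scaleR_left] assms(1))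
      (use assms(2) in auto)
  fix x assume "x \<in> S"
  then have bl: "bounded_linear (frechet_derivative f (at x))"
    using C_k_on_has_derivative[OF assms(2)] has_derivative_bounded_linear by blast
  show "(\<Sum>b\<in>Basis. blinfun_scaleR_left (frechet_derivative f (at x) b) o\<^sub>L blinfun_inner_left b) =
      Blinfun (frechet_derivative f (at x))"
  proof (rule blinfun_eqI)
    fix v
    have "frechet_derivative f (at x) v =
        frechet_derivative f (at x) (\<Sum>b\<in>Basis. (v \<bullet> b) *\<^sub>R b)"
      by (simp add: euclidean_representation)
    also have "\<dots> = (\<Sum>b\<in>Basis. (v \<bullet> b) *\<^sub>R frechet_derivative f (at x) b)"
      by (simp add: bounded_linear.linear[OF bl] linear_sum linear_cmul)
    finally show "blinfun_apply (\<Sum>b\<in>Basis. blinfun_scaleR_left (frechet_derivative f (at x) b) o\<^sub>L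
        blinfun_inner_left b) v = blinfun_apply (Blinfun (frechet_derivative f (at x))) v"
      by (simp add: bounded_linear_Blinfun_apply[OF bl] blinfun.sum_left inner_commute)
  qed
qed

section \<open>Differentiation of operator inverses\<close>

lemma blinfun_inverse_diff:
  fixes A B A' B' :: "'a::real_normed_vector \<Rightarrow>\<^sub>L 'a"
  assumes "B o\<^sub>L A = id_blinfun" "A' o\<^sub>L B' = id_blinfun"
  shows "B - B' = - (B o\<^sub>L (A - A') o\<^sub>L B')"
proof (rule blinfun_eqI)
  fix v
  have "A' (B' v) = v" "B (A (B' v)) = B' v"
    using arg_cong[OF assms(1), of "\<lambda>f. blinfun_apply f (B' v)"]
      arg_cong[OF assms(2), of "\<lambda>f. blinfun_apply f v"] by simp_all
  then show "blinfun_apply (B - B') v = blinfun_apply (- (B o\<^sub>L (A - A') o\<^sub>L B')) v"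
    by (simp add: blinfun.bilinear_simps)
qed

text \<open>At a zero of the second factor the product rule never differentiates the first, so
  continuity of \<open>P\<close> is enough. With \<open>P\<close> an operator inverse this avoids
  assuming the differentiability that is to be proved.\<close>

lemma has_derivative_bilinear_continuous:
  assumes "bounded_bilinear pr" "isCont P x" "(Q has_derivative Q') (at x)" "Q x = 0"
  shows "((\<lambda>y. pr (P y) (Q y)) has_derivative (\<lambda>v. pr (P x) (Q' v))) (at x)"
proof -
  interpret bounded_bilinear pr by fact
  obtain K where K: "\<And>a b. norm (pr a b) \<le> norm a * norm b * K" "K > 0"
    using pos_bounded by blast
  have Q'bl: "bounded_linear Q'" using assms(3) has_derivative_bounded_linear by blast
  obtain C where C: "\<And>v. norm (Q' v) \<le> norm v * C" "C > 0"
    using bounded_linear.pos_bounded[OF Q'bl] by blast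
  show ?thesis
    unfolding has_derivative_at
  proof
    show "bounded_linear (\<lambda>v. pr (P x) (Q' v))"
      using bounded_linear_compose[OF bounded_linear_right Q'bl] .
    have R: "(\<lambda>h. norm (Q (x + h) - Q x - Q' h) / norm h) \<midarrow>0\<rightarrow> 0"
      using assms(3) unfolding has_derivative_at by blast
    have P: "(\<lambda>h. norm (P (x + h) - P x)) \<midarrow>0\<rightarrow> 0"
      using assms(2) unfolding isCont_iff by (simp add: LIM_zero tendsto_norm_zero)
    have Pc: "(\<lambda>h. norm (P (x + h))) \<midarrow>0\<rightarrow> norm (P x)"
      using assms(2) unfolding isCont_iff by (simp add: tendsto_norm)
    have lim: "(\<lambda>h. (norm (P (x + h)) * (norm (Q (x + h) - Q x - Q' h) / norm h) +
        norm (P (x + h) - P x) * C) * K) \<midarrow>0\<rightarrow> (norm (P x) * 0 + 0 * C) * K"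
      by (intro tendsto_intros R P Pc)
    show "(\<lambda>h. norm (pr (P (x + h)) (Q (x + h)) - pr (P x) (Q x) - pr (P x) (Q' h)) / norm h)
        \<midarrow>0\<rightarrow> 0"
    proof (rule Lim_null_comparison[OF _ lim[simplified]], rule always_eventually, rule allI)
      fix h
      have "pr (P (x + h)) (Q (x + h)) - pr (P x) (Q x) - pr (P x) (Q' h) =
          pr (P (x + h)) (Q (x + h) - Q x - Q' h) + pr (P (x + h) - P x) (Q' h)"
        using assms(4) by (simp add: diff_left diff_right zero_right)
      then have "norm (pr (P (x + h)) (Q (x + h)) - pr (P x) (Q x) - pr (P x) (Q' h)) \<le>
          norm (P (x + h)) * norm (Q (x + h) - Q x - Q' h) * K +
          norm (P (x + h) - P x) * norm (Q' h) * K"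
        using order_trans[OF norm_triangle_ineq add_mono[OF K(1) K(1)]] by simp
      also have "\<dots> \<le> norm (P (x + h)) * norm (Q (x + h) - Q x - Q' h) * K +
          norm (P (x + h) - P x) * (norm h * C) * K"
        using C(1)[of h] K(2)
        by (intro add_left_mono mult_right_mono[OF mult_left_mono]) (simp_all add: less_imp_le)
      finally have le: "norm (pr (P (x + h)) (Q (x + h)) - pr (P x) (Q x) - pr (P x) (Q' h))
          \<le> \<dots>" .
      show "norm (norm (pr (P (x + h)) (Q (x + h)) - pr (P x) (Q x) - pr (P x) (Q' h)) / norm h)
          \<le> (norm (P (x + h)) * norm (Q (x + h) - Q x - Q' h) / norm h +
             norm (P (x + h) - P x) * C) * K"
      proof (cases "h = 0")
        case False
        then show ?thesis using le by (simp add: field_simps)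
      qed (use C(2) K(2) in simp)
    qed
  qed
qed

text \<open>The resolvent identity yields first continuity of the inverse, then its derivative
  \<open>- B A' B\<close>; that formula needs \<open>B\<close> only one order lower, which drives
  the induction.\<close>

lemma C_k_on_blinfun_inverse:
  fixes A B :: "'a::euclidean_space \<Rightarrow> 'b::real_normed_vector \<Rightarrow>\<^sub>L 'b"
  assumes "open S" "C_k_on k S A"
    and BA: "\<And>x. x \<in> S \<Longrightarrow> B x o\<^sub>L A x = id_blinfun"
    and AB: "\<And>x. x \<in> S \<Longrightarrow> A x o\<^sub>L B x = id_blinfun"
  shows "C_k_on k S B"
proof -
  have cont: "isCont B x" if x: "x \<in> S" for x
  proof -
    have "isCont A x"
      using C_k_on_continuous[OF assms(2)] x \<open>open S\<close> continuous_on_eq_continuous_at by blast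
    then have A: "((\<lambda>y. norm (A y - A x)) \<longlongrightarrow> 0) (at x)"
      unfolding isCont_def by (simp add: LIM_zero tendsto_norm_zero)
    define b where "b = norm (B x)"
    have b0: "b \<ge> 0" by (simp add: b_def)
    have "((\<lambda>y. norm (A y - A x) * b) \<longlongrightarrow> 0 * b) (at x)"
      by (intro tendsto_intros A)
    \<comment> \<open>The bound 1/2 allows \<open>norm (B y) / 2\<close> to be absorbed on the left,
      so \<open>B\<close> stays bounded by \<open>2 * b\<close> near \<open>x\<close>.\<close>
    then have "\<forall>\<^sub>F y in at x. norm (A y - A x) * b < 1 / 2"
      by (intro order_tendstoD) auto
    moreover have "\<forall>\<^sub>F y in at x. y \<in> S"
      using \<open>open S\<close> x by (simp add: eventually_at_in_open')
    ultimately have "\<forall>\<^sub>F y in at x. norm (B y - B x) \<le> 2 * b * norm (A y - A x) * b"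
    proof eventually_elim
      case (elim y)
      have "norm (B y - B x) = norm (B y o\<^sub>L (A y - A x) o\<^sub>L B x)"
        using blinfun_inverse_diff[OF BA[OF elim(2)] AB[OF x]] by simp
      also have "\<dots> \<le> norm (B y o\<^sub>L (A y - A x)) * norm (B x)"
        by (rule norm_blinfun_compose)
      also have "\<dots> \<le> norm (B y) * norm (A y - A x) * norm (B x)"
        by (intro mult_right_mono norm_blinfun_compose) auto
      finally have *: "norm (B y - B x) \<le> norm (B y) * norm (A y - A x) * b"
        by (simp add: b_def)
      have "norm (B y) \<le> b + norm (B y - B x)"
        unfolding b_def by (metis norm_triangle_sub)
      also have "\<dots> \<le> b + norm (B y) * (1 / 2)"
        using * elim(1) by (smt (verit) mult.assoc mult_left_mono norm_ge_zero)
      finally have "norm (B y) \<le> 2 * b" by simp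
      then show ?case
        using * b0 by (smt (verit) mult_right_mono norm_ge_zero)
    qed
    moreover have "((\<lambda>y. 2 * b * norm (A y - A x) * b) \<longlongrightarrow> 2 * b * 0 * b) (at x)"
      by (intro tendsto_intros A)
    ultimately have "((\<lambda>y. B y - B x) \<longlongrightarrow> 0) (at x)"
      by (auto intro: Lim_null_comparison)
    then show ?thesis
      unfolding isCont_def by (simp add: LIM_zero_cancel)
  qed
  show ?thesis
    using assms(2)
  proof (induction k)
    case 0
    then show ?case using cont by (simp add: continuous_at_imp_continuous_on)
  next
    case (Suc k)
    note CA = C_k_on_SucD[OF Suc.prems]
    note comp = bounded_bilinear_blinfun_compose
    show ?case
    proof (rule C_k_on_SucI[OF \<open>open S\<close>])
      fix x assume x: "x \<in> S"
      \<comment> \<open>\<open>B y\<close> is rewritten as \<open>B x - B y (A y - A x) B x\<close>: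
        the middle factor vanishes at \<open>x\<close>, so only continuity of \<open>B\<close>
        enters.\<close>
      have "((\<lambda>y. A y - A x) has_derivative frechet_derivative A (at x)) (at x)"
        using has_derivative_diff[OF C_k_on_has_derivative[OF Suc.prems x] has_derivative_const] by simp
      then have "((\<lambda>y. B y o\<^sub>L (A y - A x)) has_derivative
          (\<lambda>v. B x o\<^sub>L frechet_derivative A (at x) v)) (at x)"
        by (intro has_derivative_bilinear_continuous[OF comp cont[OF x]]) auto
      then have "((\<lambda>y. (B y o\<^sub>L (A y - A x)) o\<^sub>L B x) has_derivative
          (\<lambda>v. (B x o\<^sub>L frechet_derivative A (at x) v) o\<^sub>L B x)) (at x)"
        by (rule bounded_linear.has_derivative[OF bounded_bilinear.bounded_linear_left[OF comp]])
      then have "((\<lambda>y. B x - ((B y o\<^sub>L (A y - A x)) o\<^sub>L B x)) has_derivative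
          (\<lambda>v. 0 - ((B x o\<^sub>L frechet_derivative A (at x) v) o\<^sub>L B x))) (at x)"
        by (intro derivative_intros)
      then show "(B has_derivative
          (\<lambda>v. 0 - ((B x o\<^sub>L frechet_derivative A (at x) v) o\<^sub>L B x))) (at x)"
      proof (rule has_derivative_transform_within_open[OF _ \<open>open S\<close> x])
        fix y assume "y \<in> S"
        then show "B x - ((B y o\<^sub>L (A y - A x)) o\<^sub>L B x) = B y"
          using blinfun_inverse_diff[OF BA AB[OF x], of y] by (simp add: algebra_simps)
      qed
    next
      fix v
      have "C_k_on k S (\<lambda>x. (B x o\<^sub>L frechet_derivative A (at x) v) o\<^sub>L B x)"
        by (intro C_k_on_bilinear[OF \<open>open S\<close> comp] Suc.IH CA) (use Suc.prems in auto)
      from C_k_on_bounded_linear[OF \<open>open S\<close> bounded_linear_minus[OF bounded_linear_ident] this]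
      show "C_k_on k S (\<lambda>x. 0 - ((B x o\<^sub>L frechet_derivative A (at x) v) o\<^sub>L B x))" by simp
    qed
  qed
qed

lemma smooth_on_has_derivative:
  assumes "smooth_on S f" "x \<in> S"
  shows "(f has_derivative frechet_derivative f (at x)) (at x)"
  using assms C_k_on_has_derivative unfolding smooth_on_def by blast

text \<open>The local inverse \<open>g\<close> is at first only differentiable, with derivative
  inverse to \<open>f' (g y)\<close>. If \<open>g\<close> is of class \<open>k\<close>, so are
  \<open>f'\<close> along \<open>g\<close> and its operator inverse, and hence \<open>g\<close> is
  of class \<open>k + 1\<close>.\<close>

theorem smooth_inverse_function:
  fixes f :: "'a::euclidean_space \<Rightarrow> 'a"
  assumes "open U" "smooth_on U f" "x0 \<in> U"
    and inj: "\<And>v. frechet_derivative f (at x0) v = 0 \<Longrightarrow> v = 0"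
  obtains U' V g where "open U'" "U' \<subseteq> U" "x0 \<in> U'" "open V" "f x0 \<in> V"
    "homeomorphism U' V f g" "smooth_on V g"
proof -
  define f' where "f' x = Blinfun (frechet_derivative f (at x))" for x
  have df: "(f has_derivative frechet_derivative f (at x)) (at x)" if "x \<in> U" for x
    using smooth_on_has_derivative[OF assms(2) that] .
  have f'_apply: "blinfun_apply (f' x) = frechet_derivative f (at x)" if "x \<in> U" for x
    unfolding f'_def
    using df[OF that] by (intro bounded_linear_Blinfun_apply) (rule has_derivative_bounded_linear)
  have Cf': "C_k_on k U f'" for k
    unfolding f'_def using assms(1,2)
    by (intro C_k_on_blinfun_derivative) (auto simp: smooth_on_def simp del: C_k_on.simps)
  have lin: "linear (frechet_derivative f (at x0))"
    using df[OF \<open>x0 \<in> U\<close>] has_derivative_linear by blast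
  moreover have "inj (frechet_derivative f (at x0))"
    using inj linear_injective_0[OF lin] by blast
  ultimately obtain g0 where g0: "linear g0" "g0 \<circ> frechet_derivative f (at x0) = id"
    using linear_injective_left_inverse by blast
  have "Blinfun g0 o\<^sub>L f' x0 = id_blinfun"
    using g0 by (intro blinfun_eqI)
      (simp add: f'_apply[OF \<open>x0 \<in> U\<close>] bounded_linear_Blinfun_apply linear_conv_bounded_linear
        pointfree_idE)
  then obtain U' V g g' where g: "open U'" "U' \<subseteq> U" "x0 \<in> U'" "open V" "f x0 \<in> V"
    "homeomorphism U' V f g"
    "\<And>y. y \<in> V \<Longrightarrow> (g has_derivative (g' y)) (at y)"
    "\<And>y. y \<in> V \<Longrightarrow> g' y = inv (blinfun_apply (f' (g y)))"
    "\<And>y. y \<in> V \<Longrightarrow> bij (blinfun_apply (f' (g y)))"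
    using inverse_function_theorem[OF \<open>open U\<close>, of f f' x0 "Blinfun g0"] df f'_apply
      C_k_on_continuous[OF Cf'] \<open>x0 \<in> U\<close> by metis
  have gV: "g ` V \<subseteq> U"
    using g(2,6) by (auto simp: homeomorphism_def)
  have B_apply: "blinfun_apply (Blinfun (g' y)) = g' y" if "y \<in> V" for y
    using g(7)[OF that] by (intro bounded_linear_Blinfun_apply) (rule has_derivative_bounded_linear)
  have "C_k_on k V g" for k
  proof (induction k)
    case 0
    then show ?case using g(6) by (simp add: homeomorphism_def)
  next
    case (Suc k)
    have "C_k_on k V (\<lambda>y. f' (g y))"
      by (rule C_k_on_compose[OF g(4) \<open>open U\<close> gV Suc Cf'])
    then have B: "C_k_on k V (\<lambda>y. Blinfun (g' y))"
    proof (rule C_k_on_blinfun_inverse[OF g(4)])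
      fix y assume y: "y \<in> V"
      show "Blinfun (g' y) o\<^sub>L f' (g y) = id_blinfun"
        using bij_is_inj[OF g(9)[OF y]]
        by (intro blinfun_eqI) (simp add: B_apply[OF y], simp add: g(8)[OF y])
      show "f' (g y) o\<^sub>L Blinfun (g' y) = id_blinfun"
        using bij_is_surj[OF g(9)[OF y]] by (intro blinfun_eqI) (simp add: B_apply[OF y], simp add: g(8)[OF y] surj_f_inv_f)
    qed
    show ?case
    proof (rule C_k_on_SucI[OF g(4,7)])
      fix v
      show "C_k_on k V (\<lambda>y. g' y v)"
      proof (rule C_k_on_cong[OF g(4)])
        show "C_k_on k V (\<lambda>y. blinfun_apply (Blinfun (g' y)) v)"
          by (rule C_k_on_bounded_linear[OF g(4) blinfun.bounded_linear_left B])
      qed (simp add: B_apply)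
    qed auto
  qed
  then show ?thesis
    using that g(1-6) by (auto simp: smooth_on_def)
qed

section \<open>Calculus of infinitely differentiable maps\<close>

lemma smooth_on_subset: "smooth_on S f \<Longrightarrow> T \<subseteq> S \<Longrightarrow> smooth_on T f"
  unfolding smooth_on_def using C_k_on_subset by blast

lemma smooth_on_continuous: "smooth_on S f \<Longrightarrow> continuous_on S f"
  unfolding smooth_on_def using C_k_on_continuous by blast

lemma smooth_on_const: "smooth_on S (\<lambda>x. c)"
  unfolding smooth_on_def using C_k_on_const by blast

lemma smooth_on_linear: "open S \<Longrightarrow> bounded_linear L \<Longrightarrow> smooth_on S L"
  unfolding smooth_on_def using C_k_on_linear by blast

lemma smooth_on_bounded_linear:
  "open S \<Longrightarrow> bounded_linear L \<Longrightarrow> smooth_on S f \<Longrightarrow> smooth_on S (\<lambda>x. L (f x))"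
  unfolding smooth_on_def using C_k_on_bounded_linear by blast

lemma smooth_on_add:
  "open S \<Longrightarrow> smooth_on S f \<Longrightarrow> smooth_on S g \<Longrightarrow> smooth_on S (\<lambda>x. f x + g x)"
  unfolding smooth_on_def using C_k_on_add by blast

lemma smooth_on_diff:
  assumes "open S" "smooth_on S f" "smooth_on S g"
  shows "smooth_on S (\<lambda>x. f x - g x)"
  using smooth_on_add[OF assms(1,2) smooth_on_bounded_linear[OF assms(1)
        bounded_linear_minus[OF bounded_linear_ident] assms(3)]] by simp

lemma smooth_on_sum:
  "open S \<Longrightarrow> (\<And>i. i \<in> I \<Longrightarrow> smooth_on S (f i)) \<Longrightarrow> smooth_on S (\<lambda>x. \<Sum>i\<in>I. f i x)"
  unfolding smooth_on_def using C_k_on_sum by metis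

lemma smooth_on_bilinear:
  "open S \<Longrightarrow> bounded_bilinear pr \<Longrightarrow> smooth_on S f \<Longrightarrow> smooth_on S g \<Longrightarrow>
    smooth_on S (\<lambda>x. pr (f x) (g x))"
  unfolding smooth_on_def using C_k_on_bilinear by blast

lemmas smooth_on_mult = smooth_on_bilinear[OF _ bounded_bilinear_mult]
lemmas smooth_on_inner = smooth_on_bilinear[OF _ bounded_bilinear_inner]

lemma smooth_on_compose:
  fixes f :: "'a::euclidean_space \<Rightarrow> 'b::euclidean_space"
  shows "open S \<Longrightarrow> open T \<Longrightarrow> f ` S \<subseteq> T \<Longrightarrow> smooth_on S f \<Longrightarrow> smooth_on T g \<Longrightarrow>
    smooth_on S (\<lambda>x. g (f x))"
  unfolding smooth_on_def using C_k_on_compose by metis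

lemma smooth_on_Pair:
  assumes "open S" "smooth_on S f" "smooth_on S g"
  shows "smooth_on S (\<lambda>x. (f x, g x))"
proof -
  have "smooth_on S (\<lambda>x. (f x, 0) + (0, g x))"
    by (intro smooth_on_add assms smooth_on_bounded_linear[OF assms(1), where L = "\<lambda>y. (y, 0)"]
        smooth_on_bounded_linear[OF assms(1), where L = "\<lambda>y. (0, y)"]
        bounded_linear_Pair bounded_linear_ident bounded_linear_zero)
  then show ?thesis by simp
qed

lemma smooth_on_vec_lambda:
  fixes f :: "'i::finite \<Rightarrow> 'a::euclidean_space \<Rightarrow> 'b::euclidean_space"
  assumes "open S" "\<And>i. smooth_on S (f i)"
  shows "smooth_on S (\<lambda>x. \<chi> i. f i x)"
proof -
  have bl: "bounded_linear (axis i :: 'b \<Rightarrow> 'b^'i)" for i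
    by (intro linear_conv_bounded_linear[THEN iffD1] linearI) (auto simp: axis_def vec_eq_iff)
  have "smooth_on S (\<lambda>x. \<Sum>i\<in>UNIV. axis i (f i x))"
    by (intro smooth_on_sum smooth_on_bounded_linear[OF assms(1) bl] assms)
  moreover have "(\<Sum>i\<in>UNIV. axis i (f i x)) = (\<chi> i. f i x)" for x
    by (simp add: vec_eq_iff axis_def if_distrib cong: if_cong)
  ultimately show ?thesis by simp
qed

lemma C_k_on_field_derivative:
  fixes f :: "complex \<Rightarrow> complex"
  assumes "open S" "\<And>x. x \<in> S \<Longrightarrow> (f has_field_derivative f' x) (at x)" "C_k_on k S f'"
  shows "C_k_on (Suc k) S f"
  by (rule C_k_on_SucI[OF assms(1) assms(2)[unfolded has_field_derivative_def]])
    (auto intro: C_k_on_bounded_linear[OF assms(1) bounded_linear_mult_left assms(3)])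

lemma smooth_on_exp: "smooth_on S (exp :: complex \<Rightarrow> complex)"
proof -
  have "C_k_on k UNIV (exp :: complex \<Rightarrow> complex)" for k
    by (induction k) (auto intro!: C_k_on_field_derivative DERIV_exp continuous_intros
        simp del: C_k_on.simps(2))
  then show ?thesis using smooth_on_subset unfolding smooth_on_def by blast
qed

lemma smooth_on_inverse:
  assumes "open S" "0 \<notin> S"
  shows "smooth_on S (inverse :: complex \<Rightarrow> complex)"
proof -
  have "C_k_on k S (inverse :: complex \<Rightarrow> complex)" for k
  proof (induction k)
    case 0
    then show ?case using assms by (auto intro!: continuous_intros)
  next
    case (Suc k)
    have "C_k_on k S (\<lambda>x::complex. - (inverse x * inverse x))"
      by (intro C_k_on_bounded_linear[OF assms(1) bounded_linear_minus[OF bounded_linear_ident]]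
          C_k_on_bilinear[OF assms(1) bounded_bilinear_mult] Suc)
    moreover have "(inverse has_field_derivative - (inverse x * inverse x)) (at x)"
      if "x \<in> S" for x :: complex
      using DERIV_inverse[of x UNIV] assms(2) that by (auto simp: power2_eq_square power_inverse)
    ultimately show ?case by (intro C_k_on_field_derivative[OF assms(1)])
  qed
  then show ?thesis unfolding smooth_on_def by blast
qed

lemma smooth_on_Ln:
  assumes "open S" "S \<inter> \<real>\<^sub>\<le>\<^sub>0 = {}"
  shows "smooth_on S Ln"
proof -
  have "0 \<notin> S" using assms(2) by auto
  then have "C_k_on (Suc k) S Ln" for k
    using smooth_on_inverse[OF assms(1)] assms(2) unfolding smooth_on_def
    by (intro C_k_on_field_derivative[OF assms(1) has_field_derivative_Ln]) auto
  then show ?thesis unfolding smooth_on_def using C_k_on_SucD by blast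
qed

lemma smooth_on_cis:
  assumes "open S" "smooth_on S f"
  shows "smooth_on S (\<lambda>x. cis (f x))"
proof -
  have "smooth_on S (\<lambda>x. exp (\<i> * complex_of_real (f x)))"
    by (rule smooth_on_compose[OF assms(1) open_UNIV _ _ smooth_on_exp])
      (auto intro!: smooth_on_bounded_linear[OF assms(1) _ assms(2)]
        bounded_linear_compose[OF bounded_linear_mult_right bounded_linear_of_real])
  then show ?thesis by (simp add: cis_conv_exp)
qed

text \<open>The map \<open>(x, y) \<mapsto> (x, G (x, y))\<close> is locally invertible, its
  derivative being block triangular with blocks the identity and \<open>D\<close>; the solution is
  the second component of its inverse at \<open>(x, 0)\<close>.\<close>

theorem smooth_implicit_function:
  fixes G :: "'a::euclidean_space \<times> 'b::euclidean_space \<Rightarrow> 'b"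
  assumes "open S" "smooth_on S G" "(x0, y0) \<in> S" "G (x0, y0) = 0"
    and D: "((\<lambda>y. G (x0, y)) has_derivative D) (at y0)" "\<And>v. D v = 0 \<Longrightarrow> v = 0"
  obtains W \<omega> where "open W" "x0 \<in> W" "smooth_on W \<omega>" "\<omega> x0 = y0"
    "\<And>x. x \<in> W \<Longrightarrow> (x, \<omega> x) \<in> S \<and> G (x, \<omega> x) = 0"
proof -
  define F where "F p = (fst p, G p)" for p
  define G' where "G' = frechet_derivative G (at (x0, y0))"
  have dG: "(G has_derivative G') (at (x0, y0))"
    unfolding G'_def using smooth_on_has_derivative[OF assms(2,3)] .
  have smF: "smooth_on S F"
    unfolding F_def by (intro smooth_on_Pair smooth_on_linear bounded_linear_fst assms)
  have "(F has_derivative (\<lambda>v. (fst v, G' v))) (at (x0, y0))"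
    unfolding F_def by (intro derivative_intros dG)
  then have F': "frechet_derivative F (at (x0, y0)) = (\<lambda>v. (fst v, G' v))"
    using frechet_derivative_at by metis
  have pair: "((\<lambda>y. (x0, y)) has_derivative (\<lambda>v. (0, v))) (at y0)"
    by (intro derivative_intros)
  have "((\<lambda>y. G (x0, y)) has_derivative (\<lambda>v. G' (0, v))) (at y0)"
    using has_derivative_compose[OF pair dG] .
  then have "D = (\<lambda>v. G' (0, v))"
    using D(1) has_derivative_unique by blast
  then have inj: "v = 0" if "frechet_derivative F (at (x0, y0)) v = 0" for v
    using that D(2)[of "snd v"] by (cases v) (auto simp: F' zero_prod_def)
  obtain U V g where g: "open U" "U \<subseteq> S" "(x0, y0) \<in> U" "open V" "F (x0, y0) \<in> V"
    "homeomorphism U V F g" "smooth_on V g"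
    using smooth_inverse_function[OF assms(1) smF assms(3) inj] by blast
  define W where "W = {x. (x, 0) \<in> V}"
  define \<omega> where "\<omega> x = snd (g (x, 0))" for x
  have bl: "bounded_linear (\<lambda>x::'a. (x, 0::'b))"
    by (intro bounded_linear_Pair bounded_linear_ident bounded_linear_zero)
  have W: "open W"
    using continuous_open_preimage[OF _ open_UNIV g(4), of "\<lambda>x. (x, 0)"]
    by (simp add: W_def vimage_def continuous_on_Pair continuous_on_id continuous_on_const)
  have "smooth_on W \<omega>"
    unfolding \<omega>_def
    by (intro smooth_on_bounded_linear[OF W bounded_linear_snd]
        smooth_on_compose[OF W g(4) _ smooth_on_linear[OF W bl] g(7)]) (auto simp: W_def)
  moreover have "g (F (x0, y0)) = (x0, y0)"
    using g(3,6) by (auto simp: homeomorphism_def)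
  then have "\<omega> x0 = y0" "x0 \<in> W"
    using g(5) assms(4) by (auto simp: \<omega>_def W_def F_def)
  moreover have "(x, \<omega> x) \<in> S \<and> G (x, \<omega> x) = 0" if "x \<in> W" for x
  proof -
    have "(x, 0) \<in> V" using that by (simp add: W_def)
    then have *: "F (g (x, 0)) = (x, 0)" "g (x, 0) \<in> S"
      using g(2,6) by (auto simp: homeomorphism_def)
    then have "g (x, 0) = (x, \<omega> x)"
      by (cases "g (x, 0)") (auto simp: F_def \<omega>_def)
    then show ?thesis using * by (auto simp: F_def)
  qed
  ultimately show ?thesis using that W by blast
qed

text \<open>Regular level sets inside an affine space: \<open>K\<close> carries the linear
  constraints and \<open>B\<close> the directions in which \<open>g\<close> takes values, so that
  submersivity means surjectivity from \<open>K\<close> onto \<open>B\<close>.\<close>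

lemma smooth_submanifoldI:
  fixes K :: "'a::euclidean_space set" and B :: "'b::euclidean_space set"
  assumes "subspace K" "subspace B"
    and loc: "\<And>x0. x0 \<in> S \<Longrightarrow> \<exists>U g. open U \<and> x0 \<in> U \<and> smooth_on U g \<and> g ` U \<subseteq> B \<and>
      S \<inter> U = {x \<in> U. x - x0 \<in> K \<and> g x = 0} \<and> frechet_derivative g (at x0) ` K = B"
  shows "smooth_submanifold (dim K - dim B) S"
  unfolding smooth_submanifold_def
proof
  fix x0 assume "x0 \<in> S"
  from loc[OF this] obtain U g where U: "open U" "x0 \<in> U" "smooth_on U g" "g ` U \<subseteq> B"
    and SU: "S \<inter> U = {x \<in> U. x - x0 \<in> K \<and> g x = 0}"
    and surj: "frechet_derivative g (at x0) ` K = B"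
    by (elim exE conjE)
  define D where "D = frechet_derivative g (at x0)"
  have dg: "(g has_derivative D) (at x0)"
    unfolding D_def using smooth_on_has_derivative[OF U(3,2)] .
  have bD: "bounded_linear D" and lD: "linear D"
    using dg has_derivative_bounded_linear has_derivative_linear by blast+
  obtain R where R: "range R \<subseteq> K" "linear R" "\<And>b. b \<in> B \<Longrightarrow> D (R b) = b"
    using linear_exists_right_inverse_on[OF lD assms(1)] surj unfolding D_def by blast
  have bR: "bounded_linear R" using R(2) by (simp add: linear_conv_bounded_linear)
  \<comment> \<open>\<open>R\<close> is a section of \<open>D\<close> over \<open>B\<close>.
    \<open>\<Phi>\<close> exchanges the component \<open>R (D (x - x0))\<close> of
    \<open>x - x0\<close> for \<open>R (g x)\<close>; its derivative at \<open>x0\<close> is the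
    identity, and \<open>D (\<Phi> x) = g x\<close> on \<open>x0 + K\<close>.\<close>
  define \<Phi> where "\<Phi> x = (x - x0) - R (D (x - x0)) + R (g x)" for x
  have "smooth_on U \<Phi>"
    unfolding \<Phi>_def
    by (intro smooth_on_add smooth_on_diff smooth_on_bounded_linear[OF U(1) bR]
        smooth_on_bounded_linear[OF U(1) bD] smooth_on_const U smooth_on_linear bounded_linear_ident)
  have "(\<Phi> has_derivative (\<lambda>v. (v - 0) - R (D (v - 0)) + R (D v))) (at x0)"
    unfolding \<Phi>_def
    by (intro has_derivative_add has_derivative_diff has_derivative_ident has_derivative_const
        bounded_linear.has_derivative[OF bR] bounded_linear.has_derivative[OF bD] dg)
  from frechet_derivative_at[OF this] have "frechet_derivative \<Phi> (at x0) = (\<lambda>v. v)"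
    by simp
  then obtain U' W \<Psi> where W: "open U'" "U' \<subseteq> U" "x0 \<in> U'" "open W" "\<Phi> x0 \<in> W"
    "homeomorphism U' W \<Phi> \<Psi>" "smooth_on W \<Psi>"
    using smooth_inverse_function[OF U(1) \<open>smooth_on U \<Phi>\<close> U(2)] by auto
  define L where "L = {x \<in> K. D x = 0}"
  have L: "subspace L"
    unfolding L_def using assms(1) lD
    by (auto simp: subspace_def linear_add linear_cmul linear_0)
  have inL: "\<Phi> x \<in> L \<longleftrightarrow> x \<in> S" if x: "x \<in> U" for x
  proof -
    have RK: "R b \<in> K" for b using R(1) by blast
    have "\<Phi> x \<in> K \<longleftrightarrow> x - x0 \<in> K"
    proof
      assume "\<Phi> x \<in> K"
      then have "\<Phi> x - R (g x) + R (D (x - x0)) \<in> K"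
        by (intro subspace_add[OF assms(1)] subspace_diff[OF assms(1)] RK)
      then show "x - x0 \<in> K" by (simp add: \<Phi>_def)
    next
      assume "x - x0 \<in> K"
      then show "\<Phi> x \<in> K"
        unfolding \<Phi>_def using subspace_add[OF assms(1)] subspace_diff[OF assms(1)] RK by metis
    qed
    moreover have "D (\<Phi> x) = g x" if K: "x - x0 \<in> K"
    proof -
      have "D (x - x0) \<in> B" "g x \<in> B" using K surj x U(4) by (auto simp: D_def)
      then show ?thesis
        unfolding \<Phi>_def by (simp add: linear_add[OF lD] linear_diff[OF lD] R(3))
    qed
    ultimately have "\<Phi> x \<in> L \<longleftrightarrow> x - x0 \<in> K \<and> g x = 0"
      by (auto simp: L_def)
    also have "\<dots> \<longleftrightarrow> x \<in> S" using SU x by blast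
    finally show ?thesis .
  qed
  have "inj_on R B" by (metis R(3) inj_onI)
  then have dimRB: "dim (R ` B) = dim B"
    using dim_image_eq[OF R(2), of B] assms(2) by (simp add: span_eq_iff[THEN iffD2])
  have sRB: "subspace (R ` B)" using R(2) assms(2) by (rule linear_subspace_image)
  have "L \<inter> R ` B = {0}"
    using R(3) linear_0[OF R(2)] linear_0[OF lD] subspace_0[OF assms(1)] subspace_0[OF assms(2)]
    by (auto simp: L_def)
  moreover have "{x + y |x y. x \<in> L \<and> y \<in> R ` B} = K"
  proof safe
    fix x b assume "x \<in> L" "b \<in> B"
    then show "x + R b \<in> K"
      using R(1) by (auto simp: L_def intro!: subspace_add[OF assms(1)])
  next
    fix x assume x: "x \<in> K"
    then have DB: "D x \<in> B" using surj by (auto simp: D_def)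
    then have "x - R (D x) \<in> L"
      using R x by (auto simp: L_def linear_diff[OF lD] intro!: subspace_diff[OF assms(1)])
    then show "\<exists>xa y. x = xa + y \<and> xa \<in> L \<and> y \<in> R ` B"
      using DB by (intro exI[of _ "x - R (D x)"] exI[of _ "R (D x)"]) auto
  qed
  ultimately have "dim K = dim L + dim B"
    using dim_sums_Int[OF L sRB] dimRB by simp
  then have dL: "dim L = dim K - dim B" by simp
  have hom: "\<And>y. y \<in> U' \<Longrightarrow> \<Phi> y \<in> W \<and> \<Psi> (\<Phi> y) = y" "\<And>z. z \<in> W \<Longrightarrow> \<Psi> z \<in> U' \<and> \<Phi> (\<Psi> z) = z"
    using W(6) by (auto simp: homeomorphism_def)
  have "\<Phi> ` (S \<inter> U') = L \<inter> W"
  proof safe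
    fix z assume "z \<in> L" "z \<in> W"
    then show "z \<in> \<Phi> ` (S \<inter> U')"
      using hom(2)[of z] inL[of "\<Psi> z"] W(2) by (intro image_eqI[of _ _ "\<Psi> z"]) auto
  qed (use hom inL W(2) in auto)
  then show "\<exists>U W L. \<exists>\<Phi> \<Psi> :: 'a \<Rightarrow> 'a. open U \<and> x0 \<in> U \<and> open W \<and> smooth_on U \<Phi> \<and> smooth_on W \<Psi> \<and>
     (\<forall>y\<in>U. \<Phi> y \<in> W \<and> \<Psi> (\<Phi> y) = y) \<and> (\<forall>z\<in>W. \<Psi> z \<in> U \<and> \<Phi> (\<Psi> z) = z) \<and>
     subspace L \<and> dim L = dim K - dim B \<and> \<Phi> ` (S \<inter> U) = L \<inter> W"
    using W(1,3,4,7) L dL hom smooth_on_subset[OF \<open>smooth_on U \<Phi>\<close> W(2)]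
    by - (rule exI[where x = U'], rule exI[where x = W], rule exI[where x = L],
        rule exI[where x = \<Phi>], rule exI[where x = \<Psi>], simp)
qed

section \<open>Balancing Moebius maps of the circle\<close>

text \<open>For \<open>w\<close> of norm below 1, the hyperbolic translation of the unit disc that
  carries 0 to \<open>w\<close>. Rotations are left out, so that balancing can determine the
  parameter.\<close>

definition disc_moebius :: "complex \<Rightarrow> complex \<Rightarrow> complex" where
  "disc_moebius w z = (z + w) / (1 + cnj w * z)"

lemma moebius_denom_nonzero:
  assumes "norm z = 1" "norm w < 1"
  shows "1 + cnj w * z \<noteq> 0"
proof
  assume "1 + cnj w * z = 0"
  then have "norm (cnj w * z) = 1"
    by (metis add_eq_0_iff norm_minus_cancel norm_one)
  then show False using assms by (simp add: norm_mult)
qed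

lemma unit_cnj: "norm z = 1 \<Longrightarrow> z * cnj z = 1"
  by (simp add: complex_norm_square[symmetric])

text \<open>On the circle the map multiplies \<open>z\<close> by a quotient of conjugate numbers, a
  phase with twice the argument of \<open>1 + w * cnj z\<close>. This later turns it into a change
  of angles.\<close>

lemma moebius_eq_unit:
  assumes "norm z = 1"
  shows "disc_moebius w z = z * ((1 + w * cnj z) / (1 + cnj w * z))"
proof -
  have "z * (1 + w * cnj z) = z + w"
    using unit_cnj[OF assms] by (simp add: algebra_simps)
  then show ?thesis by (simp add: disc_moebius_def)
qed

lemma norm_moebius:
  assumes "norm z = 1" "norm w < 1"
  shows "norm (disc_moebius w z) = 1"
proof -
  have "1 + cnj w * z = cnj (1 + w * cnj z)" by simp
  then have "norm (1 + w * cnj z) = norm (1 + cnj w * z)"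
    by (metis complex_mod_cnj)
  then show ?thesis
    using moebius_denom_nonzero[OF assms] by (simp add: moebius_eq_unit[OF assms(1)] norm_mult norm_divide assms)
qed

lemma moebius_rotate:
  assumes "norm c = 1"
  shows "disc_moebius (c * w) (c * z) = c * disc_moebius w z"
proof -
  have "cnj (c * w) * (c * z) = (c * cnj c) * (cnj w * z)" by (simp add: mult_ac)
  then show ?thesis
    using unit_cnj[OF assms] by (simp add: disc_moebius_def distrib_left)
qed

lemma one_minus_norm_nonzero:
  assumes "norm w < 1" shows "1 - cnj w * w \<noteq> 0"
proof
  assume "1 - cnj w * w = 0"
  then have "norm (cnj w * w) = 1" by (metis eq_iff_diff_eq_0 norm_one)
  then show False
    using assms by (simp add: norm_mult)
      (metis mult_le_one norm_ge_zero less_imp_le mult_left_le not_less mult.commute)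
qed


text \<open>Every point that is not fixed moves towards \<open>w\<close>; uniqueness and (by Brouwer) existence of the
  balancing parameter both come from this.\<close>

lemma Re_moebius_diff:
  assumes "norm z = 1" "1 + cnj w * z \<noteq> 0"
  shows "Re (cnj w * (disc_moebius w z - z)) = 2 * (Im (cnj w * z))\<^sup>2 / (norm (1 + cnj w * z))\<^sup>2"
proof -
  define q where "q = cnj w * z"
  have "q * cnj q = (cnj w * w) * (z * cnj z)" by (simp add: q_def mult_ac)
  then have cw: "cnj w * w = q * cnj q" by (simp only: unit_cnj[OF assms(1)] mult_1_right)
  have "cnj w * (disc_moebius w z - z) = (cnj w * w - q * q) / (1 + q)"
    using assms(2) unfolding disc_moebius_def q_def[symmetric]
    by (simp add: field_simps q_def)
  also have "\<dots> = q * (cnj q - q) * cnj (1 + q) / ((1 + q) * cnj (1 + q))"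
  proof -
    have "cnj (1 + q) \<noteq> 0" using assms(2) unfolding q_def[symmetric] by (metis complex_cnj_zero_iff)
    from mult_divide_mult_cancel_right[OF this] show ?thesis
      unfolding cw by (simp only: right_diff_distrib)
  qed
  also have "\<dots> = (q * (cnj q - q) * cnj (1 + q)) / of_real ((norm (1 + q))\<^sup>2)"
    by (simp only: complex_norm_square)
  finally have "Re (cnj w * (disc_moebius w z - z)) = Re (q * (cnj q - q) * cnj (1 + q)) / (norm (1 + q))\<^sup>2"
    by (simp only: Re_divide_of_real)
  also have "Re (q * (cnj q - q) * cnj (1 + q)) = 2 * (Im q)\<^sup>2"
    by (simp add: power2_eq_square algebra_simps)
  finally show ?thesis by (simp add: q_def)
qed

text \<open>The signs \<open>s\<close> describe collinear configurations. The empty sum makes the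
  empty family degenerate, so vertices without neighbours in the support are treated apart.\<close>

definition nondegenerate :: "'i set \<Rightarrow> ('i \<Rightarrow> real) \<Rightarrow> bool" where
  "nondegenerate B m \<longleftrightarrow>
    (\<forall>s. (\<forall>j\<in>B. s j = 1 \<or> s j = - 1) \<longrightarrow> (\<Sum>j\<in>B. s j * m j) \<noteq> 0)"

abbreviation closed_up :: "'i set \<Rightarrow> ('i \<Rightarrow> real) \<Rightarrow> ('i \<Rightarrow> complex) \<Rightarrow> bool" where
  "closed_up B m z \<equiv> (\<Sum>j\<in>B. of_real (m j) * z j) = 0"

lemma nondegenerate_not_collinear:
  assumes "nondegenerate B m" "\<And>j. j \<in> B \<Longrightarrow> norm (z j) = 1" "closed_up B m z" "e \<noteq> 0"
  obtains j where "j \<in> B" "Im (cnj e * z j) \<noteq> 0"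
proof (rule ccontr)
  assume contra: "\<not> thesis"
  have im: "Im (cnj e * z j) = 0" if "j \<in> B" for j
    using contra that(1) \<open>j \<in> B\<close> assms by (metis \<open>\<And>j. \<lbrakk>j \<in> B; Im (cnj e * z j) \<noteq> 0\<rbrakk> \<Longrightarrow> thesis\<close>)
  define s where "s j = Re (cnj e * z j) / norm e" for j
  have s: "cnj e * z j = of_real (norm e * s j)" if "j \<in> B" for j
    using im[OF that] \<open>e \<noteq> 0\<close> by (simp add: complex_eq_iff s_def)
  have "s j = 1 \<or> s j = - 1" if j: "j \<in> B" for j
  proof -
    have "norm (cnj e * z j) = norm e" using assms(2)[OF j] by (simp add: norm_mult)
    then have "norm e * \<bar>s j\<bar> = norm e"
      unfolding s[OF j] by (simp only: norm_of_real abs_mult abs_norm_cancel)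
    then show ?thesis using \<open>e \<noteq> 0\<close> by auto
  qed
  then have "(\<Sum>j\<in>B. s j * m j) \<noteq> 0"
    using assms(1) unfolding nondegenerate_def by blast
  moreover have "of_real (norm e * (\<Sum>j\<in>B. s j * m j)) = cnj e * (\<Sum>j\<in>B. of_real (m j) * z j)"
    unfolding sum_distrib_left of_real_sum
  proof (rule sum.cong[OF refl])
    fix j assume "j \<in> B"
    then show "complex_of_real (norm e * (s j * m j)) = cnj e * (of_real (m j) * z j)"
      using s[of j] by (simp add: mult_ac)
  qed
  ultimately have "complex_of_real (norm e * (\<Sum>j\<in>B. s j * m j)) = 0"
    using assms(3) by (simp only: mult_zero_right)
  then have "norm e * (\<Sum>j\<in>B. s j * m j) = 0" by (simp only: of_real_eq_0_iff)
  then show False using \<open>(\<Sum>j\<in>B. s j * m j) \<noteq> 0\<close> \<open>e \<noteq> 0\<close> by simp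
qed

text \<open>Paired with \<open>w\<close>, the two closed sums differ by nonnegative displacements,
  one of them positive as \<open>z\<close> is not collinear. The parameter is controlled through
  nonvanishing denominators because it will be a composite one, for which
  \<open>moebius_compose\<close> provides exactly this.\<close>

lemma moebius_balanced_unique_0:
  assumes "finite B" "nondegenerate B m" "\<And>j. j \<in> B \<Longrightarrow> m j > 0" "\<And>j. j \<in> B \<Longrightarrow> norm (z j) = 1"
    and "\<And>j. j \<in> B \<Longrightarrow> 1 + cnj w * z j \<noteq> 0"
    and "closed_up B m z" "closed_up B m (\<lambda>j. disc_moebius w (z j))"
  shows "w = 0"
proof (rule ccontr)
  assume "w \<noteq> 0"
  obtain j where j: "j \<in> B" "Im (cnj w * z j) \<noteq> 0"
    using nondegenerate_not_collinear[OF assms(2,4,6) \<open>w \<noteq> 0\<close>] .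
  have "(\<Sum>j\<in>B. m j * Re (cnj w * (disc_moebius w (z j) - z j))) =
      Re (cnj w * ((\<Sum>j\<in>B. of_real (m j) * disc_moebius w (z j)) - (\<Sum>j\<in>B. of_real (m j) * z j)))"
    unfolding sum_subtractf[symmetric] sum_distrib_left Re_sum
    by (intro sum.cong refl) (simp add: algebra_simps)
  also have "\<dots> = 0" using assms(6,7) by simp
  finally have "(\<Sum>j\<in>B. m j * Re (cnj w * (disc_moebius w (z j) - z j))) = 0" .
  moreover have "(\<Sum>j\<in>B. m j * Re (cnj w * (disc_moebius w (z j) - z j))) > 0"
  proof (rule sum_pos2[OF assms(1) j(1)])
    show "0 < m j * Re (cnj w * (disc_moebius w (z j) - z j))"
      unfolding Re_moebius_diff[OF assms(4,5)[OF j(1)]]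
      using assms(3,5)[OF j(1)] j(2) by (intro mult_pos_pos divide_pos_pos) simp_all
    show "0 \<le> m i * Re (cnj w * (disc_moebius w (z i) - z i))" if "i \<in> B" for i
      unfolding Re_moebius_diff[OF assms(4,5)[OF that]]
      using assms(3)[OF that] by (intro mult_nonneg_nonneg divide_nonneg_nonneg) simp_all
  qed
  ultimately show False by simp
qed

section \<open>Composition of disc translations and uniqueness of the balancing parameter\<close>

lemma moebius_minus_moebius:
  assumes "norm z = 1" "norm w < 1"
  shows "disc_moebius (- w) (disc_moebius w z) = z"
proof -
  have 1: "1 + cnj w * z \<noteq> 0" by (rule moebius_denom_nonzero[OF assms])
  have 2: "1 - cnj w * w \<noteq> 0" by (rule one_minus_norm_nonzero[OF assms(2)])
  have "disc_moebius w z - w = z * (1 - cnj w * w) / (1 + cnj w * z)"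
    using 1 by (simp add: disc_moebius_def field_simps)
  moreover have "1 - cnj w * disc_moebius w z = (1 - cnj w * w) / (1 + cnj w * z)"
    using 1 by (simp add: disc_moebius_def field_simps)
  ultimately show ?thesis
    using 1 2 by (simp add: disc_moebius_def[of "- w"])
qed

text \<open>Translations of the disc do not form a group: a composite is a translation by
  \<open>c\<close> followed by the rotation \<open>a / cnj a\<close>. The rotation is harmless,
  since it multiplies a closed sum by a constant.\<close>

lemma moebius_compose:
  assumes "norm y = 1" "norm v < 1" "norm w < 1"
  defines "a \<equiv> 1 - v * cnj w" and "c \<equiv> (v - w) / (1 - v * cnj w)"
  shows "disc_moebius v (disc_moebius (- w) y) = a / cnj a * disc_moebius c y"
    and "1 + cnj c * y \<noteq> 0" "a \<noteq> 0"
proof -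
  have "norm (v * cnj w) < 1"
    using assms(2,3) by (simp add: norm_mult) (metis mult_strict_mono' mult_1 norm_ge_zero)
  then show a: "a \<noteq> 0" unfolding a_def by auto
  then have ca: "cnj a \<noteq> 0" by simp
  have d1: "1 - cnj w * y \<noteq> 0"
    using moebius_denom_nonzero[of y "- w"] assms by simp
  define z where "z = disc_moebius (- w) y"
  have "norm z = 1" unfolding z_def using assms by (intro norm_moebius) auto
  then have d2: "1 + cnj v * z \<noteq> 0" using assms(2) by (rule moebius_denom_nonzero)
  have z: "z * (1 - cnj w * y) = y - w"
    using d1 by (simp add: z_def disc_moebius_def)
  have c: "c * a = v - w" using a by (simp add: c_def a_def)
  have cc: "cnj c * cnj a = cnj v - cnj w" by (metis c complex_cnj_diff complex_cnj_mult)
  have e1: "(1 + cnj v * z) * (1 - cnj w * y) = cnj a * (1 + cnj c * y)"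
  proof -
    have "(1 + cnj v * z) * (1 - cnj w * y) = (1 - cnj w * y) + cnj v * (z * (1 - cnj w * y))"
      by (simp add: algebra_simps)
    also have "\<dots> = (1 - cnj w * y) + cnj v * (y - w)" by (simp only: z)
    also have "\<dots> = cnj a + (cnj v - cnj w) * y" by (simp add: a_def algebra_simps)
    also have "\<dots> = cnj a * (1 + cnj c * y)" unfolding cc[symmetric] by (simp add: algebra_simps)
    finally show ?thesis .
  qed
  have e2: "(z + v) * (1 - cnj w * y) = a * (y + c)"
  proof -
    have "(z + v) * (1 - cnj w * y) = (y - w) + v * (1 - cnj w * y)"
      by (simp only: distrib_right z)
    also have "\<dots> = a * y + c * a" unfolding c by (simp add: a_def algebra_simps)
    also have "\<dots> = a * (y + c)" by (simp only: distrib_left mult.commute)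
    finally show ?thesis .
  qed
  show d3: "1 + cnj c * y \<noteq> 0" using e1 d1 d2 by auto
  have "disc_moebius v z = ((z + v) * (1 - cnj w * y)) / ((1 + cnj v * z) * (1 - cnj w * y))"
    by (simp only: disc_moebius_def mult_divide_mult_cancel_right[OF d1])
  also have "\<dots> = a / cnj a * disc_moebius c y"
    unfolding e1 e2 by (simp only: disc_moebius_def times_divide_times_eq)
  finally show "disc_moebius v (disc_moebius (- w) y) = a / cnj a * disc_moebius c y"
    unfolding z_def .
qed

text \<open>The configuration balanced by \<open>w\<close> is taken as the new starting point.
  Relative to it, balancing by \<open>v\<close> means balancing by the composite parameter
  \<open>c\<close>, which must vanish as the configuration is already closed.\<close>

lemma moebius_balanced_unique:
  assumes "finite B" "nondegenerate B m" "\<And>j. j \<in> B \<Longrightarrow> m j > 0" "\<And>j. j \<in> B \<Longrightarrow> norm (z j) = 1"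
    and "norm v < 1" "norm w < 1"
    and "closed_up B m (\<lambda>j. disc_moebius v (z j))" "closed_up B m (\<lambda>j. disc_moebius w (z j))"
  shows "v = w"
proof -
  define y where "y j = disc_moebius w (z j)" for j
  define a where "a = 1 - v * cnj w"
  define c where "c = (v - w) / (1 - v * cnj w)"
  have y: "norm (y j) = 1" if "j \<in> B" for j
    unfolding y_def using norm_moebius assms that by blast
  have "disc_moebius v (z j) = a / cnj a * disc_moebius c (y j)" if "j \<in> B" for j
    using moebius_compose(1)[OF y[OF that] assms(5,6)] moebius_minus_moebius[OF assms(4)[OF that] assms(6)]
    unfolding a_def c_def y_def by simp
  then have "(\<Sum>j\<in>B. of_real (m j) * disc_moebius v (z j)) =
      a / cnj a * (\<Sum>j\<in>B. of_real (m j) * disc_moebius c (y j))"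
    unfolding sum_distrib_left by (intro sum.cong) (auto simp: mult_ac)
  moreover have "a \<noteq> 0"
  proof -
    have "norm (1::complex) = 1" by simp
    from moebius_compose(3)[OF this assms(5,6)] show ?thesis by (simp add: a_def)
  qed
  ultimately have "closed_up B m (\<lambda>j. disc_moebius c (y j))"
    using assms(7) by simp
  moreover have "1 + cnj c * y j \<noteq> 0" if "j \<in> B" for j
    using moebius_compose(2)[OF y[OF that] assms(5,6)] by (simp add: c_def)
  ultimately have "c = 0"
    using assms(8) y by (intro moebius_balanced_unique_0[OF assms(1-3), of y c]) (simp_all add: y_def)
  then show ?thesis using \<open>a \<noteq> 0\<close> by (simp add: c_def a_def)
qed


text \<open>A continuous field on a disc that points outward along the boundary has a zero. The
  radius 1/2 keeps all parameters inside the unit disc, where the denominators do not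
  vanish.\<close>

lemma moebius_balanced_exists:
  assumes "\<And>j. j \<in> B \<Longrightarrow> norm (z j) = 1"
    and outward: "\<And>w. norm w = 1 / 2 \<Longrightarrow>
      Re (cnj w * (\<Sum>j\<in>B. of_real (m j) * disc_moebius w (z j))) > 0"
  shows "\<exists>w. norm w < 1 \<and> closed_up B m (\<lambda>j. disc_moebius w (z j))"
proof (rule ccontr)
  define b where "b w = (\<Sum>j\<in>B. of_real (m j) * disc_moebius w (z j))" for w
  assume "\<not> ?thesis"
  then have b0: "b w \<noteq> 0" if "w \<in> cball 0 (1 / 2)" for w
    using that by (auto simp: b_def)
  have "continuous_on (cball 0 (1 / 2)) b"
    unfolding b_def disc_moebius_def
    using moebius_denom_nonzero[OF assms(1)] by (auto intro!: continuous_intros)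
  \<comment> \<open>Without a zero, the field reversed and scaled to length 1/2 maps the disc to its
    boundary; at a Brouwer fixed point \<open>w\<close> the vector \<open>b w\<close> points along
    \<open>- w\<close>, against \<open>outward\<close>.\<close>
  then have "continuous_on (cball 0 (1 / 2)) (\<lambda>w. - of_real (1 / (2 * norm (b w))) * b w)"
    using b0 by (auto intro!: continuous_intros)
  then obtain w where w: "w \<in> cball 0 (1 / 2)" "- of_real (1 / (2 * norm (b w))) * b w = w"
    by (rule brouwer_ball[rotated]) (use b0 in \<open>auto simp: norm_mult norm_divide\<close>)
  have "norm w = norm (- of_real (1 / (2 * norm (b w))) * b w)" by (simp only: w(2))
  also have "\<dots> = 1 / 2" using b0[OF w(1)] by (simp add: norm_mult norm_divide)
  finally have "Re (cnj w * b w) > 0" using outward by (simp add: b_def)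
  moreover have "cnj w * b w = of_real (- (1 / (2 * norm (b w))) * (norm (b w))\<^sup>2)"
  proof -
    have "cnj w = - of_real (1 / (2 * norm (b w))) * cnj (b w)"
      using arg_cong[OF w(2), of cnj] by simp
    then have "cnj w * b w = - of_real (1 / (2 * norm (b w))) * (b w * cnj (b w))" by simp
    then show ?thesis unfolding complex_norm_square[symmetric] by simp
  qed
  ultimately show False by (simp add: divide_less_0_iff zero_less_mult_iff)
qed

text \<open>Quantitative non-collinearity: \<open>\<eta>\<close> is uniform over all closed
  configurations and all directions \<open>e\<close>, so that one neighbourhood can serve all of
  them.\<close>

lemma gap_not_collinear:
  assumes gap: "\<And>s. \<forall>j\<in>B. s j = 1 \<or> s j = - 1 \<Longrightarrow> g \<le> \<bar>\<Sum>j\<in>B. s j * m j\<bar>"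
    and "\<And>j. j \<in> B \<Longrightarrow> m j \<ge> 0" "\<And>j. j \<in> B \<Longrightarrow> norm (z j) = 1"
    and "closed_up B m z" "norm e = 1" "\<eta> * (\<Sum>j\<in>B. m j) < g"
  shows "\<exists>j\<in>B. \<eta> \<le> \<bar>Im (cnj e * z j)\<bar>"
proof (rule ccontr)
  assume "\<not> ?thesis"
  then have im: "\<bar>Im (cnj e * z j)\<bar> < \<eta>" if "j \<in> B" for j using that by force
  define r where "r j = Re (cnj e * z j)" for j
  \<comment> \<open>Each unit vector near the line is rounded to the closer of its two directions;
    the error \<open>1 - \<bar>r j\<bar>\<close> is at most the modulus of the imaginary
    part.\<close>
  define s where "s j = (if r j \<ge> 0 then 1 else - 1 :: real)" for j
  have close: "\<bar>s j - r j\<bar> \<le> \<eta>" if j: "j \<in> B" for j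
  proof -
    have "norm (cnj e * z j) = 1" using assms(3)[OF j] assms(5) by (simp add: norm_mult)
    then show ?thesis
      using im[OF j] cmod_le[of "cnj e * z j"] abs_Re_le_cmod[of "cnj e * z j"]
      unfolding s_def r_def by (auto split: if_splits)
  qed
  have "(\<Sum>j\<in>B. r j * m j) = Re (cnj e * (\<Sum>j\<in>B. of_real (m j) * z j))"
    unfolding sum_distrib_left Re_sum r_def by (intro sum.cong refl) (simp add: algebra_simps)
  then have r0: "(\<Sum>j\<in>B. r j * m j) = 0" using assms(4) by simp
  have "g \<le> \<bar>\<Sum>j\<in>B. s j * m j\<bar>" by (rule gap) (simp add: s_def)
  also have "(\<Sum>j\<in>B. s j * m j) = (\<Sum>j\<in>B. (s j - r j) * m j)"
    using r0 by (simp add: left_diff_distrib sum_subtractf)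
  also have "\<bar>\<dots>\<bar> \<le> (\<Sum>j\<in>B. \<bar>(s j - r j) * m j\<bar>)" by (rule sum_abs)
  also have "\<dots> \<le> (\<Sum>j\<in>B. \<eta> * m j)"
    using assms(2) close by (intro sum_mono) (simp add: abs_mult mult_right_mono)
  finally show False using assms(6) by (simp add: sum_distrib_left)
qed

text \<open>The weights \<open>m'\<close> close \<open>z\<close> only up to an error that, paired
  with \<open>w\<close>, is at most \<open>card B * d / 2\<close>. The displacement outweighs it:
  one term is at least \<open>2 / 9 * (a * \<eta>\<^sup>2)\<close>, by \<open>norm w = 1 / 2\<close>
  and a denominator of norm at most 3/2.\<close>

lemma moebius_outward:
  assumes "finite B" "\<And>j. j \<in> B \<Longrightarrow> norm (z j) = 1" "closed_up B m z"
    and "\<And>j. j \<in> B \<Longrightarrow> 0 < a \<and> a \<le> m' j" "\<And>j. j \<in> B \<Longrightarrow> \<bar>m' j - m j\<bar> \<le> d"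
    and "\<exists>j\<in>B. \<eta> \<le> \<bar>Im (cnj (2 * w) * z j)\<bar>" "\<eta> > 0" "norm w = 1 / 2"
    and "9 * (real (card B) * d) < 4 * (a * \<eta>\<^sup>2)"
  shows "Re (cnj w * (\<Sum>j\<in>B. of_real (m' j) * disc_moebius w (z j))) > 0"
proof -
  define t where "t j = m' j * Re (cnj w * (disc_moebius w (z j) - z j))" for j
  have nz: "1 + cnj w * z j \<noteq> 0" if "j \<in> B" for j
    using assms(8) by (intro moebius_denom_nonzero[OF assms(2)[OF that]]) simp
  have t: "t j = m' j * (2 * (Im (cnj w * z j))\<^sup>2 / (norm (1 + cnj w * z j))\<^sup>2)" if "j \<in> B" for j
    unfolding t_def by (simp only: Re_moebius_diff[OF assms(2) nz, OF that that])
  have t0: "t j \<ge> 0" if "j \<in> B" for j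
    unfolding t[OF that] using assms(4)[OF that] by (intro mult_nonneg_nonneg) auto
  obtain i where i: "i \<in> B" "\<eta> \<le> \<bar>Im (cnj (2 * w) * z i)\<bar>" using assms(6) by blast
  have "Im (cnj (2 * w) * z i) = 2 * Im (cnj w * z i)" by (simp add: algebra_simps)
  then have "\<eta> / 2 \<le> \<bar>Im (cnj w * z i)\<bar>" using i(2) by linarith
  then have im: "(\<eta> / 2)\<^sup>2 \<le> (Im (cnj w * z i))\<^sup>2"
    using power_mono[of "\<eta> / 2" "\<bar>Im (cnj w * z i)\<bar>" 2] assms(7) by (simp only: power2_abs)
  have "norm (1 + cnj w * z i) \<le> norm (1::complex) + norm (cnj w * z i)" by (rule norm_triangle_ineq)
  also have "\<dots> = 3 / 2" using assms(2)[OF i(1)] assms(8) by (simp add: norm_mult)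
  finally have den: "(norm (1 + cnj w * z i))\<^sup>2 \<le> (3 / 2)\<^sup>2" by (intro power_mono) auto
  have "2 / 9 * (a * \<eta>\<^sup>2) = a * (2 * (\<eta> / 2)\<^sup>2 / (3 / 2)\<^sup>2)"
    by (simp add: power_divide)
  also have "\<dots> \<le> t i"
    unfolding t[OF i(1)] using assms(4)[OF i(1)] im den nz[OF i(1)]
    by (intro mult_mono frac_le) auto
  also have "\<dots> \<le> (\<Sum>j\<in>B. t j)"
    using t0 i(1) assms(1) by (intro member_le_sum) auto
  finally have big: "2 / 9 * (a * \<eta>\<^sup>2) \<le> (\<Sum>j\<in>B. t j)" .
  define u where "u j = (m' j - m j) * Re (cnj w * z j)" for j
  have "\<bar>u j\<bar> \<le> d * (1 / 2)" if j: "j \<in> B" for j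
  proof -
    have "\<bar>Re (cnj w * z j)\<bar> \<le> 1 / 2"
      using abs_Re_le_cmod[of "cnj w * z j"] assms(2)[OF j] assms(8) by (simp add: norm_mult)
    then show ?thesis
      unfolding u_def abs_mult using assms(5)[OF j] by (intro mult_mono) auto
  qed
  then have "\<bar>\<Sum>j\<in>B. u j\<bar> \<le> real (card B) * (d * (1 / 2))"
    by (intro order_trans[OF sum_abs] sum_bounded_above) auto
  moreover have "Re (cnj w * (\<Sum>j\<in>B. of_real (m' j) * disc_moebius w (z j))) =
      (\<Sum>j\<in>B. t j) + (\<Sum>j\<in>B. u j) + Re (cnj w * (\<Sum>j\<in>B. of_real (m j) * z j))"
    unfolding sum_distrib_left Re_sum sum.distrib[symmetric] t_def u_def
    by (intro sum.cong refl) (simp add: algebra_simps)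
  ultimately show ?thesis using big assms(3,9) by simp
qed

text \<open>A directed notion, for carrying configurations closed for \<open>m\<close> to ones
  closed for \<open>m'\<close>; an invertible transport takes it in both directions.\<close>

definition good_pair :: "'i set \<Rightarrow> ('i \<Rightarrow> real) \<Rightarrow> ('i \<Rightarrow> real) \<Rightarrow> bool" where
  "good_pair B m m' \<longleftrightarrow> nondegenerate B m' \<and> (\<forall>j\<in>B. m' j > 0) \<and>
    (\<forall>z. (\<forall>j\<in>B. norm (z j) = 1) \<longrightarrow> closed_up B m z \<longrightarrow>
      (\<exists>w. norm w < 1 \<and> closed_up B m' (\<lambda>j. disc_moebius w (z j))))"

text \<open>Finitely many sign patterns leave a positive gap. The tolerance \<open>d\<close> serves
  any two weights near \<open>m\<close>, so that a pair can be used in either order.\<close>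

lemma nondegenerate_perturb:
  assumes "finite B" "nondegenerate B m" "\<And>j. j \<in> B \<Longrightarrow> m j > 0"
  shows "\<exists>d>0. (\<forall>m'. (\<forall>j\<in>B. \<bar>m' j - m j\<bar> \<le> d) \<longrightarrow> nondegenerate B m' \<and> (\<forall>j\<in>B. m' j > 0)) \<and>
    (\<forall>m1 m2. (\<forall>j\<in>B. \<bar>m1 j - m j\<bar> \<le> d) \<longrightarrow> (\<forall>j\<in>B. \<bar>m2 j - m j\<bar> \<le> d) \<longrightarrow> good_pair B m1 m2)"
proof -
  define \<sigma> where "\<sigma> T = \<bar>\<Sum>j\<in>B. (if j \<in> T then 1 else - 1) * m j\<bar>" for T
  define g where "g = Min (\<sigma> ` Pow B)"
  have \<sigma>: "\<exists>T\<in>Pow B. \<bar>\<Sum>j\<in>B. s j * m j\<bar> = \<sigma> T" if s: "\<forall>j\<in>B. s j = 1 \<or> s j = - 1" for s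
    unfolding \<sigma>_def using s
    by (intro bexI[of _ "{j \<in> B. s j = 1}"] arg_cong[of _ _ abs] sum.cong) auto
  have g_le: "g \<le> \<bar>\<Sum>j\<in>B. s j * m j\<bar>" if "\<forall>j\<in>B. s j = 1 \<or> s j = - 1" for s
    using \<sigma>[OF that] assms(1) unfolding g_def by (auto intro!: Min_le)
  have "g \<in> \<sigma> ` Pow B" unfolding g_def using assms(1) by (intro Min_in) auto
  then have "g > 0"
    using assms(2) unfolding nondegenerate_def \<sigma>_def by auto
  have "B \<noteq> {}" using assms(2) by (auto simp: nondegenerate_def)
  define n where "n = real (card B)"
  have n: "n > 0" using assms(1) \<open>B \<noteq> {}\<close> by (simp add: n_def card_gt_0_iff)
  define a where "a = Min (m ` B)"
  have a_le: "a \<le> m j" if "j \<in> B" for j using that assms(1) by (simp add: a_def)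
  have "a \<in> m ` B" unfolding a_def using assms(1) \<open>B \<noteq> {}\<close> by (intro Min_in) auto
  then have "a > 0" using assms(3) by auto
  define M where "M = (\<Sum>j\<in>B. m j) + n * a"
  have "(\<Sum>j\<in>B. m j) \<ge> 0" using assms(3) by (intro sum_nonneg) (simp add: less_imp_le)
  then have "M > 0" using \<open>a > 0\<close> n by (simp add: M_def add_nonneg_pos)
  \<comment> \<open>\<open>M\<close> bounds the total weight after perturbation, so
    \<open>\<eta> * M = g / 4\<close> stays below the perturbed gap \<open>g / 2\<close>.\<close>
  define \<eta> where "\<eta> = g / (4 * M)"
  have "\<eta> > 0" using \<open>g > 0\<close> \<open>M > 0\<close> by (simp add: \<eta>_def)
  \<comment> \<open>The three bounds keep, in turn, every weight at least \<open>a / 2\<close>,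
    every signed sum at least \<open>g / 2\<close> in modulus, and the distance \<open>2 * d\<close>
    of two perturbed weights within the reach of \<open>moebius_outward\<close> applied with
    \<open>a / 2\<close>.\<close>
  define d where "d = min (a / 2) (min (g / (2 * n)) (a * \<eta>\<^sup>2 / (18 * n)))"
  have d: "d \<le> a / 2" "n * d \<le> g / 2" "18 * (n * d) \<le> a * \<eta>\<^sup>2"
  proof -
    have "d \<le> g / (2 * n)" "d \<le> a * \<eta>\<^sup>2 / (18 * n)" by (simp_all add: d_def)
    then show "n * d \<le> g / 2" "18 * (n * d) \<le> a * \<eta>\<^sup>2"
      using n by (simp_all add: field_simps)
  qed (simp add: d_def)
  have "d > 0" using \<open>a > 0\<close> \<open>g > 0\<close> \<open>\<eta> > 0\<close> n by (simp add: d_def)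
  have ge: "a / 2 \<le> m' j" if "j \<in> B" "\<bar>m' j - m j\<bar> \<le> d" for j m'
    using a_le[OF that(1)] that(2) d(1) by linarith
  have gap: "g / 2 \<le> \<bar>\<Sum>j\<in>B. s j * m' j\<bar>"
    if s: "\<forall>j\<in>B. s j = 1 \<or> s j = - 1" and m': "\<And>j. j \<in> B \<Longrightarrow> \<bar>m' j - m j\<bar> \<le> d" for m' s
  proof -
    have "\<bar>\<Sum>j\<in>B. s j * (m' j - m j)\<bar> \<le> (\<Sum>j\<in>B. \<bar>s j * (m' j - m j)\<bar>)" by (rule sum_abs)
    also have "\<dots> \<le> n * d"
      unfolding n_def using s m' by (intro sum_bounded_above) (auto simp: abs_mult)
    finally have "\<bar>\<Sum>j\<in>B. s j * (m' j - m j)\<bar> \<le> g / 2" using d(2) by linarith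
    moreover have "(\<Sum>j\<in>B. s j * (m' j - m j)) = (\<Sum>j\<in>B. s j * m' j) - (\<Sum>j\<in>B. s j * m j)"
      by (simp add: right_diff_distrib sum_subtractf)
    ultimately show ?thesis using g_le[OF s] by linarith
  qed
  have pert: "nondegenerate B m' \<and> (\<forall>j\<in>B. m' j > 0)" if "\<forall>j\<in>B. \<bar>m' j - m j\<bar> \<le> d" for m'
  proof -
    have m': "\<And>j. j \<in> B \<Longrightarrow> \<bar>m' j - m j\<bar> \<le> d" using that by blast
    have "(\<Sum>j\<in>B. s j * m' j) \<noteq> 0" if "\<forall>j\<in>B. s j = 1 \<or> s j = - 1" for s
      using gap[OF that, of m'] m' \<open>g > 0\<close> by auto
    moreover have "m' j > 0" if "j \<in> B" for j
      using ge[of j m', OF that m'[OF that]] \<open>a > 0\<close> by linarith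
    ultimately show ?thesis
      unfolding nondegenerate_def by blast
  qed
  have "\<exists>w. norm w < 1 \<and> closed_up B m2 (\<lambda>j. disc_moebius w (z j))"
    if m1: "\<And>j. j \<in> B \<Longrightarrow> \<bar>m1 j - m j\<bar> \<le> d" and m2: "\<And>j. j \<in> B \<Longrightarrow> \<bar>m2 j - m j\<bar> \<le> d"
      and z: "\<And>j. j \<in> B \<Longrightarrow> norm (z j) = 1" "closed_up B m1 z" for m1 m2 z
  proof -
    have m1_pos: "m1 j \<ge> 0" if "j \<in> B" for j
      using ge[of j m1, OF that m1[OF that]] \<open>a > 0\<close> by linarith
    have "(\<Sum>j\<in>B. m1 j) \<le> (\<Sum>j\<in>B. m j + a)"
      using m1 d(1) \<open>a > 0\<close> by (intro sum_mono) (smt (verit) field_sum_of_halves)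
    then have "(\<Sum>j\<in>B. m1 j) \<le> M" by (simp add: M_def sum.distrib n_def)
    then have "\<eta> * (\<Sum>j\<in>B. m1 j) \<le> \<eta> * M" using \<open>\<eta> > 0\<close> by simp
    also have "\<dots> < g / 2" using \<open>M > 0\<close> \<open>g > 0\<close> by (simp add: \<eta>_def)
    finally have small: "\<eta> * (\<Sum>j\<in>B. m1 j) < g / 2" .
    show ?thesis
    proof (rule moebius_balanced_exists[OF z(1)])
      fix w :: complex assume w: "norm w = 1 / 2"
      then have w2: "norm (2 * w) = 1" by (simp add: norm_mult)
      show "Re (cnj w * (\<Sum>j\<in>B. of_real (m2 j) * disc_moebius w (z j))) > 0"
      proof (rule moebius_outward[OF assms(1) z, of "a / 2" m2 "2 * d" \<eta>])
        show "\<exists>j\<in>B. \<eta> \<le> \<bar>Im (cnj (2 * w) * z j)\<bar>"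
          by (rule gap_not_collinear[OF _ m1_pos z w2 small]) (use gap m1 in auto)
        show "\<bar>m2 j - m1 j\<bar> \<le> 2 * d" if "j \<in> B" for j
          using m1[OF that] m2[OF that] by linarith
        show "9 * (real (card B) * (2 * d)) < 4 * (a / 2 * \<eta>\<^sup>2)"
        proof -
          have "0 < a * \<eta>\<^sup>2" using \<open>a > 0\<close> \<open>\<eta> > 0\<close> by simp
          moreover have "9 * (real (card B) * (2 * d)) = 18 * (n * d)"
            "4 * (a / 2 * \<eta>\<^sup>2) = 2 * (a * \<eta>\<^sup>2)" by (simp_all add: n_def)
          ultimately show ?thesis using d(3) by linarith
        qed
      qed (use ge m2 \<open>a > 0\<close> \<open>\<eta> > 0\<close> w in auto)
    qed
  qed
  then have "good_pair B m1 m2"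
    if "\<forall>j\<in>B. \<bar>m1 j - m j\<bar> \<le> d" "\<forall>j\<in>B. \<bar>m2 j - m j\<bar> \<le> d" for m1 m2
    unfolding good_pair_def using pert[OF that(2)] that by blast
  then show ?thesis using pert \<open>d > 0\<close> by blast
qed

section \<open>Smooth dependence of the balancing parameter\<close>

lemma has_derivative_disc_moebius:
  assumes "1 + cnj w * z \<noteq> 0"
  shows "((\<lambda>w. disc_moebius w z) has_derivative
    (\<lambda>v. v / (1 + cnj w * z) - (z + w) * (cnj v * z) / (1 + cnj w * z)\<^sup>2)) (at w)"
proof -
  have "((\<lambda>w. (z + w) / (1 + cnj w * z)) has_derivative
      (\<lambda>v. ((0 + v) * (1 + cnj w * z) - (z + w) * (0 + cnj v * z)) /
        ((1 + cnj w * z) * (1 + cnj w * z)))) (at w)"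
    using assms
    by (intro has_derivative_divide' has_derivative_add has_derivative_const has_derivative_ident
        has_derivative_mult_left has_derivative_cnj)
  also have "(\<lambda>v. ((0 + v) * (1 + cnj w * z) - (z + w) * (0 + cnj v * z)) /
        ((1 + cnj w * z) * (1 + cnj w * z))) =
      (\<lambda>v. v / (1 + cnj w * z) - (z + w) * (cnj v * z) / (1 + cnj w * z)\<^sup>2)"
    using assms by (simp add: fun_eq_iff diff_divide_distrib power2_eq_square)
  finally show ?thesis by (simp only: disc_moebius_def)
qed

text \<open>In terms of the image point the derivative becomes that at \<open>w = 0\<close>, up to a multiple of the
  image point, which cancels in a closed configuration.\<close>

lemma disc_moebius_derivative_eq:
  assumes "norm z = 1" "norm w < 1"
  defines "y \<equiv> disc_moebius w z"
  shows "(1 - w * cnj w) * (v / (1 + cnj w * z) - (z + w) * (cnj v * z) / (1 + cnj w * z)\<^sup>2) =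
    (v - y * y * cnj v) + (w * cnj v - cnj w * v) * y"
proof -
  define d where "d = 1 + cnj w * z"
  have d: "d \<noteq> 0" unfolding d_def by (rule moebius_denom_nonzero[OF assms(1,2)])
  have y: "y * d = z + w" using d by (simp add: y_def disc_moebius_def d_def)
  have "(1 - w * cnj w) * (v / d - (z + w) * (cnj v * z) / d\<^sup>2) * d =
      (1 - w * cnj w) * (v - y * (cnj v * z))"
    using d unfolding y[symmetric] by (simp add: field_simps power2_eq_square)
  moreover have "((v - y * y * cnj v) + (w * cnj v - cnj w * v) * y) * d =
      (1 - w * cnj w) * (v - y * (cnj v * z))"
  proof -
    have "((v - y * y * cnj v) + (w * cnj v - cnj w * v) * y) * d =
        v * d - y * cnj v * (y * d) + (w * cnj v - cnj w * v) * (y * d)"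
      by (simp add: algebra_simps)
    also have "\<dots> = v * d - y * cnj v * (z + w) + (w * cnj v - cnj w * v) * (z + w)"
      by (simp only: y)
    also have "\<dots> = v * (1 - w * cnj w) - y * cnj v * (z + w) + w * cnj v * (z + w)"
      by (simp add: d_def algebra_simps)
    also have "w * cnj v * (z + w) = w * cnj v * (y * d)" by (simp only: y)
    also have "v * (1 - w * cnj w) - y * cnj v * (z + w) + w * cnj v * (y * d) =
        (1 - w * cnj w) * (v - y * (cnj v * z))"
      by (simp add: d_def algebra_simps)
    finally show ?thesis .
  qed
  ultimately have "(1 - w * cnj w) * (v / d - (z + w) * (cnj v * z) / d\<^sup>2) * d =
      ((v - y * y * cnj v) + (w * cnj v - cnj w * v) * y) * d"
    by simp
  then show ?thesis using d unfolding d_def by (metis mult_right_cancel)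
qed

lemma Re_unit_square_diff:
  assumes "norm y = 1"
  shows "Re (cnj v * (v - y * y * cnj v)) = 2 * (Im (cnj v * y))\<^sup>2"
proof -
  define q where "q = cnj v * y"
  have "q * cnj q = (cnj v * v) * (y * cnj y)" by (simp add: q_def mult_ac)
  then have "cnj v * v = q * cnj q" by (simp only: unit_cnj[OF assms] mult_1_right)
  then have "cnj v * (v - y * y * cnj v) = q * cnj q - q * q"
    by (simp add: q_def algebra_simps)
  then show ?thesis by (simp add: q_def[symmetric] power2_eq_square)
qed

text \<open>After multiplication by \<open>1 - w * cnj w\<close> the multiples of the image points
  add up to zero, and pairing the remainder with \<open>v\<close> leaves a weighted sum of the
  squares of \<open>Im (cnj v * y j)\<close>, positive for a non-collinear configuration.\<close>

lemma moebius_balanced_derivative_inj: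
  assumes "finite B" "nondegenerate B m" "\<And>j. j \<in> B \<Longrightarrow> m j > 0" "\<And>j. j \<in> B \<Longrightarrow> norm (z j) = 1"
    and "norm w < 1" "closed_up B m (\<lambda>j. disc_moebius w (z j))"
    and D: "(\<Sum>j\<in>B. of_real (m j) *
      (v / (1 + cnj w * z j) - (z j + w) * (cnj v * z j) / (1 + cnj w * z j)\<^sup>2)) = 0"
  shows "v = 0"
proof (rule ccontr)
  assume "v \<noteq> 0"
  define y where "y j = disc_moebius w (z j)" for j
  have y: "norm (y j) = 1" if "j \<in> B" for j
    unfolding y_def using norm_moebius assms that by blast
  obtain j where j: "j \<in> B" "Im (cnj v * y j) \<noteq> 0"
    using nondegenerate_not_collinear[of B m y v] assms(2,6) y \<open>v \<noteq> 0\<close> by (auto simp: y_def)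
  have "0 = (1 - w * cnj w) * (\<Sum>j\<in>B. of_real (m j) *
      (v / (1 + cnj w * z j) - (z j + w) * (cnj v * z j) / (1 + cnj w * z j)\<^sup>2))"
    by (simp only: D mult_zero_right)
  also have "\<dots> = (\<Sum>j\<in>B. of_real (m j) * (v - y j * y j * cnj v) +
      (w * cnj v - cnj w * v) * (of_real (m j) * y j))"
    unfolding sum_distrib_left
  proof (rule sum.cong[OF refl])
    fix j assume "j \<in> B"
    from disc_moebius_derivative_eq[OF assms(4)[OF this] assms(5), of v]
    show "(1 - w * cnj w) * (of_real (m j) *
        (v / (1 + cnj w * z j) - (z j + w) * (cnj v * z j) / (1 + cnj w * z j)\<^sup>2)) =
        of_real (m j) * (v - y j * y j * cnj v) + (w * cnj v - cnj w * v) * (of_real (m j) * y j)"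
      unfolding y_def by (metis (no_types, opaque_lifting) distrib_left mult.left_commute)
  qed
  also have "\<dots> = (\<Sum>j\<in>B. of_real (m j) * (v - y j * y j * cnj v))"
    using assms(6) unfolding sum.distrib sum_distrib_left[symmetric] y_def by simp
  finally have "Re (cnj v * (\<Sum>j\<in>B. of_real (m j) * (v - y j * y j * cnj v))) = 0" by simp
  also have "Re (cnj v * (\<Sum>j\<in>B. of_real (m j) * (v - y j * y j * cnj v))) =
      (\<Sum>j\<in>B. m j * Re (cnj v * (v - y j * y j * cnj v)))"
    unfolding sum_distrib_left Re_sum by (intro sum.cong refl) (simp add: algebra_simps)
  also have "\<dots> = (\<Sum>j\<in>B. m j * (2 * (Im (cnj v * y j))\<^sup>2))"
    by (intro sum.cong refl) (simp only: Re_unit_square_diff[OF y])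
  finally have "(\<Sum>j\<in>B. m j * (2 * (Im (cnj v * y j))\<^sup>2)) = 0" .
  moreover have "(\<Sum>j\<in>B. m j * (2 * (Im (cnj v * y j))\<^sup>2)) > 0"
  proof (rule sum_pos2[OF assms(1) j(1)])
    show "0 < m j * (2 * (Im (cnj v * y j))\<^sup>2)"
      using assms(3)[OF j(1)] j(2) by (intro mult_pos_pos) auto
    show "0 \<le> m i * (2 * (Im (cnj v * y i))\<^sup>2)" if "i \<in> B" for i
      using assms(3)[OF that] by (intro mult_nonneg_nonneg) auto
  qed
  ultimately show False by simp
qed

text \<open>A balancing parameter is given at \<open>x0\<close> only; implicit functions extend it
  to an open neighbourhood. Uniqueness later identifies the extension with the chosen
  parameter.\<close>

lemma moebius_balanced_smooth:
  fixes z :: "'j \<Rightarrow> 'a::euclidean_space \<Rightarrow> complex"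
  assumes "finite B" "nondegenerate B m" "\<And>j. j \<in> B \<Longrightarrow> m j > 0"
    and z: "\<And>j. j \<in> B \<Longrightarrow> smooth_on UNIV (z j)" "\<And>j x. j \<in> B \<Longrightarrow> norm (z j x) = 1"
    and "norm w0 < 1" "closed_up B m (\<lambda>j. disc_moebius w0 (z j x0))"
  obtains W \<omega> where "open W" "x0 \<in> W" "smooth_on W \<omega>"
    "\<And>x. x \<in> W \<Longrightarrow> norm (\<omega> x) < 1 \<and> closed_up B m (\<lambda>j. disc_moebius (\<omega> x) (z j x))"
proof -
  define S where "S = (UNIV :: 'a set) \<times> ball (0::complex) 1"
  have S: "open S" by (simp add: S_def open_Times)
  define G where "G p = (\<Sum>j\<in>B. of_real (m j) * disc_moebius (snd p) (z j (fst p)))" for p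
  have smz: "smooth_on S (\<lambda>p. z j (fst p))" if "j \<in> B" for j
    by (rule smooth_on_compose[OF S open_UNIV _ smooth_on_linear[OF S bounded_linear_fst] z(1)[OF that]])
      simp
  have den: "smooth_on S (\<lambda>p. 1 + cnj (snd p) * z j (fst p))" if "j \<in> B" for j
    by (intro smooth_on_add smooth_on_mult smz that S smooth_on_const
        smooth_on_linear bounded_linear_compose[OF bounded_linear_cnj bounded_linear_snd])
  have "smooth_on S (\<lambda>p. inverse (1 + cnj (snd p) * z j (fst p)))" if j: "j \<in> B" for j
    by (rule smooth_on_compose[OF S _ _ den[OF j] smooth_on_inverse[of "- {0}"]])
      (use moebius_denom_nonzero[OF z(2)[OF j]] in \<open>auto simp: S_def\<close>)
  then have smG: "smooth_on S G"
    unfolding G_def disc_moebius_def divide_inverse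
    using smooth_on_linear[OF S bounded_linear_snd]
    by (intro smooth_on_sum smooth_on_mult smooth_on_add smz S smooth_on_const)
  have nz: "1 + cnj w0 * z j x0 \<noteq> 0" if "j \<in> B" for j
    using moebius_denom_nonzero[OF z(2)[OF that] assms(6)] .
  have D: "((\<lambda>w. G (x0, w)) has_derivative (\<lambda>v. \<Sum>j\<in>B. of_real (m j) *
      (v / (1 + cnj w0 * z j x0) - (z j x0 + w0) * (cnj v * z j x0) / (1 + cnj w0 * z j x0)\<^sup>2))) (at w0)"
    unfolding G_def fst_conv snd_conv
    by (intro has_derivative_sum has_derivative_mult_right has_derivative_disc_moebius nz)
  have "(x0, w0) \<in> S" "G (x0, w0) = 0" using assms(6,7) by (auto simp: S_def G_def)
  then show ?thesis
  proof (rule smooth_implicit_function[OF S smG _ _ D])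
    show "v = 0" if "(\<Sum>j\<in>B. of_real (m j) * (v / (1 + cnj w0 * z j x0) -
        (z j x0 + w0) * (cnj v * z j x0) / (1 + cnj w0 * z j x0)\<^sup>2)) = 0" for v
      by (rule moebius_balanced_derivative_inj[OF assms(1-3) z(2) assms(6,7) that])
    fix W \<omega>
    assume "open W" "x0 \<in> W" "smooth_on W \<omega>" "\<And>x. x \<in> W \<Longrightarrow> (x, \<omega> x) \<in> S \<and> G (x, \<omega> x) = 0"
    then show ?thesis by (intro that[of W \<omega>]) (auto simp: S_def G_def)
  qed
qed

section \<open>Linkages in fixed gauge\<close>

text \<open>This is submersivity of a closing condition: turning a vector \<open>z j\<close> moves
  the sum along \<open>\<i> * z j\<close>, and two non-parallel vectors span the plane over the
  reals.\<close>

lemma closed_up_directions_span: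
  assumes "finite B" "nondegenerate B m" "\<And>j. j \<in> B \<Longrightarrow> m j > 0" "\<And>j. j \<in> B \<Longrightarrow> norm (z j) = 1"
    and "closed_up B m z"
  shows "\<exists>t :: 'i \<Rightarrow> real. (\<Sum>j\<in>B. of_real (m j) * (z j * of_real (t j))) = c"
proof -
  have "B \<noteq> {}" using assms(2) by (auto simp: nondegenerate_def)
  then obtain i where i: "i \<in> B" by blast
  then have "z i \<noteq> 0" using assms(4) by force
  then obtain k where k: "k \<in> B" "Im (cnj (z i) * z k) \<noteq> 0"
    using nondegenerate_not_collinear[OF assms(2,4,5)] by blast
  \<comment> \<open>\<open>d\<close> is the oriented area spanned by \<open>z i\<close> and
    \<open>z k\<close>; \<open>a\<close> and \<open>b\<close> are given by Cramer's rule.\<close>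
  define d where "d = Im (cnj (z i) * z k)"
  define a where "a = - Im (cnj (z k) * c) / d"
  define b where "b = Im (cnj (z i) * c) / d"
  have c: "of_real a * z i + of_real b * z k = c"
  proof -
    have d: "d \<noteq> 0" using k(2) by (simp add: d_def del: times_complex.sel)
    have "(of_real a * z i + of_real b * z k) * of_real d = of_real (a * d) * z i + of_real (b * d) * z k"
      by (simp add: algebra_simps)
    also have "\<dots> = of_real (- Im (cnj (z k) * c)) * z i + of_real (Im (cnj (z i) * c)) * z k"
    proof -
      have "a * d = - Im (cnj (z k) * c)" "b * d = Im (cnj (z i) * c)"
        using d by (simp_all add: a_def b_def del: times_complex.sel)
      then show ?thesis by (simp only:)
    qed
    also have "\<dots> = c * of_real d"
      by (simp add: complex_eq_iff d_def algebra_simps)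
    finally have "(of_real a * z i + of_real b * z k) * of_real d = c * of_real d" .
    moreover have "complex_of_real d \<noteq> 0" using k(2) by (simp add: d_def del: times_complex.sel)
    ultimately show ?thesis using mult_right_cancel by blast
  qed
  define t where "t j = (if j = i then a / m i else 0) + (if j = k then b / m k else 0)" for j
  have "of_real (m j) * (z j * of_real (t j)) =
      (if j = i then of_real a * z i else 0) + (if j = k then of_real b * z k else 0)" if "j \<in> B" for j
    using assms(3)[OF i] assms(3)[OF k(1)] by (auto simp: t_def field_simps)
  then have "(\<Sum>j\<in>B. of_real (m j) * (z j * of_real (t j))) =
      (\<Sum>j\<in>B. (if j = i then of_real a * z i else 0) + (if j = k then of_real b * z k else 0))"
    by (rule sum.cong[OF refl])
  also have "\<dots> = c" using assms(1) i k(1) by (simp add: sum.distrib c)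
  finally show ?thesis by blast
qed

section \<open>Arguments of Moebius factors by principal logarithms\<close>

lemma cis_double_Im_Ln:
  assumes "u \<noteq> 0"
  shows "cis (2 * Im (Ln u)) = u / cnj u"
proof -
  have n: "norm u \<noteq> 0" using assms by simp
  have "exp (Ln u) = u" using assms by simp
  then have "of_real (norm u) * cis (Im (Ln u)) = u"
    using assms by (simp add: exp_eq_polar Re_Ln exp_of_real[symmetric])
  then have c: "cis (Im (Ln u)) = u / of_real (norm u)" using n by (simp add: field_simps)
  have "cis (2 * Im (Ln u)) = cis (Im (Ln u)) * cis (Im (Ln u))" by (simp add: cis_mult)
  also have "\<dots> = (u * u) / (of_real ((norm u)\<^sup>2))" unfolding c by (simp add: power2_eq_square)
  also have "\<dots> = u / cnj u" unfolding complex_norm_square using assms by simp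
  finally show ?thesis .
qed

text \<open>Positive real part keeps \<open>u\<close> off the branch cut, so the angles cancel
  exactly and not only modulo \<open>2 * pi\<close>; hence the transport is inverted on the matrices
  themselves.\<close>

lemma Im_Ln_inverse_scale:
  assumes "c > 0" "Re u > 0"
  shows "Im (Ln (of_real c / u)) = - Im (Ln u)"
proof -
  have u: "u \<noteq> 0" "u \<notin> \<real>\<^sub>\<le>\<^sub>0" using assms(2) by (auto simp: complex_nonpos_Reals_iff)
  have "Ln (of_real c * inverse u) = of_real (ln c) + Ln (inverse u)"
    using Ln_times_of_real[of c "inverse u"] assms u by (simp add: Ln_of_real)
  then show ?thesis using Ln_inverse[OF u(2)] by (simp add: divide_inverse)
qed

lemma Re_one_plus_pos:
  assumes "norm w < 1" "norm z = 1"
  shows "Re (1 + w * cnj z) > 0"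
proof -
  have "\<bar>Re (w * cnj z)\<bar> < 1"
    using abs_Re_le_cmod[of "w * cnj z"] assms by (simp add: norm_mult)
  then show ?thesis by simp
qed

section \<open>Antisymmetric matrices up to gauge\<close>

lemma antisymmetric_space_iff:
  "\<alpha> \<in> antisymmetric_space E \<longleftrightarrow>
    (\<forall>r s. \<alpha> $ s $ r = - \<alpha> $ r $ s) \<and> (\<forall>r s. (r, s) \<notin> E \<longrightarrow> r \<noteq> s \<longrightarrow> \<alpha> $ r $ s = 0)"
  by (auto simp: antisymmetric_space_def supported_def transpose_def vec_eq_iff)

lemma subspace_antisymmetric_space:
  fixes E :: "('v::finite \<times> 'v) set"
  shows "subspace (antisymmetric_space E)"
proof -
  have *: "\<alpha> $ s $ r = - \<alpha> $ r $ s" if "\<alpha> \<in> antisymmetric_space E" for \<alpha> :: "real^'v^'v" and r s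
    using that unfolding antisymmetric_space_iff by blast
  have **: "\<alpha> $ r $ s = 0" if "\<alpha> \<in> antisymmetric_space E" "(r, s) \<notin> E" "r \<noteq> s"
    for \<alpha> :: "real^'v^'v" and r s
    using that unfolding antisymmetric_space_iff by blast
  show ?thesis
    unfolding subspace_def
  proof (intro conjI ballI allI)
    fix \<alpha> \<beta> :: "real^'v^'v" and c :: real
    assume \<alpha>: "\<alpha> \<in> antisymmetric_space E"
    show "c *\<^sub>R \<alpha> \<in> antisymmetric_space E"
      unfolding antisymmetric_space_iff
    proof (intro conjI allI impI)
      show "(c *\<^sub>R \<alpha>) $ s $ r = - (c *\<^sub>R \<alpha>) $ r $ s" for r s
        by (simp add: *[OF \<alpha>, of s r])
      show "(c *\<^sub>R \<alpha>) $ r $ s = 0" if "(r, s) \<notin> E" "r \<noteq> s" for r s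
        by (simp add: **[OF \<alpha> that])
    qed
    assume \<beta>: "\<beta> \<in> antisymmetric_space E"
    show "\<alpha> + \<beta> \<in> antisymmetric_space E"
      unfolding antisymmetric_space_iff
    proof (intro conjI allI impI)
      show "(\<alpha> + \<beta>) $ s $ r = - (\<alpha> + \<beta>) $ r $ s" for r s
        by (simp add: *[OF \<alpha>, of s r] *[OF \<beta>, of s r])
      show "(\<alpha> + \<beta>) $ r $ s = 0" if "(r, s) \<notin> E" "r \<noteq> s" for r s
        by (simp add: **[OF \<alpha> that] **[OF \<beta> that])
    qed
  qed (simp add: antisymmetric_space_iff)
qed

text \<open>Comparing phases on edges accounts at once for coboundaries and for entries in
  \<open>2 * pi\<close> times the integers. No matrix \<open>h\<close> appears, so one relation
  serves both tori.\<close>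

definition gauge_eq :: "('v::finite \<times> 'v) set \<Rightarrow> real^'v^'v \<Rightarrow> real^'v^'v \<Rightarrow> bool" where
  "gauge_eq E \<alpha> \<beta> \<longleftrightarrow>
    (\<exists>\<eta>. \<forall>r s. (r, s) \<in> E \<longrightarrow> cis (\<alpha> $ r $ s) = cis (\<eta> r - \<eta> s) * cis (\<beta> $ r $ s))"

lemma gauge_eq_sym: "gauge_eq E \<alpha> \<beta> \<Longrightarrow> gauge_eq E \<beta> \<alpha>"
  unfolding gauge_eq_def
proof (elim exE)
  fix \<eta> assume \<eta>: "\<forall>r s. (r, s) \<in> E \<longrightarrow> cis (\<alpha> $ r $ s) = cis (\<eta> r - \<eta> s) * cis (\<beta> $ r $ s)"
  show "\<exists>\<eta>. \<forall>r s. (r, s) \<in> E \<longrightarrow> cis (\<beta> $ r $ s) = cis (\<eta> r - \<eta> s) * cis (\<alpha> $ r $ s)"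
    using \<eta> by (intro exI[of _ "\<lambda>r. - \<eta> r"]) (simp add: cis_mult)
qed

text \<open>The functional \<open>p s\<close> sums a matrix along a path from \<open>s\<close> to \<open>root\<close> inside \<open>N\<close>; the gauge
  transformation with these phases normalises a matrix to \<open>\<alpha>0\<close> on \<open>N\<close> if that is possible.\<close>

locale gauge_fixing =
  fixes E :: "('v::finite \<times> 'v) set" and N :: "'v set" and root :: 'v
    and p :: "'v \<Rightarrow> real^'v^'v \<Rightarrow> real" and \<alpha>0 :: "real^'v^'v" and \<tau> :: "'v \<Rightarrow> 'v \<Rightarrow> real"
  assumes sym_E: "(r, s) \<in> E \<Longrightarrow> (s, r) \<in> E"
    and linear_p: "linear (p s)"
    and p_gauge: "(\<And>r t. r \<in> N \<Longrightarrow> t \<in> N \<Longrightarrow> (r, t) \<in> E \<Longrightarrow> cis (\<gamma> $ r $ t) = cis (\<eta> r - \<eta> t)) \<Longrightarrow>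
      s \<in> N \<Longrightarrow> cis (p s \<gamma>) = cis (\<eta> s - \<eta> root)"
    and p_zero: "(\<And>r t. r \<in> N \<Longrightarrow> t \<in> N \<Longrightarrow> \<gamma> $ r $ t = 0) \<Longrightarrow> p s \<gamma> = 0"
    and \<tau>_sign: "\<bar>\<tau> r s\<bar> = 1"
begin

definition nbrs :: "'v \<Rightarrow> 'v set" where
  "nbrs r = {s \<in> N. (r, s) \<in> E}"

text \<open>The phase \<open>p s\<close> carries the inner end \<open>s\<close> into the gauge that
  matches \<open>\<alpha>0\<close> on \<open>N\<close>. The outer end is left alone, since a phase
  at \<open>r\<close> rotates all its directions together. The sign \<open>\<tau> r s\<close> makes
  positive lengths possible.\<close>

definition dirn :: "'v \<Rightarrow> 'v \<Rightarrow> real^'v^'v \<Rightarrow> complex" where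
  "dirn r s \<alpha> = of_real (\<tau> r s) * cis (\<alpha> $ r $ s + p s (\<alpha> - \<alpha>0))"

text \<open>The flux of \<open>\<gamma>\<close> through the closed walk formed by the edge from
  \<open>r\<close> to \<open>s\<close>, the path from \<open>s\<close> to \<open>root\<close> and
  the reversed path to \<open>r\<close>; modulo \<open>2 * pi\<close> it is gauge invariant.\<close>

definition holonomy :: "'v \<Rightarrow> 'v \<Rightarrow> real^'v^'v \<Rightarrow> real" where
  "holonomy r s \<gamma> = \<gamma> $ r $ s - (p r \<gamma> - p s \<gamma>)"

text \<open>All conditions are gauge invariant, so this describes the whole preimage of a critical
  set and not a gauge slice. Asking that the phase of the holonomy be 1 admits multiples of
  \<open>2 * pi\<close>.\<close>

definition linkages :: "('v \<Rightarrow> 'v \<Rightarrow> real) \<Rightarrow> (real^'v^'v) set" where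
  "linkages m = {\<alpha> \<in> antisymmetric_space E.
    (\<forall>r\<in>N. \<forall>s\<in>N. (r, s) \<in> E \<longrightarrow> cis (holonomy r s (\<alpha> - \<alpha>0)) = 1) \<and>
    (\<forall>r. r \<notin> N \<longrightarrow> closed_up (nbrs r) (m r) (\<lambda>s. dirn r s \<alpha>))}"

lemma bounded_linear_p: "bounded_linear (p s)"
  using linear_p by (simp add: linear_conv_bounded_linear)

lemma linear_holonomy: "linear (holonomy r s)"
  by (intro linearI) (simp_all add: holonomy_def linear_add[OF linear_p] linear_cmul[OF linear_p]
      algebra_simps)

lemma norm_dirn [simp]: "norm (dirn r s \<alpha>) = 1"
  using \<tau>_sign[of r s] by (simp add: dirn_def norm_mult)

lemma smooth_on_dirn: "smooth_on UNIV (dirn r s)"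
proof -
  have "bounded_linear (\<lambda>\<alpha>::real^'v^'v. \<alpha> $ r $ s)"
    by (intro bounded_linear_compose[OF bounded_linear_vec_nth] bounded_linear_vec_nth)
  then show ?thesis
    unfolding dirn_def
    by (intro smooth_on_mult smooth_on_const smooth_on_cis smooth_on_add open_UNIV
        smooth_on_linear smooth_on_bounded_linear[OF open_UNIV bounded_linear_p] smooth_on_diff
        bounded_linear_ident)
qed

lemma has_derivative_dirn:
  "(dirn r s has_derivative (\<lambda>\<gamma>. dirn r s \<alpha> * (\<i> * of_real (\<gamma> $ r $ s + p s \<gamma>)))) (at \<alpha>)"
proof -
  define f where "f \<alpha> = \<i> * of_real (\<alpha> $ r $ s + p s (\<alpha> - \<alpha>0))" for \<alpha> :: "real^'v^'v"
  have nth: "bounded_linear (\<lambda>\<alpha>::real^'v^'v. \<alpha> $ r $ s)"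
    by (intro bounded_linear_compose[OF bounded_linear_vec_nth] bounded_linear_vec_nth)
  have "(f has_derivative (\<lambda>\<gamma>. \<i> * of_real (\<gamma> $ r $ s + p s (\<gamma> - 0)))) (at \<alpha>)"
    unfolding f_def
    by (intro has_derivative_mult_right has_derivative_of_real has_derivative_add
        bounded_linear_imp_has_derivative[OF nth] bounded_linear.has_derivative[OF bounded_linear_p]
        has_derivative_diff has_derivative_ident has_derivative_const)
  from has_derivative_compose[OF this DERIV_exp[unfolded has_field_derivative_def]]
  have "((\<lambda>\<alpha>. of_real (\<tau> r s) * exp (f \<alpha>)) has_derivative
      (\<lambda>\<gamma>. of_real (\<tau> r s) * (exp (f \<alpha>) * (\<i> * of_real (\<gamma> $ r $ s + p s (\<gamma> - 0)))))) (at \<alpha>)"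
    by (rule has_derivative_mult_right)
  moreover have "dirn r s = (\<lambda>\<alpha>. of_real (\<tau> r s) * exp (f \<alpha>))"
    by (simp add: fun_eq_iff dirn_def f_def cis_conv_exp)
  ultimately show ?thesis by (simp add: mult.assoc)
qed

definition slice_space :: "(real^'v^'v) set" where
  "slice_space = {\<gamma> \<in> antisymmetric_space E. \<forall>r\<in>N. \<forall>s\<in>N. (r, s) \<in> E \<longrightarrow> holonomy r s \<gamma> = 0}"

definition row_space :: "(complex^'v) set" where
  "row_space = {b. \<forall>r. \<not> (r \<notin> N \<and> nbrs r \<noteq> {}) \<longrightarrow> b $ r = 0}"

lemma subspace_slice_space: "subspace slice_space"
  using subspace_antisymmetric_space[of E]
  by (auto simp: slice_space_def subspace_def linear_add[OF linear_holonomy]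
      linear_cmul[OF linear_holonomy] linear_0[OF linear_holonomy])

lemma subspace_row_space: "subspace row_space"
  by (auto simp: row_space_def subspace_def)

text \<open>The closing equations at different outer vertices involve different edges, none of them
  seen by \<open>p\<close>; each equation can be solved independently.\<close>

lemma linkage_derivative_image:
  assumes nondeg: "\<And>r. r \<notin> N \<Longrightarrow> nbrs r \<noteq> {} \<Longrightarrow> nondegenerate (nbrs r) (m r) \<and> (\<forall>s\<in>nbrs r. m r s > 0)"
    and "\<alpha> \<in> linkages m"
    and D: "\<And>\<gamma> r. D \<gamma> $ r = (if r \<notin> N \<and> nbrs r \<noteq> {} then
      \<Sum>s\<in>nbrs r. of_real (m r s) * (dirn r s \<alpha> * (\<i> * of_real (\<gamma> $ r $ s + p s \<gamma>))) else 0)"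
  shows "D ` slice_space = row_space"
proof (intro equalityI subsetI)
  fix b assume "b \<in> D ` slice_space"
  then show "b \<in> row_space" by (auto simp: row_space_def D)
next
  fix b assume b: "b \<in> row_space"
  have "\<exists>t. r \<notin> N \<longrightarrow> nbrs r \<noteq> {} \<longrightarrow>
      (\<Sum>s\<in>nbrs r. of_real (m r s) * (dirn r s \<alpha> * of_real (t s))) = b $ r / \<i>" for r
  proof (cases "r \<notin> N \<and> nbrs r \<noteq> {}")
    case True
    then show ?thesis
      using closed_up_directions_span[of "nbrs r" "m r" "\<lambda>s. dirn r s \<alpha>" "b $ r / \<i>"] nondeg[of r] assms(2)
      by (auto simp: linkages_def)
  qed auto
  then have "\<forall>r. \<exists>t. r \<notin> N \<longrightarrow> nbrs r \<noteq> {} \<longrightarrow>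
      (\<Sum>s\<in>nbrs r. of_real (m r s) * (dirn r s \<alpha> * of_real (t s))) = b $ r / \<i>" ..
  from choice[OF this] obtain t where t: "\<And>r. r \<notin> N \<Longrightarrow> nbrs r \<noteq> {} \<Longrightarrow>
      (\<Sum>s\<in>nbrs r. of_real (m r s) * (dirn r s \<alpha> * of_real (t r s))) = b $ r / \<i>"
    by blast
  \<comment> \<open>Entries are nonzero only between \<open>N\<close> and its complement, where just
    one of the two terms survives; the difference makes \<open>\<gamma>\<close>
    antisymmetric.\<close>
  define \<gamma> :: "real^'v^'v" where
    "\<gamma> = (\<chi> r s. (if r \<notin> N \<and> s \<in> nbrs r then t r s else 0) - (if s \<notin> N \<and> r \<in> nbrs s then t s r else 0))"
  have p\<gamma>: "p s \<gamma> = 0" for s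
    by (rule p_zero) (simp add: \<gamma>_def)
  have "\<gamma> \<in> slice_space"
    using sym_E by (auto simp: slice_space_def antisymmetric_space_iff holonomy_def p\<gamma>)
      (auto simp: \<gamma>_def nbrs_def)
  moreover have "D \<gamma> = b"
  proof (subst vec_eq_iff, rule allI)
    fix r
    show "D \<gamma> $ r = b $ r"
    proof (cases "r \<notin> N \<and> nbrs r \<noteq> {}")
      case True
      have "\<gamma> $ r $ s = t r s" if "s \<in> nbrs r" for s
        using True that by (simp add: \<gamma>_def nbrs_def)
      then have "D \<gamma> $ r = (\<Sum>s\<in>nbrs r. of_real (m r s) * (dirn r s \<alpha> * (\<i> * of_real (t r s))))"
        using True by (simp add: D p\<gamma>)
      also have "\<dots> = \<i> * (\<Sum>s\<in>nbrs r. of_real (m r s) * (dirn r s \<alpha> * of_real (t r s)))"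
        unfolding sum_distrib_left by (intro sum.cong refl) simp
      also have "\<dots> = b $ r" using t[of r] True by simp
      finally show ?thesis .
    next
      case False
      then show ?thesis using b by (auto simp: D row_space_def)
    qed
  qed
  ultimately show "b \<in> D ` slice_space" by blast
qed

lemma cis_eq_1_small: "cis t = 1 \<Longrightarrow> \<bar>t\<bar> < 1 \<Longrightarrow> t = 0"
proof -
  assume "cis t = 1" "\<bar>t\<bar> < 1"
  then obtain k :: int where k: "t = 2 * pi * k"
    using cos_one_2pi_int[of t] by (auto simp: complex_eq_iff mult_ac)
  have "k = 0"
  proof (rule ccontr)
    assume "k \<noteq> 0"
    then have "1 \<le> \<bar>real_of_int k\<bar>" by linarith
    then have "2 * pi * 1 \<le> \<bar>t\<bar>" unfolding k abs_mult by (intro mult_mono) auto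
    then show False using \<open>\<bar>t\<bar> < 1\<close> pi_gt3 by linarith
  qed
  then show "t = 0" by (simp add: k)
qed

lemma smooth_submanifold_linkages:
  assumes nondeg: "\<And>r. r \<notin> N \<Longrightarrow> nbrs r \<noteq> {} \<Longrightarrow> nondegenerate (nbrs r) (m r) \<and> (\<forall>s\<in>nbrs r. m r s > 0)"
  shows "smooth_submanifold (dim slice_space - dim row_space) (linkages m)"
proof (rule smooth_submanifoldI[OF subspace_slice_space subspace_row_space])
  fix x0 assume x0: "x0 \<in> linkages m"
  define g where "g x = (\<chi> r. if r \<notin> N \<and> nbrs r \<noteq> {} then
    \<Sum>s\<in>nbrs r. of_real (m r s) * dirn r s x else 0)" for x
  \<comment> \<open>On \<open>U\<close> the holonomies move by less than 1, hence by less than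
    \<open>2 * pi\<close>; there the condition on their phases becomes linear.\<close>
  define U where "U = (\<Inter>(r, s)\<in>UNIV. {x. \<bar>holonomy r s (x - x0)\<bar> < 1})"
  have cont: "continuous_on UNIV (\<lambda>x. holonomy r s (x - x0))" for r s
    by (rule bounded_linear.continuous_on[OF linear_holonomy[unfolded linear_conv_bounded_linear]
          continuous_on_diff[OF continuous_on_id continuous_on_const]])
  have U: "open U"
    unfolding U_def
    by (intro open_INT) (auto intro!: open_Collect_less continuous_intros cont)
  have "x0 \<in> U" by (simp add: U_def linear_0[OF linear_holonomy])
  have "smooth_on UNIV (\<lambda>x. \<Sum>s\<in>nbrs r. of_real (m r s) * dirn r s x)" for r
    by (intro smooth_on_sum smooth_on_mult smooth_on_dirn smooth_on_const open_UNIV)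
  then have "smooth_on UNIV (\<lambda>x. if r \<notin> N \<and> nbrs r \<noteq> {} then
      \<Sum>s\<in>nbrs r. of_real (m r s) * dirn r s x else 0)" for r
    by (cases "r \<notin> N \<and> nbrs r \<noteq> {}") (auto simp: smooth_on_const)
  then have smg: "smooth_on UNIV g"
    unfolding g_def by (intro smooth_on_vec_lambda open_UNIV)
  have dg: "(g has_derivative frechet_derivative g (at x0)) (at x0)"
    using smooth_on_has_derivative[OF smg UNIV_I] .
  have D: "frechet_derivative g (at x0) \<gamma> $ r = (if r \<notin> N \<and> nbrs r \<noteq> {} then
      \<Sum>s\<in>nbrs r. of_real (m r s) * (dirn r s x0 * (\<i> * of_real (\<gamma> $ r $ s + p s \<gamma>))) else 0)" for \<gamma> r
  proof -
    have 1: "((\<lambda>x. g x $ r) has_derivative (\<lambda>\<gamma>. frechet_derivative g (at x0) \<gamma> $ r)) (at x0)"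
      by (rule bounded_linear.has_derivative[OF bounded_linear_vec_nth dg])
    have 2: "((\<lambda>x. g x $ r) has_derivative (\<lambda>\<gamma>. if r \<notin> N \<and> nbrs r \<noteq> {} then
      \<Sum>s\<in>nbrs r. of_real (m r s) * (dirn r s x0 * (\<i> * of_real (\<gamma> $ r $ s + p s \<gamma>))) else 0)) (at x0)"
      by (cases "r \<notin> N \<and> nbrs r \<noteq> {}")
        (auto simp: g_def simp del: of_real_add
          intro!: has_derivative_sum has_derivative_mult_right has_derivative_dirn)
    show ?thesis using fun_cong[OF has_derivative_unique[OF 1 2]] .
  qed
  have "linkages m \<inter> U = {x \<in> U. x - x0 \<in> slice_space \<and> g x = 0}"
  proof -
    have "x \<in> linkages m \<longleftrightarrow> x - x0 \<in> slice_space \<and> g x = 0" if x: "x \<in> U" for x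
    proof -
      have A0: "x0 \<in> antisymmetric_space E" using x0 by (simp add: linkages_def)
      have "x \<in> antisymmetric_space E \<longleftrightarrow> x - x0 \<in> antisymmetric_space E"
        using subspace_diff[OF subspace_antisymmetric_space _ A0]
          subspace_add[OF subspace_antisymmetric_space _ A0, of "x - x0"] by auto
      moreover have "cis (holonomy r s (x - \<alpha>0)) = 1 \<longleftrightarrow> holonomy r s (x - x0) = 0"
        if e: "r \<in> N" "s \<in> N" "(r, s) \<in> E" for r s
      proof -
        have "holonomy r s (x - \<alpha>0) = holonomy r s (x - x0) + holonomy r s (x0 - \<alpha>0)"
          by (simp add: linear_add[OF linear_holonomy, symmetric])
        then have "cis (holonomy r s (x - \<alpha>0)) = cis (holonomy r s (x - x0))"
          using x0 e by (auto simp: linkages_def cis_mult[symmetric])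
        moreover have "\<bar>holonomy r s (x - x0)\<bar> < 1" using x by (auto simp: U_def)
        ultimately show ?thesis using cis_eq_1_small by auto
      qed
      moreover have "(\<forall>r. r \<notin> N \<longrightarrow> closed_up (nbrs r) (m r) (\<lambda>s. dirn r s x)) \<longleftrightarrow> g x = 0"
        by (auto simp: g_def vec_eq_iff)
      ultimately show ?thesis by (auto simp: linkages_def slice_space_def)
    qed
    then show ?thesis by blast
  qed
  moreover have "g ` U \<subseteq> row_space" by (auto simp: row_space_def g_def)
  moreover have "smooth_on U g" using smg smooth_on_subset by blast
  moreover have "frechet_derivative g (at x0) ` slice_space = row_space"
    by (rule linkage_derivative_image[OF nondeg x0 D])
  ultimately show "\<exists>U g. open U \<and> x0 \<in> U \<and> smooth_on U g \<and> g ` U \<subseteq> row_space \<and>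
      linkages m \<inter> U = {x \<in> U. x - x0 \<in> slice_space \<and> g x = 0} \<and>
      frechet_derivative g (at x0) ` slice_space = row_space"
    using U \<open>x0 \<in> U\<close> by (intro exI[of _ U] exI[of _ g]) simp
qed

section \<open>Transport between linkages of different lengths\<close>

definition bent :: "'v \<Rightarrow> bool" where
  "bent r \<longleftrightarrow> r \<notin> N \<and> nbrs r \<noteq> {}"

text \<open>The choice carries information on linkages, for good pairs; elsewhere existence may fail
  and the value is arbitrary.\<close>

definition balancing :: "('v \<Rightarrow> 'v \<Rightarrow> real) \<Rightarrow> 'v \<Rightarrow> real^'v^'v \<Rightarrow> complex" where
  "balancing m r \<alpha> =
    (SOME w. norm w < 1 \<and> closed_up (nbrs r) (m r) (\<lambda>s. disc_moebius w (dirn r s \<alpha>)))"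

text \<open>The argument of the Moebius factor as a real angle and not as a phase, so that it can be
  added to a matrix entry.\<close>

definition turn :: "complex \<Rightarrow> 'v \<Rightarrow> 'v \<Rightarrow> real^'v^'v \<Rightarrow> real" where
  "turn w r s \<alpha> = (if bent r \<and> s \<in> nbrs r then 2 * Im (Ln (1 + w * cnj (dirn r s \<alpha>))) else 0)"

text \<open>Along an edge between \<open>N\<close> and its complement at most one of the two turns
  is nonzero; both are written for the sake of antisymmetry.\<close>

definition turned :: "('v \<Rightarrow> complex) \<Rightarrow> real^'v^'v \<Rightarrow> real^'v^'v" where
  "turned w \<alpha> = (\<chi> r s. \<alpha> $ r $ s + turn (w r) r s \<alpha> - turn (w s) s r \<alpha>)"

definition transport :: "('v \<Rightarrow> 'v \<Rightarrow> real) \<Rightarrow> real^'v^'v \<Rightarrow> real^'v^'v" where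
  "transport m \<alpha> = turned (\<lambda>r. balancing m r \<alpha>) \<alpha>"

lemma turned_antisymmetric:
  assumes "\<alpha> \<in> antisymmetric_space E"
  shows "turned w \<alpha> \<in> antisymmetric_space E"
proof -
  have a: "\<alpha> $ s $ r = - \<alpha> $ r $ s" for r s
    using assms unfolding antisymmetric_space_iff by blast
  have "turned w \<alpha> $ s $ r = - turned w \<alpha> $ r $ s" for r s
    by (simp add: turned_def a[of s r])
  moreover have "turned w \<alpha> $ r $ s = 0" if "(r, s) \<notin> E" "r \<noteq> s" for r s
  proof -
    have "\<alpha> $ r $ s = 0" using assms that unfolding antisymmetric_space_iff by blast
    moreover have "(s, r) \<notin> E" using sym_E that by blast
    ultimately show ?thesis using that by (simp add: turned_def turn_def nbrs_def)
  qed
  ultimately show ?thesis unfolding antisymmetric_space_iff by blast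
qed

lemma p_turned: "p s (turned w \<alpha> - \<alpha>0) = p s (\<alpha> - \<alpha>0)"
proof -
  have "p s (turned w \<alpha> - \<alpha>) = 0"
    by (rule p_zero) (simp add: turned_def turn_def bent_def)
  moreover have "p s (turned w \<alpha> - \<alpha>0) = p s (turned w \<alpha> - \<alpha>) + p s (\<alpha> - \<alpha>0)"
    by (simp add: linear_add[OF linear_p, symmetric])
  ultimately show ?thesis by simp
qed

lemma holonomy_turned:
  "r \<in> N \<Longrightarrow> s \<in> N \<Longrightarrow> holonomy r s (turned w \<alpha> - \<alpha>0) = holonomy r s (\<alpha> - \<alpha>0)"
  using p_turned by (simp add: holonomy_def) (simp add: turned_def turn_def bent_def)

lemma dirn_turned:
  assumes "bent r" "s \<in> nbrs r" "norm (w r) < 1"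
  shows "dirn r s (turned w \<alpha>) = disc_moebius (w r) (dirn r s \<alpha>)"
proof -
  define u where "u = 1 + w r * cnj (dirn r s \<alpha>)"
  have u: "u \<noteq> 0" using Re_one_plus_pos[OF assms(3) norm_dirn[of r s \<alpha>]]
    unfolding u_def by (metis less_irrefl zero_complex.sel(1))
  have "turned w \<alpha> $ r $ s = \<alpha> $ r $ s + 2 * Im (Ln u)"
    using assms by (simp add: turned_def turn_def bent_def nbrs_def u_def)
  then have "dirn r s (turned w \<alpha>) =
      of_real (\<tau> r s) * cis ((\<alpha> $ r $ s + p s (\<alpha> - \<alpha>0)) + 2 * Im (Ln u))"
    by (simp add: dirn_def p_turned add_ac)
  also have "\<dots> = dirn r s \<alpha> * (u / cnj u)"
    unfolding dirn_def cis_mult[of _ "2 * Im (Ln u)", symmetric] cis_double_Im_Ln[OF u]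
    by (simp only: mult.assoc)
  also have "\<dots> = disc_moebius (w r) (dirn r s \<alpha>)"
    unfolding moebius_eq_unit[OF norm_dirn] by (simp add: u_def)
  finally show ?thesis .
qed

definition transportable :: "('v \<Rightarrow> 'v \<Rightarrow> real) \<Rightarrow> ('v \<Rightarrow> 'v \<Rightarrow> real) \<Rightarrow> bool" where
  "transportable m m' \<longleftrightarrow> (\<forall>r. bent r \<longrightarrow> good_pair (nbrs r) (m r) (m' r))"

lemma balancing:
  assumes "transportable m m'" "\<alpha> \<in> linkages m" "bent r"
  shows "norm (balancing m' r \<alpha>) < 1"
    "closed_up (nbrs r) (m' r) (\<lambda>s. disc_moebius (balancing m' r \<alpha>) (dirn r s \<alpha>))"
proof -
  have "\<exists>w. norm w < 1 \<and> closed_up (nbrs r) (m' r) (\<lambda>s. disc_moebius w (dirn r s \<alpha>))"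
    using assms unfolding transportable_def good_pair_def linkages_def bent_def by force
  from someI_ex[OF this] show "norm (balancing m' r \<alpha>) < 1"
    "closed_up (nbrs r) (m' r) (\<lambda>s. disc_moebius (balancing m' r \<alpha>) (dirn r s \<alpha>))"
    unfolding balancing_def by blast+
qed

text \<open>This makes the choice in \<open>balancing\<close> usable: it identifies the parameter of
  the reverse transport, its rotation under gauge changes, and its agreement with a smooth
  solution.\<close>

lemma balancing_unique:
  assumes "transportable m m'" "\<alpha> \<in> linkages m" "bent r"
    and "norm w < 1" "closed_up (nbrs r) (m' r) (\<lambda>s. disc_moebius w (dirn r s \<alpha>))"
  shows "balancing m' r \<alpha> = w"
  using assms(1,3)
  by (intro moebius_balanced_unique[OF _ _ _ _ balancing(1)[OF assms(1-3)] assms(4)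
        balancing(2)[OF assms(1-3)] assms(5)])
    (auto simp: transportable_def good_pair_def)

lemma transport_in_linkages:
  assumes "transportable m m'" "\<alpha> \<in> linkages m"
  shows "transport m' \<alpha> \<in> linkages m'"
proof -
  have "closed_up (nbrs r) (m' r) (\<lambda>s. dirn r s (transport m' \<alpha>))" if r: "r \<notin> N" for r
  proof (cases "nbrs r = {}")
    case False
    then have b: "bent r" using r by (simp add: bent_def)
    have "(\<Sum>s\<in>nbrs r. of_real (m' r s) * dirn r s (transport m' \<alpha>)) =
        (\<Sum>s\<in>nbrs r. of_real (m' r s) * disc_moebius (balancing m' r \<alpha>) (dirn r s \<alpha>))"
      unfolding transport_def
      by (intro sum.cong refl arg_cong2[of _ _ _ _ "(*)"] dirn_turned[OF b] balancing(1)[OF assms b])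
    then show ?thesis using balancing(2)[OF assms b] by simp
  qed simp
  then show ?thesis
    using assms(2) turned_antisymmetric
    by (auto simp: linkages_def holonomy_turned transport_def)
qed

text \<open>Moving the transported directions by \<open>- w\<close> restores those of
  \<open>\<alpha>\<close>, which close up for \<open>m\<close>; by uniqueness \<open>- w\<close> is
  the parameter of the way back, and it remains to cancel the real angles.\<close>

lemma transport_transport:
  assumes "transportable m m'" "transportable m' m" "\<alpha> \<in> linkages m"
  shows "transport m (transport m' \<alpha>) = \<alpha>"
proof -
  have X: "transport m' \<alpha> \<in> linkages m'" by (rule transport_in_linkages[OF assms(1,3)])
  have "turn (balancing m r (transport m' \<alpha>)) r s (transport m' \<alpha>) = - turn (balancing m' r \<alpha>) r s \<alpha>"
    for r s
  proof (cases "bent r \<and> s \<in> nbrs r")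
    case True
    define w where "w = balancing m' r \<alpha>"
    have w: "norm w < 1" unfolding w_def using balancing(1)[OF assms(1,3)] True by blast
    have dn: "dirn r s (transport m' \<alpha>) = disc_moebius w (dirn r s \<alpha>)" if "s \<in> nbrs r" for s
      unfolding transport_def w_def
      using True that balancing(1)[OF assms(1,3)] by (intro dirn_turned) auto
    have closed_back: "balancing m r (transport m' \<alpha>) = - w"
    proof (rule balancing_unique[OF assms(2) X])
      have "(\<Sum>s\<in>nbrs r. of_real (m r s) * disc_moebius (- w) (dirn r s (transport m' \<alpha>))) =
          (\<Sum>s\<in>nbrs r. of_real (m r s) * dirn r s \<alpha>)"
        by (intro sum.cong refl) (simp add: dn moebius_minus_moebius[OF norm_dirn w])
      then show "closed_up (nbrs r) (m r) (\<lambda>s. disc_moebius (- w) (dirn r s (transport m' \<alpha>)))"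
        using assms(3) True by (simp add: linkages_def bent_def)
    qed (use w True in auto)
    define z where "z = dirn r s \<alpha>"
    have z: "norm z = 1" by (simp add: z_def)
    have "1 + cnj w * z \<noteq> 0" by (rule moebius_denom_nonzero[OF z w])
    then have nz: "1 + w * cnj z \<noteq> 0" by (metis complex_cnj_add complex_cnj_cnj complex_cnj_mult complex_cnj_one complex_cnj_zero)
    \<comment> \<open>The factor of the way back is a positive multiple of the inverse of the factor
      of the way there, so the principal arguments are opposite.\<close>
    have "1 + (- w) * cnj (disc_moebius w z) = 1 - w * ((cnj z + cnj w) / (1 + w * cnj z))"
      by (simp add: disc_moebius_def)
    also have "\<dots> = (1 - w * cnj w) / (1 + w * cnj z)"
      using nz by (simp add: field_simps)
    also have "1 - w * cnj w = of_real (1 - (norm w)\<^sup>2)"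
      unfolding of_real_diff complex_norm_square by simp
    finally have eq: "1 + (- w) * cnj (disc_moebius w z) = of_real (1 - (norm w)\<^sup>2) / (1 + w * cnj z)" .
    have "1 - (norm w)\<^sup>2 > 0" using w by (simp add: power_less_one_iff abs_square_less_1)
    from Im_Ln_inverse_scale[OF this Re_one_plus_pos[OF w z]]
    have "Im (Ln (1 + (- w) * cnj (disc_moebius w z))) = - Im (Ln (1 + w * cnj z))"
      by (simp only: eq)
    then show ?thesis
      using True by (simp add: turn_def closed_back dn w_def[symmetric] z_def)
  qed (auto simp: turn_def)
  then show ?thesis
    unfolding transport_def[of m] turned_def by (simp add: vec_eq_iff)
      (simp add: transport_def turned_def)
qed

text \<open>The gauge phase at \<open>s\<close> cancels against the one picked up along the path
  from \<open>s\<close> to \<open>root\<close>. What remains is a common rotation of all directions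
  at \<open>r\<close>.\<close>

lemma dirn_gauge:
  assumes "\<And>r s. (r, s) \<in> E \<Longrightarrow> cis (\<alpha> $ r $ s) = cis (\<eta> r - \<eta> s) * cis (\<beta> $ r $ s)"
    and "s \<in> nbrs r"
  shows "dirn r s \<alpha> = cis (\<eta> r - \<eta> root) * dirn r s \<beta>"
proof -
  have s: "s \<in> N" "(r, s) \<in> E" using assms(2) by (auto simp: nbrs_def)
  have "cis (p s (\<alpha> - \<beta>)) = cis (\<eta> s - \<eta> root)"
  proof (rule p_gauge[OF _ s(1)])
    fix r t assume "(r, t) \<in> E"
    from assms(1)[OF this] show "cis ((\<alpha> - \<beta>) $ r $ t) = cis (\<eta> r - \<eta> t)"
      by (simp add: cis_divide[symmetric])
  qed
  moreover have "p s (\<alpha> - \<alpha>0) = p s (\<alpha> - \<beta>) + p s (\<beta> - \<alpha>0)"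
    by (simp add: linear_add[OF linear_p, symmetric])
  ultimately have "dirn r s \<alpha> = of_real (\<tau> r s) *
      (cis (\<eta> r - \<eta> s) * cis (\<beta> $ r $ s) * (cis (\<eta> s - \<eta> root) * cis (p s (\<beta> - \<alpha>0))))"
    unfolding dirn_def using assms(1)[OF s(2)] by (simp only: cis_mult[symmetric])
  also have "\<dots> = (cis (\<eta> r - \<eta> s) * cis (\<eta> s - \<eta> root)) * dirn r s \<beta>"
    unfolding dirn_def cis_mult[of "\<beta> $ r $ s", symmetric] by (simp only: mult_ac)
  also have "cis (\<eta> r - \<eta> s) * cis (\<eta> s - \<eta> root) = cis (\<eta> r - \<eta> root)"
    by (simp add: cis_mult)
  finally show ?thesis .
qed

lemma transport_gauge:
  assumes "transportable m m'" "\<alpha> \<in> linkages m" "\<beta> \<in> linkages m" "gauge_eq E \<alpha> \<beta>"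
  shows "gauge_eq E (transport m' \<alpha>) (transport m' \<beta>)"
proof -
  obtain \<eta> where \<eta>: "\<And>r s. (r, s) \<in> E \<Longrightarrow> cis (\<alpha> $ r $ s) = cis (\<eta> r - \<eta> s) * cis (\<beta> $ r $ s)"
    using assms(4) unfolding gauge_eq_def by blast
  note dn = dirn_gauge[OF \<eta>]
  \<comment> \<open>Directions and balancing parameter rotate by the same unit \<open>c\<close>; the
    product of one with the conjugate of the other, and with it the turn, is unchanged.\<close>
  have turn: "turn (balancing m' r \<alpha>) r s \<alpha> = turn (balancing m' r \<beta>) r s \<beta>" for r s
  proof (cases "bent r \<and> s \<in> nbrs r")
    case True
    define c where "c = cis (\<eta> r - \<eta> root)"
    have c: "norm c = 1" by (simp add: c_def)
    have "balancing m' r \<alpha> = c * balancing m' r \<beta>"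
    proof (rule balancing_unique[OF assms(1,2)])
      have "(\<Sum>s\<in>nbrs r. of_real (m' r s) * disc_moebius (c * balancing m' r \<beta>) (dirn r s \<alpha>)) =
          (\<Sum>s\<in>nbrs r. c * (of_real (m' r s) * disc_moebius (balancing m' r \<beta>) (dirn r s \<beta>)))"
        by (intro sum.cong refl) (simp add: dn c_def[symmetric] moebius_rotate[OF c])
      also have "\<dots> = 0"
        using balancing(2)[OF assms(1,3), of r] True by (simp add: sum_distrib_left[symmetric])
      finally show "closed_up (nbrs r) (m' r)
          (\<lambda>s. disc_moebius (c * balancing m' r \<beta>) (dirn r s \<alpha>))" .
    qed (use True balancing(1)[OF assms(1,3)] c in \<open>auto simp: norm_mult\<close>)
    then have "balancing m' r \<alpha> * cnj (dirn r s \<alpha>) =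
        (c * cnj c) * (balancing m' r \<beta> * cnj (dirn r s \<beta>))"
      using True by (simp add: dn c_def[symmetric] mult_ac)
    then show ?thesis using unit_cnj[OF c] by (simp add: turn_def)
  qed (auto simp: turn_def)
  have "cis (transport m' \<alpha> $ r $ s) = cis (\<eta> r - \<eta> s) * cis (transport m' \<beta> $ r $ s)"
    if "(r, s) \<in> E" for r s
  proof -
    define k where "k = turn (balancing m' r \<beta>) r s \<beta> - turn (balancing m' s \<beta>) s r \<beta>"
    have "transport m' \<alpha> $ r $ s = \<alpha> $ r $ s + k" "transport m' \<beta> $ r $ s = \<beta> $ r $ s + k"
      by (simp_all add: transport_def turned_def turn k_def)
    then show ?thesis using \<eta>[OF that] by (simp add: cis_mult[symmetric] mult.assoc)
  qed
  then show ?thesis unfolding gauge_eq_def by blast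
qed

lemma linkages_gauge:
  assumes "\<alpha> \<in> linkages m" "\<beta> \<in> antisymmetric_space E" "gauge_eq E \<alpha> \<beta>"
  shows "\<beta> \<in> linkages m"
proof -
  obtain \<eta> where \<eta>: "\<And>r s. (r, s) \<in> E \<Longrightarrow> cis (\<alpha> $ r $ s) = cis (\<eta> r - \<eta> s) * cis (\<beta> $ r $ s)"
    using assms(3) unfolding gauge_eq_def by blast
  have "cis (holonomy r s (\<beta> - \<alpha>0)) = 1" if e: "r \<in> N" "s \<in> N" "(r, s) \<in> E" for r s
  proof -
    have d: "cis ((\<alpha> - \<beta>) $ r $ t) = cis (\<eta> r - \<eta> t)" if "(r, t) \<in> E" for r t
      using \<eta>[OF that] by (simp add: cis_divide[symmetric])
    have pr: "cis (p t (\<alpha> - \<beta>)) = cis (\<eta> t - \<eta> root)" if "t \<in> N" for t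
      using p_gauge[OF d that] .
    have "cis (holonomy r s (\<alpha> - \<beta>)) = cis (\<eta> r - \<eta> s) / (cis (\<eta> r - \<eta> root) / cis (\<eta> s - \<eta> root))"
      unfolding holonomy_def cis_divide[symmetric] d[OF e(3)] pr[OF e(1)] pr[OF e(2)] ..
    also have "\<dots> = 1" by (simp add: cis_divide)
    finally have "cis (holonomy r s (\<alpha> - \<beta>)) = 1" .
    have "holonomy r s (\<alpha> - \<alpha>0) = holonomy r s (\<alpha> - \<beta>) + holonomy r s (\<beta> - \<alpha>0)"
      by (simp add: linear_add[OF linear_holonomy, symmetric])
    then have "cis (holonomy r s (\<alpha> - \<alpha>0)) = cis (holonomy r s (\<alpha> - \<beta>)) * cis (holonomy r s (\<beta> - \<alpha>0))"
      by (simp only: cis_mult)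
    moreover have "cis (holonomy r s (\<alpha> - \<alpha>0)) = 1"
      using assms(1) e by (simp add: linkages_def)
    ultimately show ?thesis using \<open>cis (holonomy r s (\<alpha> - \<beta>)) = 1\<close> by simp
  qed
  moreover have "closed_up (nbrs r) (m r) (\<lambda>s. dirn r s \<beta>)" if "r \<notin> N" for r
  proof -
    have "(\<Sum>s\<in>nbrs r. of_real (m r s) * dirn r s \<alpha>) =
        cis (\<eta> r - \<eta> root) * (\<Sum>s\<in>nbrs r. of_real (m r s) * dirn r s \<beta>)"
      unfolding sum_distrib_left
      by (intro sum.cong refl) (simp add: dirn_gauge[OF \<eta>])
    then show ?thesis using assms(1) that by (simp add: linkages_def)
  qed
  ultimately show ?thesis using assms(2) by (simp add: linkages_def)
qed

text \<open>Off the linkages the chosen parameter is out of control, so \<open>\<Phi>\<close> is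
  built from local implicit functions and agrees with the transport on linkages by
  uniqueness.\<close>

lemma transport_locally_smooth:
  assumes "transportable m m'" "\<alpha> \<in> linkages m"
  obtains W \<Phi> where "open W" "\<alpha> \<in> W" "smooth_on W \<Phi>"
    "\<And>\<beta>. \<beta> \<in> antisymmetric_space E \<Longrightarrow> \<Phi> \<beta> \<in> antisymmetric_space E"
    "\<And>\<beta>. \<beta> \<in> W \<Longrightarrow> \<beta> \<in> linkages m \<Longrightarrow> \<Phi> \<beta> = transport m' \<beta>"
proof -
  have "\<exists>W \<omega>. open W \<and> \<alpha> \<in> W \<and> smooth_on W \<omega> \<and> (bent r \<longrightarrow> (\<forall>x\<in>W. norm (\<omega> x) < 1 \<and>
      closed_up (nbrs r) (m' r) (\<lambda>s. disc_moebius (\<omega> x) (dirn r s x))))" for r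
  proof (cases "bent r")
    case True
    have g: "good_pair (nbrs r) (m r) (m' r)" using True assms(1) by (simp add: transportable_def)
    obtain W \<omega> where "open W" "\<alpha> \<in> W" "smooth_on W \<omega>"
      "\<And>x. x \<in> W \<Longrightarrow> norm (\<omega> x) < 1 \<and> closed_up (nbrs r) (m' r) (\<lambda>s. disc_moebius (\<omega> x) (dirn r s x))"
      by (rule moebius_balanced_smooth[OF _ _ _ smooth_on_dirn norm_dirn balancing[OF assms True]])
        (use g in \<open>auto simp: good_pair_def\<close>)
    then show ?thesis by blast
  next
    case False
    then show ?thesis
      using smooth_on_const[of UNIV "0::complex"] by (intro exI[of _ UNIV] exI[of _ "\<lambda>_. 0"]) simp
  qed
  then have "\<forall>r. \<exists>W \<omega>. open W \<and> \<alpha> \<in> W \<and> smooth_on W \<omega> \<and> (bent r \<longrightarrow> (\<forall>x\<in>W. norm (\<omega> x) < 1 \<and>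
      closed_up (nbrs r) (m' r) (\<lambda>s. disc_moebius (\<omega> x) (dirn r s x))))" ..
  from choice[OF this] obtain W' where "\<forall>r. \<exists>\<omega>. open (W' r) \<and> \<alpha> \<in> W' r \<and> smooth_on (W' r) \<omega> \<and>
      (bent r \<longrightarrow> (\<forall>x\<in>W' r. norm (\<omega> x) < 1 \<and>
      closed_up (nbrs r) (m' r) (\<lambda>s. disc_moebius (\<omega> x) (dirn r s x))))" ..
  from choice[OF this] obtain \<omega> where \<omega>: "\<And>r. open (W' r)" "\<And>r. \<alpha> \<in> W' r" "\<And>r. smooth_on (W' r) (\<omega> r)"
    "\<And>r x. bent r \<Longrightarrow> x \<in> W' r \<Longrightarrow> norm (\<omega> r x) < 1"
    "\<And>r x. bent r \<Longrightarrow> x \<in> W' r \<Longrightarrow>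
      closed_up (nbrs r) (m' r) (\<lambda>s. disc_moebius (\<omega> r x) (dirn r s x))"
    by blast
  define W where "W = (\<Inter>r. W' r)"
  have W: "open W" "\<alpha> \<in> W" using \<omega>(1,2) by (auto simp: W_def)
  have sm\<omega>: "smooth_on W (\<omega> r)" for r
    by (rule smooth_on_subset[OF \<omega>(3)]) (auto simp: W_def)
  have smd: "smooth_on W (dirn r s)" for r s
    using smooth_on_subset[OF smooth_on_dirn] by blast
  have smt: "smooth_on W (\<lambda>x. turn (\<omega> r x) r s x)" for r s
  proof (cases "bent r \<and> s \<in> nbrs r")
    case True
    have sm: "smooth_on W (\<lambda>x. 1 + \<omega> r x * cnj (dirn r s x))"
      by (intro smooth_on_add smooth_on_mult W(1) smooth_on_const sm\<omega> smd
          smooth_on_bounded_linear[OF W(1) bounded_linear_cnj])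
    have im: "(\<lambda>x. 1 + \<omega> r x * cnj (dirn r s x)) ` W \<subseteq> {u. Re u > 0}"
      using Re_one_plus_pos[OF \<omega>(4) norm_dirn] True by (auto simp: W_def)
    have op: "open {u. Re u > 0}" by (intro open_Collect_less continuous_intros)
    have "smooth_on {u. Re u > 0} Ln"
      by (rule smooth_on_Ln[OF op]) (auto simp: complex_nonpos_Reals_iff)
    from smooth_on_compose[OF W(1) op im sm this]
    have "smooth_on W (\<lambda>x. 2 * Im (Ln (1 + \<omega> r x * cnj (dirn r s x))))"
      by (intro smooth_on_bounded_linear[OF W(1) bounded_linear_mult_right]
          smooth_on_bounded_linear[OF W(1) bounded_linear_Im])
    then show ?thesis using True by (simp add: turn_def)
  next
    case False
    then show ?thesis by (auto simp: turn_def smooth_on_const)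
  qed
  have nth: "bounded_linear (\<lambda>\<alpha>::real^'v^'v. \<alpha> $ r $ s)" for r s
    by (intro bounded_linear_compose[OF bounded_linear_vec_nth] bounded_linear_vec_nth)
  show thesis
  proof (rule that[OF W, of "\<lambda>x. turned (\<lambda>r. \<omega> r x) x"])
    show "smooth_on W (\<lambda>x. turned (\<lambda>r. \<omega> r x) x)"
      unfolding turned_def
      by (intro smooth_on_vec_lambda W(1) smooth_on_diff smooth_on_add smt smooth_on_linear nth)
    show "turned (\<lambda>r. \<omega> r \<beta>) \<beta> \<in> antisymmetric_space E" if "\<beta> \<in> antisymmetric_space E" for \<beta>
      using turned_antisymmetric[OF that] .
    show "turned (\<lambda>r. \<omega> r \<beta>) \<beta> = transport m' \<beta>" if b: "\<beta> \<in> W" "\<beta> \<in> linkages m" for \<beta>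
    proof -
      have "turn (\<omega> r \<beta>) r s \<beta> = turn (balancing m' r \<beta>) r s \<beta>" for r s
      proof (cases "bent r")
        case True
        then have "balancing m' r \<beta> = \<omega> r \<beta>"
          using \<omega>(4,5) b by (intro balancing_unique[OF assms(1)]) (auto simp: W_def)
        then show ?thesis by simp
      qed (simp add: turn_def)
      then show ?thesis by (simp add: transport_def turned_def)
    qed
  qed
qed

end

section \<open>Gauge classes\<close>

context gauge_fixing
begin

section \<open>Descent of the transport to gauge classes\<close>

lemma torus_smooth_on_transport:
  assumes "transportable m m'"
    and F: "\<And>\<alpha>. \<alpha> \<in> antisymmetric_space E \<Longrightarrow> gauge_class E h \<alpha> \<in> F \<longleftrightarrow> \<alpha> \<in> linkages m"
    and f: "\<And>\<alpha>. \<alpha> \<in> linkages m \<Longrightarrow> f (gauge_class E h \<alpha>) = gauge_class E h' (transport m' \<alpha>)"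
  shows "torus_smooth_on E h h' F f"
  unfolding torus_smooth_on_def
proof (intro ballI impI)
  fix \<alpha> assume "\<alpha> \<in> antisymmetric_space E" "gauge_class E h \<alpha> \<in> F"
  then have \<alpha>: "\<alpha> \<in> linkages m" using F by blast
  obtain W \<Phi> where W: "open W" "\<alpha> \<in> W" "smooth_on W \<Phi>"
    "\<And>\<beta>. \<beta> \<in> antisymmetric_space E \<Longrightarrow> \<Phi> \<beta> \<in> antisymmetric_space E"
    "\<And>\<beta>. \<beta> \<in> W \<Longrightarrow> \<beta> \<in> linkages m \<Longrightarrow> \<Phi> \<beta> = transport m' \<beta>"
    by (rule transport_locally_smooth[OF assms(1) \<alpha>], rule that)
  then have "\<forall>\<beta>\<in>W \<inter> antisymmetric_space E. \<Phi> \<beta> \<in> antisymmetric_space E \<and>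
      (gauge_class E h \<beta> \<in> F \<longrightarrow> gauge_class E h' (\<Phi> \<beta>) = f (gauge_class E h \<beta>))"
    using F f by simp
  then show "\<exists>W \<Phi>. open W \<and> \<alpha> \<in> W \<and> smooth_on W \<Phi> \<and>
      (\<forall>\<beta>\<in>W \<inter> antisymmetric_space E. \<Phi> \<beta> \<in> antisymmetric_space E \<and>
        (gauge_class E h \<beta> \<in> F \<longrightarrow> gauge_class E h' (\<Phi> \<beta>) = f (gauge_class E h \<beta>)))"
    using W(1-3) by (intro exI[of _ W] exI[of _ \<Phi>] conjI)
qed

lemma linkages_antisymmetric: "\<alpha> \<in> linkages m \<Longrightarrow> \<alpha> \<in> antisymmetric_space E"
  by (simp add: linkages_def)

definition class_transport ::
    "real^'v^'v \<Rightarrow> real^'v^'v \<Rightarrow> ('v \<Rightarrow> 'v \<Rightarrow> real) \<Rightarrow> (complex^'v^'v) set \<Rightarrow> (complex^'v^'v) set" where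
  "class_transport h h' m C = gauge_class E h' (transport m
    (SOME \<alpha>. \<alpha> \<in> antisymmetric_space E \<and> gauge_class E h \<alpha> = C))"

text \<open>Nothing about \<open>h\<close> enters the gauge relation, so the transport maps descend to the tori.\<close>

lemma class_transport:
  assumes t: "transportable m m'"
    and gc: "\<And>\<alpha> \<beta>. \<alpha> \<in> antisymmetric_space E \<Longrightarrow> \<beta> \<in> antisymmetric_space E \<Longrightarrow>
        gauge_class E h \<alpha> = gauge_class E h \<beta> \<longleftrightarrow> gauge_eq E \<alpha> \<beta>"
      "\<And>\<alpha> \<beta>. \<alpha> \<in> antisymmetric_space E \<Longrightarrow> \<beta> \<in> antisymmetric_space E \<Longrightarrow>
        gauge_class E h' \<alpha> = gauge_class E h' \<beta> \<longleftrightarrow> gauge_eq E \<alpha> \<beta>"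
    and \<alpha>: "\<alpha> \<in> linkages m"
  shows "class_transport h h' m' (gauge_class E h \<alpha>) = gauge_class E h' (transport m' \<alpha>)"
proof -
  define \<beta> where "\<beta> = (SOME \<beta>. \<beta> \<in> antisymmetric_space E \<and> gauge_class E h \<beta> = gauge_class E h \<alpha>)"
  have A: "\<alpha> \<in> antisymmetric_space E" using \<alpha> by (rule linkages_antisymmetric)
  then have \<beta>: "\<beta> \<in> antisymmetric_space E" "gauge_class E h \<beta> = gauge_class E h \<alpha>"
    using someI[of "\<lambda>\<beta>. \<beta> \<in> antisymmetric_space E \<and> gauge_class E h \<beta> = gauge_class E h \<alpha>" \<alpha>]
    unfolding \<beta>_def by blast+
  then have eq: "gauge_eq E \<beta> \<alpha>" using gc(1) A by blast
  have L: "\<beta> \<in> linkages m" by (rule linkages_gauge[OF \<alpha> \<beta>(1) gauge_eq_sym[OF eq]])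
  show ?thesis
    unfolding class_transport_def \<beta>_def[symmetric]
    using gc(2)[OF linkages_antisymmetric linkages_antisymmetric, OF transport_in_linkages[OF t L]
        transport_in_linkages[OF t \<alpha>]] transport_gauge[OF t L \<alpha> eq] by blast
qed

lemma torus_diffeomorphic_linkages:
  assumes t: "transportable m m'" "transportable m' m"
    and gc: "\<And>\<alpha> \<beta>. \<alpha> \<in> antisymmetric_space E \<Longrightarrow> \<beta> \<in> antisymmetric_space E \<Longrightarrow>
        gauge_class E h \<alpha> = gauge_class E h \<beta> \<longleftrightarrow> gauge_eq E \<alpha> \<beta>"
      "\<And>\<alpha> \<beta>. \<alpha> \<in> antisymmetric_space E \<Longrightarrow> \<beta> \<in> antisymmetric_space E \<Longrightarrow>
        gauge_class E h' \<alpha> = gauge_class E h' \<beta> \<longleftrightarrow> gauge_eq E \<alpha> \<beta>"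
    and F: "F \<subseteq> magnetic_torus E h"
      "\<And>\<alpha>. \<alpha> \<in> antisymmetric_space E \<Longrightarrow> gauge_class E h \<alpha> \<in> F \<longleftrightarrow> \<alpha> \<in> linkages m"
    and F': "F' \<subseteq> magnetic_torus E h'"
      "\<And>\<alpha>. \<alpha> \<in> antisymmetric_space E \<Longrightarrow> gauge_class E h' \<alpha> \<in> F' \<longleftrightarrow> \<alpha> \<in> linkages m'"
  shows "torus_diffeomorphic E h F h' F'"
proof -
  define f where "f = class_transport h h' m'"
  define f' where "f' = class_transport h' h m"
  have f: "f (gauge_class E h \<alpha>) = gauge_class E h' (transport m' \<alpha>)" if "\<alpha> \<in> linkages m" for \<alpha>
    unfolding f_def by (rule class_transport[OF t(1) gc that])
  have f': "f' (gauge_class E h' \<alpha>) = gauge_class E h (transport m \<alpha>)" if "\<alpha> \<in> linkages m'" for \<alpha>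
    unfolding f'_def by (rule class_transport[OF t(2) gc(2,1) that])
  have rep: "\<exists>\<alpha>\<in>linkages m. C = gauge_class E h \<alpha>" if "C \<in> F" for C
    using that F by (auto simp: magnetic_torus_def)
  have rep': "\<exists>\<alpha>\<in>linkages m'. C = gauge_class E h' \<alpha>" if "C \<in> F'" for C
    using that F' by (auto simp: magnetic_torus_def)
  have inF': "gauge_class E h' \<alpha> \<in> F'" if "\<alpha> \<in> linkages m'" for \<alpha>
    using F'(2) linkages_antisymmetric that by blast
  have inF: "gauge_class E h \<alpha> \<in> F" if "\<alpha> \<in> linkages m" for \<alpha>
    using F(2) linkages_antisymmetric that by blast
  have bf: "f C \<in> F' \<and> f' (f C) = C" if "C \<in> F" for C
  proof -
    obtain \<alpha> where \<alpha>: "\<alpha> \<in> linkages m" "C = gauge_class E h \<alpha>" using rep[OF \<open>C \<in> F\<close>] by blast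
    have "transport m' \<alpha> \<in> linkages m'" by (rule transport_in_linkages[OF t(1) \<alpha>(1)])
    then show ?thesis
      unfolding \<alpha>(2) f[OF \<alpha>(1)] by (simp add: f' inF' transport_transport[OF t \<alpha>(1)])
  qed
  have bf': "f' C \<in> F \<and> f (f' C) = C" if "C \<in> F'" for C
  proof -
    obtain \<alpha> where \<alpha>: "\<alpha> \<in> linkages m'" "C = gauge_class E h' \<alpha>" using rep'[OF \<open>C \<in> F'\<close>] by blast
    have "transport m \<alpha> \<in> linkages m" by (rule transport_in_linkages[OF t(2) \<alpha>(1)])
    then show ?thesis
      unfolding \<alpha>(2) f'[OF \<alpha>(1)] by (simp add: f inF transport_transport[OF t(2,1) \<alpha>(1)])
  qed
  have bij: "bij_betw f F F'"
    by (rule bij_betw_byWitness[of F f' f F']) (use bf bf' in auto)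
  have inv: "inv_into F f C = f' C" if "C \<in> F'" for C
    using bf'[OF that] bij by (intro inv_into_f_eq) (auto simp: bij_betw_def)
  have "inv_into F f (gauge_class E h' \<alpha>) = gauge_class E h (transport m \<alpha>)"
    if "\<alpha> \<in> linkages m'" for \<alpha>
    using inv[OF inF'[OF that]] f'[OF that] by simp
  then have "torus_smooth_on E h' h F' (inv_into F f)"
    using torus_smooth_on_transport[OF t(2)] F'(2) by blast
  moreover have "torus_smooth_on E h h' F f"
    using torus_smooth_on_transport[OF t(1)] F(2) f by blast
  ultimately show ?thesis
    unfolding torus_diffeomorphic_def using bij F(1) F'(1) by blast
qed

end

text \<open>A fixed path inside \<open>N\<close> makes the accumulated phase linear in the matrix,
  and a gauge term telescopes to its values at the two ends.\<close>

lemma path_functionals_exist: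
  fixes E :: "('v::finite \<times> 'v) set" and root :: 'v
  assumes "induces_connected E N" "root \<in> N"
  shows "\<exists>p :: 'v \<Rightarrow> real^'v^'v \<Rightarrow> real. (\<forall>s. linear (p s)) \<and>
    (\<forall>\<gamma> \<eta>. (\<forall>r\<in>N. \<forall>t\<in>N. (r, t) \<in> E \<longrightarrow> cis (\<gamma> $ r $ t) = cis (\<eta> r - \<eta> t)) \<longrightarrow>
      (\<forall>s\<in>N. cis (p s \<gamma>) = cis (\<eta> s - \<eta> root))) \<and>
    (\<forall>\<gamma> s. (\<forall>r\<in>N. \<forall>t\<in>N. \<gamma> $ r $ t = 0) \<longrightarrow> p s \<gamma> = 0)"
proof -
  define P where "P s q \<longleftrightarrow> linear q \<and>
      (\<forall>\<gamma> \<eta>. (\<forall>r\<in>N. \<forall>t\<in>N. (r, t) \<in> E \<longrightarrow> cis (\<gamma> $ r $ t) = cis (\<eta> r - \<eta> t)) \<longrightarrow>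
        cis (q \<gamma>) = cis (\<eta> s - \<eta> root)) \<and>
      (\<forall>\<gamma>. (\<forall>r\<in>N. \<forall>t\<in>N. \<gamma> $ r $ t = 0) \<longrightarrow> q \<gamma> = 0)" for s and q :: "real^'v^'v \<Rightarrow> real"
  have "\<exists>q. P s q" if "(root, s) \<in> (Restr E N)\<^sup>*" for s
    using that
  proof (induction rule: rtrancl_induct)
    case base
    show ?case by (intro exI[of _ "\<lambda>_. 0"]) (auto simp: P_def intro: linearI)
  next
    case (step s' s)
    then obtain q where q: "linear q"
      "\<And>\<gamma> \<eta>. (\<forall>r\<in>N. \<forall>t\<in>N. (r, t) \<in> E \<longrightarrow> cis (\<gamma> $ r $ t) = cis (\<eta> r - \<eta> t)) \<Longrightarrow>
        cis (q \<gamma>) = cis (\<eta> s' - \<eta> root)"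
      "\<And>\<gamma>. (\<forall>r\<in>N. \<forall>t\<in>N. \<gamma> $ r $ t = 0) \<Longrightarrow> q \<gamma> = 0"
      unfolding P_def by blast
    have e: "s' \<in> N" "s \<in> N" "(s', s) \<in> E" using step(2) by auto
    \<comment> \<open>The sum runs from \<open>s\<close> to \<open>root\<close>, so the edge from
      \<open>s'\<close> to \<open>s\<close> is traversed backwards and enters with a minus
      sign.\<close>
    have "linear (\<lambda>\<gamma>. q \<gamma> - \<gamma> $ s' $ s)"
      by (intro linearI) (simp_all add: linear_add[OF q(1)] linear_cmul[OF q(1)] algebra_simps)
    moreover have "cis (q \<gamma> - \<gamma> $ s' $ s) = cis (\<eta> s - \<eta> root)"
      if *: "\<forall>r\<in>N. \<forall>t\<in>N. (r, t) \<in> E \<longrightarrow> cis (\<gamma> $ r $ t) = cis (\<eta> r - \<eta> t)" for \<gamma> and \<eta> :: "'v \<Rightarrow> real"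
    proof -
      have "cis (\<gamma> $ s' $ s) = cis (\<eta> s' - \<eta> s)" using * e by blast
      then show ?thesis by (simp add: cis_divide[symmetric] q(2)[OF *])
    qed
    moreover have "q \<gamma> - \<gamma> $ s' $ s = 0" if "\<forall>r\<in>N. \<forall>t\<in>N. \<gamma> $ r $ t = 0" for \<gamma>
      using q(3)[OF that] that e by simp
    ultimately show ?case unfolding P_def by blast
  qed
  then have ex: "\<exists>q. P s q" if "s \<in> N" for s
    using assms that unfolding induces_connected_def by blast
  define p where "p s = (if s \<in> N then SOME q. P s q else (\<lambda>_. 0))" for s
  have p: "P s (p s)" if "s \<in> N" for s
    using someI_ex[OF ex[OF that]] that by (simp add: p_def)
  have p0: "p s = (\<lambda>_. 0)" if "s \<notin> N" for s
    using that by (simp add: p_def)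
  show ?thesis
  proof (intro exI[of _ p] conjI allI impI ballI)
    show "linear (p s)" for s
      using p[of s] p0[of s] by (cases "s \<in> N") (auto simp: P_def intro: linearI)
    show "p s \<gamma> = 0" if "\<forall>r\<in>N. \<forall>t\<in>N. \<gamma> $ r $ t = 0" for \<gamma> s
      using p[of s] p0[of s] that by (cases "s \<in> N") (auto simp: P_def)
  qed (use p in \<open>unfold P_def, blast\<close>)
qed

section \<open>The gauge relation in matrix entries\<close>

lemma magnetic_nth: "magnetic h \<alpha> $ r $ s = cis (\<alpha> $ r $ s) * of_real (h $ r $ s)"
  by (simp add: magnetic_def cis_conv_exp)

lemma gauge_conj_nth:
  "(gauge_matrix \<theta> ** M ** gauge_matrix (- \<theta>)) $ r $ s = cis (\<theta> $ r - \<theta> $ s) * M $ r $ s"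
proof -
  have "(gauge_matrix \<theta> ** M) $ r $ t = cis (\<theta> $ r) * M $ r $ t" for t
    by (simp add: matrix_matrix_mult_def gauge_matrix_def cis_conv_exp if_distribR if_distrib cong: if_cong)
  moreover have g: "gauge_matrix (- \<theta>) $ t $ s = (if t = s then cis (- \<theta> $ t) else 0)" for t
    by (simp add: gauge_matrix_def cis_conv_exp)
  ultimately have "(gauge_matrix \<theta> ** M ** gauge_matrix (- \<theta>)) $ r $ s =
      (\<Sum>t\<in>UNIV. cis (\<theta> $ r) * M $ r $ t * (if t = s then cis (- \<theta> $ t) else 0))"
    by (simp add: matrix_matrix_mult_def[of "gauge_matrix \<theta> ** M"] g)
  also have "\<dots> = cis (\<theta> $ r) * M $ r $ s * cis (- \<theta> $ s)"
    by (simp add: if_distrib cong: if_cong)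
  also have "\<dots> = cis (\<theta> $ r) * cis (- \<theta> $ s) * M $ r $ s" by (simp only: mult_ac)
  finally show ?thesis by (simp add: cis_mult)
qed

lemma gauge_rel_iff:
  "(M, M') \<in> gauge_rel E \<longleftrightarrow> M \<in> hermitian_space E \<and> M' \<in> hermitian_space E \<and>
    (\<exists>\<theta>::'v::finite \<Rightarrow> real. \<forall>r s. M' $ r $ s = cis (\<theta> r - \<theta> s) * M $ r $ s)"
proof -
  have "(\<exists>\<theta>. M' = gauge_matrix \<theta> ** M ** gauge_matrix (- \<theta>)) \<longleftrightarrow>
      (\<exists>\<theta>::'v \<Rightarrow> real. \<forall>r s. M' $ r $ s = cis (\<theta> r - \<theta> s) * M $ r $ s)"
    (is "?L \<longleftrightarrow> ?R")
  proof
    assume ?L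
    then obtain \<theta> where "M' = gauge_matrix \<theta> ** M ** gauge_matrix (- \<theta>)" ..
    then show ?R by (intro exI[of _ "\<lambda>r. \<theta> $ r"]) (simp add: gauge_conj_nth)
  next
    assume ?R
    then obtain \<theta> :: "'v \<Rightarrow> real" where "\<forall>r s. M' $ r $ s = cis (\<theta> r - \<theta> s) * M $ r $ s" ..
    then show ?L by (intro exI[of _ "\<chi> r. \<theta> r"]) (simp add: vec_eq_iff gauge_conj_nth)
  qed
  then show ?thesis by (simp add: gauge_rel_def)
qed

lemma equiv_gauge_rel: "equiv (hermitian_space E) (gauge_rel E)"
proof (rule equivI)
  show "gauge_rel E \<subseteq> hermitian_space E \<times> hermitian_space E"
    by (auto simp: gauge_rel_iff)
  show "refl_on (hermitian_space E) (gauge_rel E)"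
    by (auto simp: refl_on_def gauge_rel_iff intro: exI[of _ "\<lambda>_. 0"])
  show "sym (gauge_rel E)"
  proof (rule symI)
    fix M M' assume "(M, M') \<in> gauge_rel E"
    then show "(M', M) \<in> gauge_rel E"
      unfolding gauge_rel_iff
    proof (elim conjE exE, intro conjI)
      fix \<theta> :: "'a \<Rightarrow> real" assume *: "\<forall>r s. M' $ r $ s = cis (\<theta> r - \<theta> s) * M $ r $ s"
      have "M $ r $ s = cis (- \<theta> r - - \<theta> s) * M' $ r $ s" for r s
      proof -
        have "M' $ r $ s = cis (\<theta> r - \<theta> s) * M $ r $ s" using * by blast
        then have "cis (- \<theta> r - - \<theta> s) * M' $ r $ s = (cis (- \<theta> r - - \<theta> s) * cis (\<theta> r - \<theta> s)) * M $ r $ s"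
          by (simp only: mult.assoc)
        then show ?thesis by (simp add: cis_mult)
      qed
      then show "\<exists>\<theta>. \<forall>r s. M $ r $ s = cis (\<theta> r - \<theta> s) * M' $ r $ s"
        by (intro exI[of _ "\<lambda>r. - \<theta> r"]) blast
    qed
  qed
  show "trans (gauge_rel E)"
  proof (rule transI)
    fix L M M' assume "(L, M) \<in> gauge_rel E" "(M, M') \<in> gauge_rel E"
    then show "(L, M') \<in> gauge_rel E"
      unfolding gauge_rel_iff
    proof (elim conjE exE, intro conjI)
      fix \<theta> \<eta> :: "'a \<Rightarrow> real"
      assume *: "\<forall>r s. M $ r $ s = cis (\<theta> r - \<theta> s) * L $ r $ s"
        "\<forall>r s. M' $ r $ s = cis (\<eta> r - \<eta> s) * M $ r $ s"
      have "M' $ r $ s = cis ((\<eta> r + \<theta> r) - (\<eta> s + \<theta> s)) * L $ r $ s" for r s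
      proof -
        have "M $ r $ s = cis (\<theta> r - \<theta> s) * L $ r $ s" "M' $ r $ s = cis (\<eta> r - \<eta> s) * M $ r $ s"
          using * by blast+
        then have "M' $ r $ s = (cis (\<eta> r - \<eta> s) * cis (\<theta> r - \<theta> s)) * L $ r $ s"
          by (simp only: mult.assoc)
        then show ?thesis by (simp add: cis_mult add_diff_add)
      qed
      then show "\<exists>\<theta>. \<forall>r s. M' $ r $ s = cis (\<theta> r - \<theta> s) * L $ r $ s"
        by (intro exI[of _ "\<lambda>r. \<eta> r + \<theta> r"]) blast
    qed
  qed
qed

lemma magnetic_hermitian:
  assumes "h \<in> symmetric_space E" "\<alpha> \<in> antisymmetric_space E"
  shows "magnetic h \<alpha> \<in> hermitian_space E"
proof -
  have "h $ s $ r = h $ r $ s" for r s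
    using assms(1) by (auto simp: symmetric_space_def transpose_def vec_eq_iff)
  moreover have "\<alpha> $ s $ r = - \<alpha> $ r $ s" for r s
    using assms(2) unfolding antisymmetric_space_iff by blast
  ultimately have "magnetic h \<alpha> $ s $ r = cnj (magnetic h \<alpha> $ r $ s)" for r s
    unfolding magnetic_nth by (metis cis_cnj complex_cnj_complex_of_real complex_cnj_mult)
  moreover have "supported E (magnetic h \<alpha>)"
    using assms(1) by (auto simp: supported_def symmetric_space_def magnetic_nth)
  ultimately show ?thesis unfolding hermitian_space_def by blast
qed

text \<open>On edges the nonzero entry of \<open>h\<close> cancels from the entrywise equation, off
  the edges both sides vanish, and antisymmetric matrices are zero on the diagonal.\<close>

lemma gauge_class_eq_iff:
  assumes "h \<in> symmetric_space E" "strictly_supported E h"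
    and "\<alpha> \<in> antisymmetric_space E" "\<beta> \<in> antisymmetric_space E"
  shows "gauge_class E h \<alpha> = gauge_class E h \<beta> \<longleftrightarrow> gauge_eq E \<alpha> \<beta>"
proof -
  have diag: "\<gamma> $ r $ r = 0" if "\<gamma> \<in> antisymmetric_space E" for \<gamma> r
  proof -
    have "\<gamma> $ r $ r = - \<gamma> $ r $ r" using that unfolding antisymmetric_space_iff by blast
    then show ?thesis by simp
  qed
  have "gauge_class E h \<alpha> = gauge_class E h \<beta> \<longleftrightarrow> (magnetic h \<beta>, magnetic h \<alpha>) \<in> gauge_rel E"
    unfolding gauge_class_def
    using eq_equiv_class_iff[OF equiv_gauge_rel magnetic_hermitian[OF assms(1,4)]
        magnetic_hermitian[OF assms(1,3)]] by auto
  also have "\<dots> \<longleftrightarrow> (\<exists>\<theta>. \<forall>r s. cis (\<alpha> $ r $ s) * of_real (h $ r $ s) =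
      cis (\<theta> r - \<theta> s) * (cis (\<beta> $ r $ s) * of_real (h $ r $ s)))"
    using magnetic_hermitian[OF assms(1,3)] magnetic_hermitian[OF assms(1,4)]
    by (simp add: gauge_rel_iff magnetic_nth)
  also have "\<dots> \<longleftrightarrow> gauge_eq E \<alpha> \<beta>"
    unfolding gauge_eq_def
  proof (intro ex_cong1 all_cong1)
    fix \<theta> r s
    show "cis (\<alpha> $ r $ s) * of_real (h $ r $ s) = cis (\<theta> r - \<theta> s) * (cis (\<beta> $ r $ s) * of_real (h $ r $ s))
      \<longleftrightarrow> ((r, s) \<in> E \<longrightarrow> cis (\<alpha> $ r $ s) = cis (\<theta> r - \<theta> s) * cis (\<beta> $ r $ s))"
    proof (cases "r = s")
      case True
      then show ?thesis using diag assms by simp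
    next
      case False
      then have "h $ r $ s \<noteq> 0 \<longleftrightarrow> (r, s) \<in> E" using assms(2) by (auto simp: strictly_supported_def)
      moreover have "cis (\<theta> r - \<theta> s) * (cis (\<beta> $ r $ s) * of_real (h $ r $ s)) =
          (cis (\<theta> r - \<theta> s) * cis (\<beta> $ r $ s)) * of_real (h $ r $ s)" by (simp only: mult.assoc)
      ultimately show ?thesis by (simp only: mult_cancel_right of_real_eq_0_iff) blast
    qed
  qed
  finally show ?thesis .
qed

section \<open>Perturbation of critical data\<close>

lemma graph_components_connected:
  assumes "induces_connected E U"
  shows "graph_components E U = {U}"
proof -
  have "(Restr E U)\<^sup>* `` {r} = U" if r: "r \<in> U" for r
  proof (intro equalityI subsetI)
    fix s assume "s \<in> (Restr E U)\<^sup>* `` {r}"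
    then have "(r, s) \<in> (Restr E U)\<^sup>*" by blast
    then show "s \<in> U" by (induction rule: rtrancl_induct) (use r in auto)
  qed (use assms r in \<open>auto simp: induces_connected_def\<close>)
  then show ?thesis using assms by (auto simp: graph_components_def induces_connected_def)
qed

lemma induces_connected_insert:
  assumes "induces_connected E U" "sym E" "s \<in> U" "(r, s) \<in> E"
  shows "induces_connected E (insert r U)"
proof -
  let ?R = "(Restr E (insert r U))\<^sup>*"
  have "(s, r) \<in> E" using assms(2,4) by (auto dest: symD)
  then have 1: "(r, s) \<in> ?R" "(s, r) \<in> ?R" using assms(3,4) by auto
  have 2: "(a, b) \<in> ?R" if "a \<in> U" "b \<in> U" for a b
  proof -
    have "(a, b) \<in> (Restr E U)\<^sup>*" using assms(1) that by (auto simp: induces_connected_def)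
    moreover have "(Restr E U)\<^sup>* \<subseteq> ?R" by (intro rtrancl_mono) auto
    ultimately show ?thesis by blast
  qed
  have "(a, s) \<in> ?R \<and> (s, a) \<in> ?R" if "a \<in> insert r U" for a
    using that 1 2 assms(3) by auto
  then have "(a, b) \<in> ?R" if "a \<in> insert r U" "b \<in> insert r U" for a b
    using that rtrancl_trans by metis
  then show ?thesis by (simp add: induces_connected_def)
qed

section \<open>Real eigenvectors and perturbation of simple eigenpairs\<close>

lemma eigenspace_proportional:
  assumes "vec.dim (eigenspace_on U A \<mu>) = 1" "x \<in> eigenspace_on U A \<mu>" "y \<in> eigenspace_on U A \<mu>" "y \<noteq> 0"
  obtains k where "x = k *s y"
proof -
  have "eigenspace_on U A \<mu> \<subseteq> vec.span {y}"
  proof (rule vec.card_ge_dim_independent)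
    show "vec.independent {y}" using assms(4) vec.dependent_single by blast
  qed (use assms in auto)
  then have "x \<in> vec.span {y}" using assms(2) by blast
  then show thesis using that by (auto simp: vec.span_singleton)
qed

lemma eigenspace_on_iff:
  "\<psi> \<in> eigenspace_on U A \<mu> \<longleftrightarrow> (\<forall>r. r \<notin> U \<longrightarrow> \<psi> $ r = 0) \<and>
    (\<forall>r. (\<Sum>s\<in>UNIV. of_real (A $ r $ s) * \<psi> $ s) = of_real \<mu> * \<psi> $ r)"
  by (simp add: eigenspace_on_def vec_eq_iff matrix_vector_mult_def map_matrix_def)

text \<open>Normalised to 1 at \<open>s0\<close>, the eigenvector is proportional to its conjugate
  with factor 1, hence real. This gives signed real lengths and a real system to perturb.\<close>

lemma real_eigenvector:
  fixes \<psi> :: "complex^'v::finite"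
  assumes dim: "vec.dim (eigenspace_on U A \<mu>) = 1" and \<psi>: "\<psi> \<in> eigenspace_on U A \<mu>" and s0: "\<psi> $ s0 \<noteq> 0"
  obtains c u where "c \<noteq> 0" "\<And>s. \<psi> $ s = c * of_real (u $ s)"
    "A *v u = \<mu> *\<^sub>R u"
    "\<And>v. (\<And>r. r \<notin> U \<Longrightarrow> v $ r = 0) \<Longrightarrow> A *v v = \<mu> *\<^sub>R v \<Longrightarrow> \<exists>k. v = k *\<^sub>R u"
proof -
  define c where "c = \<psi> $ s0"
  define x where "x = (\<chi> s. \<psi> $ s / c)"
  define y where "y = (\<chi> s. cnj (x $ s))"
  have c: "c \<noteq> 0" using s0 by (simp add: c_def)
  have x: "x \<in> eigenspace_on U A \<mu>"
    using \<psi> unfolding eigenspace_on_iff by (simp add: x_def sum_divide_distrib[symmetric])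
  have y: "y \<in> eigenspace_on U A \<mu>"
    unfolding eigenspace_on_iff
  proof (intro conjI allI impI)
    show "y $ r = 0" if "r \<notin> U" for r using x that by (simp add: eigenspace_on_iff y_def)
    show "(\<Sum>s\<in>UNIV. of_real (A $ r $ s) * y $ s) = of_real \<mu> * y $ r" for r
    proof -
      have "(\<Sum>s\<in>UNIV. of_real (A $ r $ s) * x $ s) = of_real \<mu> * x $ r"
        using x by (simp add: eigenspace_on_iff)
      from arg_cong[OF this, of cnj] show ?thesis by (simp add: y_def)
    qed
  qed
  have xs0: "x $ s0 = 1" using c by (simp add: x_def c_def)
  then have "x \<noteq> 0" by auto
  from eigenspace_proportional[OF dim y x this] obtain k where k: "y = k *s x" .
  have "y $ s0 = k * x $ s0" unfolding k by simp
  then have "k = 1" using xs0 by (simp add: y_def)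
  then have yx: "cnj (x $ s) = x $ s" for s using k by (simp add: vec_eq_iff y_def)
  define u where "u = (\<chi> s. Re (x $ s))"
  have xu: "x $ s = of_real (u $ s)" for s
    using yx[of s] by (simp add: u_def complex_eq_iff)
  have u1: "\<psi> $ s = c * of_real (u $ s)" for s
    using c by (simp add: xu[symmetric] x_def)
  moreover have "A *v u = \<mu> *\<^sub>R u"
  proof -
    have "(\<Sum>s\<in>UNIV. A $ r $ s * u $ s) = \<mu> * u $ r" for r
    proof -
      have "(\<Sum>s\<in>UNIV. of_real (A $ r $ s) * x $ s) = of_real \<mu> * x $ r"
        using x by (simp add: eigenspace_on_iff)
      then have "complex_of_real (\<Sum>s\<in>UNIV. A $ r $ s * u $ s) = of_real (\<mu> * u $ r)"
        by (simp add: xu)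
      then show ?thesis by (simp only: of_real_eq_iff)
    qed
    then show ?thesis by (simp add: vec_eq_iff matrix_vector_mult_def)
  qed
  moreover have "\<exists>k. v = k *\<^sub>R u" if v: "\<And>r. r \<notin> U \<Longrightarrow> v $ r = 0" "A *v v = \<mu> *\<^sub>R v" for v
  proof -
    define z where "z = (\<chi> s. complex_of_real (v $ s))"
    have "z \<in> eigenspace_on U A \<mu>"
      unfolding eigenspace_on_iff
    proof (intro conjI allI impI)
      show "z $ r = 0" if "r \<notin> U" for r using v(1)[OF that] by (simp add: z_def)
      show "(\<Sum>s\<in>UNIV. of_real (A $ r $ s) * z $ s) = of_real \<mu> * z $ r" for r
      proof -
        have "(\<Sum>s\<in>UNIV. A $ r $ s * v $ s) = \<mu> * v $ r"
          using v(2) by (simp add: vec_eq_iff matrix_vector_mult_def)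
        from arg_cong[OF this, of complex_of_real] show ?thesis by (simp add: z_def)
      qed
    qed
    from eigenspace_proportional[OF dim this x \<open>x \<noteq> 0\<close>] obtain k where k: "z = k *s x" .
    have "v $ s = Re k * u $ s" for s
    proof -
      have "complex_of_real (v $ s) = k * of_real (u $ s)"
        using k by (simp add: vec_eq_iff z_def xu)
      from arg_cong[OF this, of Re] show ?thesis by simp
    qed
    then show ?thesis by (intro exI[of _ "Re k"]) (simp add: vec_eq_iff)
  qed
  ultimately show thesis using that[of c u] c by blast
qed

text \<open>Implicit functions applied to the eigenvalue equation, with the normalisation
  \<open>(u - u0) \<bullet> u0 = 0\<close> removing the freedom of scaling. As \<open>A\<close>
  varies over all matrices, the conclusion is confined to those supported on
  \<open>N\<close>.\<close>

lemma eigenpair_perturb: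
  fixes A0 :: "real^'v::finite^'v" and u0 :: "real^'v"
  assumes sym: "transpose A0 = A0" and zero: "\<And>r s. r \<notin> N \<or> s \<notin> N \<Longrightarrow> A0 $ r $ s = 0"
    and u0: "\<And>r. r \<notin> N \<Longrightarrow> u0 $ r = 0" "u0 \<noteq> 0" "A0 *v u0 = \<mu>0 *\<^sub>R u0"
    and simple: "\<And>v. (\<And>r. r \<notin> N \<Longrightarrow> v $ r = 0) \<Longrightarrow> A0 *v v = \<mu>0 *\<^sub>R v \<Longrightarrow> \<exists>k. v = k *\<^sub>R u0"
  obtains u \<mu> where "(u \<longlongrightarrow> u0) (nhds A0)" "(\<mu> \<longlongrightarrow> \<mu>0) (nhds A0)"
    "\<forall>\<^sub>F A in nhds A0. (\<forall>r s. r \<notin> N \<or> s \<notin> N \<longrightarrow> A $ r $ s = 0) \<longrightarrow>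
      A *v u A = \<mu> A *\<^sub>R u A \<and> (\<forall>r. r \<notin> N \<longrightarrow> u A $ r = 0)"
proof -
  \<comment> \<open>Rows outside \<open>N\<close> are replaced by the vanishing of that coordinate:
    this removes the kernel vectors created by the zero extension and keeps the system
    square.\<close>
  define G :: "(real^'v^'v) \<times> ((real^'v) \<times> real) \<Rightarrow> (real^'v) \<times> real" where
    "G p = (\<chi> r. if r \<in> N then (\<Sum>s\<in>UNIV. fst p $ r $ s * fst (snd p) $ s) - snd (snd p) * fst (snd p) $ r
      else fst (snd p) $ r, (fst (snd p) - u0) \<bullet> u0)" for p
  have bl: "bounded_linear (\<lambda>p::(real^'v^'v) \<times> ((real^'v) \<times> real). fst p $ r $ s)"
    "bounded_linear (\<lambda>p::(real^'v^'v) \<times> ((real^'v) \<times> real). fst (snd p))"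
    "bounded_linear (\<lambda>p::(real^'v^'v) \<times> ((real^'v) \<times> real). fst (snd p) $ s)"
    "bounded_linear (\<lambda>p::(real^'v^'v) \<times> ((real^'v) \<times> real). snd (snd p))" for r s
    by (intro bounded_linear_compose[OF bounded_linear_vec_nth] bounded_linear_vec_nth
        bounded_linear_compose[OF bounded_linear_fst] bounded_linear_compose[OF bounded_linear_snd]
        bounded_linear_fst bounded_linear_snd)+
  note sl = bl[THEN smooth_on_linear[OF open_UNIV]]
  have "smooth_on UNIV (\<lambda>p::(real^'v^'v) \<times> ((real^'v) \<times> real). if r \<in> N then
      (\<Sum>s\<in>UNIV. fst p $ r $ s * fst (snd p) $ s) - snd (snd p) * fst (snd p) $ r
      else fst (snd p) $ r)" for r
    by (cases "r \<in> N") (auto intro!: smooth_on_diff smooth_on_sum smooth_on_mult sl)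
  then have smG: "smooth_on UNIV G"
    unfolding G_def
    by (intro smooth_on_Pair smooth_on_vec_lambda smooth_on_inner smooth_on_diff smooth_on_const
        open_UNIV sl)
  define y0 where "y0 = (u0, \<mu>0)"
  have "(\<Sum>s\<in>UNIV. A0 $ r $ s * u0 $ s) = \<mu>0 * u0 $ r" for r
    using u0(3) by (simp add: vec_eq_iff matrix_vector_mult_def)
  then have G0: "G (A0, y0) = 0"
    using u0(1) by (simp add: G_def y0_def vec_eq_iff zero_prod_def)
  define D where "D v = frechet_derivative G (at (A0, y0)) (0, v)" for v
  have D: "((\<lambda>y. G (A0, y)) has_derivative D) (at y0)"
  proof -
    have "((\<lambda>y. (A0, y)) has_derivative (\<lambda>v. (0, v))) (at y0)"
      by (intro derivative_intros)
    from has_derivative_compose[OF this smooth_on_has_derivative[OF smG UNIV_I]]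
    show ?thesis unfolding D_def .
  qed
  have Dr: "fst (D v) $ r = (if r \<in> N then (\<Sum>s\<in>UNIV. A0 $ r $ s * fst v $ s) -
      (\<mu>0 * fst v $ r + snd v * u0 $ r) else fst v $ r)" for v r
  proof -
    have 1: "((\<lambda>y. fst (G (A0, y)) $ r) has_derivative (\<lambda>v. fst (D v) $ r)) (at y0)"
      by (intro bounded_linear.has_derivative[OF bounded_linear_vec_nth] has_derivative_fst D)
    have nth: "((\<lambda>y::(real^'v) \<times> real. fst y $ s) has_derivative (\<lambda>v. fst v $ s)) (at y0)" for s
      by (intro bounded_linear_imp_has_derivative bounded_linear_compose[OF bounded_linear_vec_nth]
          bounded_linear_fst)
    have snd': "((\<lambda>y::(real^'v) \<times> real. snd y) has_derivative (\<lambda>v. snd v)) (at y0)"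
      by (intro bounded_linear_imp_has_derivative bounded_linear_snd)
    have 2: "((\<lambda>y. fst (G (A0, y)) $ r) has_derivative (\<lambda>v. if r \<in> N then
      (\<Sum>s\<in>UNIV. A0 $ r $ s * fst v $ s) - (snd y0 * fst v $ r + snd v * fst y0 $ r) else fst v $ r)) (at y0)"
      by (cases "r \<in> N") (auto simp: G_def intro!: has_derivative_diff has_derivative_sum
          has_derivative_mult_right has_derivative_mult nth snd')
    show ?thesis using fun_cong[OF has_derivative_unique[OF 1 2], of v] by (simp add: y0_def)
  qed
  have Ds: "snd (D v) = fst v \<bullet> u0" for v
  proof -
    have 1: "((\<lambda>y. snd (G (A0, y))) has_derivative (\<lambda>v. snd (D v))) (at y0)"
      by (intro has_derivative_snd D)
    have "((\<lambda>y::(real^'v) \<times> real. (fst y - u0) \<bullet> u0) has_derivative (\<lambda>v. (fst v - 0) \<bullet> u0)) (at y0)"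
      by (intro has_derivative_inner_left has_derivative_diff has_derivative_const
          bounded_linear_imp_has_derivative[OF bounded_linear_fst])
    then have 2: "((\<lambda>y. snd (G (A0, y))) has_derivative (\<lambda>v. fst v \<bullet> u0)) (at y0)"
      by (simp add: G_def)
    show ?thesis using fun_cong[OF has_derivative_unique[OF 1 2], of v] .
  qed
  \<comment> \<open>Pairing the linearised equation with \<open>u0\<close> and using symmetry of
    \<open>A0\<close> gives \<open>\<nu> = 0\<close>; then \<open>v\<close> is a multiple of
    \<open>u0\<close> by simplicity, and zero by orthogonality.\<close>
  have inj: "w = 0" if "D w = 0" for w
  proof -
    define v \<nu> where "v = fst w" and "\<nu> = snd w"
    have v0: "v $ r = 0" if "r \<notin> N" for r
      using Dr[of w r] \<open>D w = 0\<close> that by (simp add: v_def)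
    have eq: "A0 *v v = \<mu>0 *\<^sub>R v + \<nu> *\<^sub>R u0"
    proof (subst vec_eq_iff, rule allI)
      fix r
      show "(A0 *v v) $ r = (\<mu>0 *\<^sub>R v + \<nu> *\<^sub>R u0) $ r"
      proof (cases "r \<in> N")
        case True
        then show ?thesis using Dr[of w r] \<open>D w = 0\<close>
          by (simp add: v_def \<nu>_def matrix_vector_mult_def)
      next
        case False
        then show ?thesis using v0 u0(1) zero by (simp add: matrix_vector_mult_def)
      qed
    qed
    have orth: "v \<bullet> u0 = 0" using Ds[of w] \<open>D w = 0\<close> by (simp add: v_def)
    have "(A0 *v v) \<bullet> u0 = v \<bullet> (A0 *v u0)"
      using dot_lmul_matrix[of v A0 u0] sym by (simp add: vector_transpose_matrix[symmetric] del: vector_transpose_matrix)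
    then have "\<nu> * (u0 \<bullet> u0) = 0"
      unfolding eq u0(3) by (simp add: inner_add_left orth)
    then have \<nu>: "\<nu> = 0" using u0(2) by simp
    then have "A0 *v v = \<mu>0 *\<^sub>R v" using eq by simp
    from simple[OF v0 this] obtain k where "v = k *\<^sub>R u0" by blast
    then have "v = 0" using orth u0(2) by auto
    then show ?thesis using \<nu> by (simp add: v_def \<nu>_def prod_eq_iff)
  qed
  obtain W \<omega> where W: "open W" "A0 \<in> W" "smooth_on W \<omega>" "\<omega> A0 = y0"
    "\<And>A. A \<in> W \<Longrightarrow> (A, \<omega> A) \<in> UNIV \<and> G (A, \<omega> A) = 0"
    by (rule smooth_implicit_function[OF open_UNIV smG UNIV_I G0 D inj], assumption, rule that)
  have "isCont \<omega> A0"
    using smooth_on_continuous[OF W(3)] W(1,2) continuous_on_eq_continuous_at by blast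
  then have lim: "(\<omega> \<longlongrightarrow> y0) (nhds A0)"
    using W(4) by (simp add: isCont_def tendsto_nhds_iff)
  show thesis
  proof (rule that)
    show "((\<lambda>A. fst (\<omega> A)) \<longlongrightarrow> u0) (nhds A0)"
      using tendsto_fst[OF lim] by (simp add: y0_def)
    show "((\<lambda>A. snd (\<omega> A)) \<longlongrightarrow> \<mu>0) (nhds A0)"
      using tendsto_snd[OF lim] by (simp add: y0_def)
    have "\<forall>\<^sub>F A in nhds A0. A \<in> W" using W(1,2) by (rule eventually_nhds_in_open)
    then show "\<forall>\<^sub>F A in nhds A0. (\<forall>r s. r \<notin> N \<or> s \<notin> N \<longrightarrow> A $ r $ s = 0) \<longrightarrow>
      A *v fst (\<omega> A) = snd (\<omega> A) *\<^sub>R fst (\<omega> A) \<and> (\<forall>r. r \<notin> N \<longrightarrow> fst (\<omega> A) $ r = 0)"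
    proof (eventually_elim, intro impI)
      fix A assume "A \<in> W" and z: "\<forall>r s. r \<notin> N \<or> s \<notin> N \<longrightarrow> A $ r $ s = 0"
      then have "G (A, \<omega> A) = 0" using W(5) by blast
      then have g: "(if r \<in> N then (\<Sum>s\<in>UNIV. A $ r $ s * fst (\<omega> A) $ s) - snd (\<omega> A) * fst (\<omega> A) $ r
        else fst (\<omega> A) $ r) = 0" for r
        by (simp add: G_def zero_prod_def vec_eq_iff cong: if_cong)
      have o: "fst (\<omega> A) $ r = 0" if "r \<notin> N" for r using g[of r] that by simp
      have "(A *v fst (\<omega> A)) $ r = (snd (\<omega> A) *\<^sub>R fst (\<omega> A)) $ r" for r
      proof (cases "r \<in> N")
        case True
        then show ?thesis using g[of r] by (simp add: matrix_vector_mult_def)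
      next
        case False
        then show ?thesis using z o by (simp add: matrix_vector_mult_def)
      qed
      then show "A *v fst (\<omega> A) = snd (\<omega> A) *\<^sub>R fst (\<omega> A) \<and> (\<forall>r. r \<notin> N \<longrightarrow> fst (\<omega> A) $ r = 0)"
        using o by (simp add: vec_eq_iff)
    qed
  qed
qed

section \<open>Critical sets as gauge classes of linkages\<close>

context gauge_fixing
begin

text \<open>Rows in \<open>N\<close> hold by the eigenvalue equation of \<open>hN\<close>. In the
  other rows \<open>\<psi> $ r = 0\<close>, so the diagonal entry and the eigenvalue drop out and a
  closing equation remains.\<close>

lemma magnetic_eigenvector_iff:
  assumes h: "h \<in> symmetric_space E"
    and hN: "\<And>r s. r \<in> N \<Longrightarrow> s \<in> N \<Longrightarrow> complex_of_real (hN $ r $ s) = magnetic h \<beta> $ r $ s"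
    and u: "\<And>s. \<psi> $ s = c * of_real (u $ s)" "c \<noteq> 0" and \<psi>: "\<psi> \<in> eigenspace_on N hN \<mu>"
  shows "magnetic h \<beta> *v \<psi> = of_real \<mu> *s \<psi> \<longleftrightarrow>
    (\<forall>r. r \<notin> N \<longrightarrow> (\<Sum>s\<in>nbrs r. of_real (h $ r $ s * u $ s) * cis (\<beta> $ r $ s)) = 0)"
proof -
  have zero: "\<psi> $ s = 0" if "s \<notin> N" for s using \<psi> that by (simp add: eigenspace_on_iff)
  have inN: "(magnetic h \<beta> *v \<psi>) $ r = of_real \<mu> * \<psi> $ r" if r: "r \<in> N" for r
  proof -
    have "(magnetic h \<beta> *v \<psi>) $ r = (\<Sum>s\<in>UNIV. of_real (hN $ r $ s) * \<psi> $ s)"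
      unfolding matrix_vector_mult_def vec_lambda_beta
    proof (rule sum.cong[OF refl])
      fix s
      show "magnetic h \<beta> $ r $ s * \<psi> $ s = of_real (hN $ r $ s) * \<psi> $ s"
        by (cases "s \<in> N") (simp_all add: hN r zero)
    qed
    then show ?thesis using \<psi> by (simp add: eigenspace_on_iff)
  qed
  have offN: "(magnetic h \<beta> *v \<psi>) $ r = c * (\<Sum>s\<in>nbrs r. of_real (h $ r $ s * u $ s) * cis (\<beta> $ r $ s))"
    if r: "r \<notin> N" for r
  proof -
    have "(magnetic h \<beta> *v \<psi>) $ r = (\<Sum>s\<in>nbrs r. magnetic h \<beta> $ r $ s * \<psi> $ s)"
      unfolding matrix_vector_mult_def vec_lambda_beta
    proof (rule sum.mono_neutral_right)
      show "\<forall>s\<in>UNIV - nbrs r. magnetic h \<beta> $ r $ s * \<psi> $ s = 0"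
      proof
        fix s assume "s \<in> UNIV - nbrs r"
        then have "s \<notin> N \<or> (r \<noteq> s \<and> (r, s) \<notin> E)" using r by (auto simp: nbrs_def)
        then show "magnetic h \<beta> $ r $ s * \<psi> $ s = 0"
          using h zero by (auto simp: magnetic_nth symmetric_space_def supported_def)
      qed
    qed auto
    then show ?thesis
      by (simp add: magnetic_nth u sum_distrib_left mult_ac)
  qed
  show ?thesis
  proof
    assume eq: "magnetic h \<beta> *v \<psi> = of_real \<mu> *s \<psi>"
    show "\<forall>r. r \<notin> N \<longrightarrow> (\<Sum>s\<in>nbrs r. of_real (h $ r $ s * u $ s) * cis (\<beta> $ r $ s)) = 0"
    proof (intro allI impI)
      fix r assume r: "r \<notin> N"
      have "c * (\<Sum>s\<in>nbrs r. of_real (h $ r $ s * u $ s) * cis (\<beta> $ r $ s)) = 0"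
        unfolding offN[OF r, symmetric] eq by (simp add: zero[OF r])
      then show "(\<Sum>s\<in>nbrs r. of_real (h $ r $ s * u $ s) * cis (\<beta> $ r $ s)) = 0"
        using u(2) by (metis mult_eq_0_iff)
    qed
  next
    assume *: "\<forall>r. r \<notin> N \<longrightarrow> (\<Sum>s\<in>nbrs r. of_real (h $ r $ s * u $ s) * cis (\<beta> $ r $ s)) = 0"
    show "magnetic h \<beta> *v \<psi> = of_real \<mu> *s \<psi>"
    proof (subst vec_eq_iff, rule allI)
      fix r
      show "(magnetic h \<beta> *v \<psi>) $ r = (of_real \<mu> *s \<psi>) $ r"
      proof (cases "r \<in> N")
        case True
        then show ?thesis using inN by simp
      next
        case False
        then have "(\<Sum>s\<in>nbrs r. of_real (h $ r $ s * u $ s) * cis (\<beta> $ r $ s)) = 0"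
          using * by blast
        then show ?thesis using offN[OF False] zero[OF False] by (simp only: mult_zero_right vector_smult_component)
      qed
    qed
  qed
qed

lemma critical_set_iff:
  assumes irrefl: "\<And>r. (r, r) \<notin> E" and \<alpha>0: "\<alpha>0 \<in> antisymmetric_space E"
    and h: "h \<in> symmetric_space E" "strictly_supported E h"
    and hN: "\<And>r s. r \<in> N \<Longrightarrow> s \<in> N \<Longrightarrow> complex_of_real (hN $ r $ s) = magnetic h \<alpha>0 $ r $ s"
      "\<And>r s. r \<notin> N \<or> s \<notin> N \<Longrightarrow> hN $ r $ s = 0"
    and u: "\<And>s. \<psi> $ s = c * of_real (u $ s)" "c \<noteq> 0" and \<psi>: "\<psi> \<in> eigenspace_on N hN \<mu>"
    and m: "\<And>r s. r \<notin> N \<Longrightarrow> s \<in> nbrs r \<Longrightarrow> \<tau> r s * m r s = h $ r $ s * u $ s"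
    and \<alpha>: "\<alpha> \<in> antisymmetric_space E"
  shows "gauge_class E h \<alpha> \<in> critical_set E h N hN \<psi> \<mu> \<longleftrightarrow> \<alpha> \<in> linkages m"
proof -
  have diag: "\<beta> $ r $ r = 0" if "\<beta> \<in> antisymmetric_space E" for \<beta> :: "real^'v^'v" and r
  proof -
    have "\<beta> $ r $ r = - \<beta> $ r $ r" using that unfolding antisymmetric_space_iff by blast
    then show ?thesis by simp
  qed
  have restr: "restrict_matrix N (magnetic h \<beta>) = map_matrix complex_of_real hN \<longleftrightarrow>
      (\<forall>r\<in>N. \<forall>s\<in>N. complex_of_real (hN $ r $ s) = magnetic h \<beta> $ r $ s)" for \<beta>
    using hN(2) by (auto simp: vec_eq_iff restrict_matrix_def map_matrix_def)
  have edge: "h $ r $ s \<noteq> 0" if "(r, s) \<in> E" for r s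
    using h(2) irrefl that by (cases "r = s") (auto simp: strictly_supported_def)
  have m_sum: "(\<Sum>s\<in>nbrs r. of_real (h $ r $ s * u $ s) * z s) =
      (\<Sum>s\<in>nbrs r. of_real (m r s) * (of_real (\<tau> r s) * z s))" if "r \<notin> N" for r and z :: "'v \<Rightarrow> complex"
  proof (rule sum.cong[OF refl])
    fix s assume "s \<in> nbrs r"
    from m[OF that this] have "complex_of_real (h $ r $ s * u $ s) = of_real (m r s) * of_real (\<tau> r s)"
      by (metis mult.commute of_real_mult)
    then show "of_real (h $ r $ s * u $ s) * z s = of_real (m r s) * (of_real (\<tau> r s) * z s)"
      by (simp only: mult.assoc)
  qed
  show ?thesis
  proof
    assume "gauge_class E h \<alpha> \<in> critical_set E h N hN \<psi> \<mu>"
    then obtain \<beta> where \<beta>: "gauge_class E h \<alpha> = gauge_class E h \<beta>" "\<beta> \<in> antisymmetric_space E"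
      "restrict_matrix N (magnetic h \<beta>) = map_matrix complex_of_real hN"
      "magnetic h \<beta> *v \<psi> = of_real \<mu> *s \<psi>"
      unfolding critical_set_def by blast
    have \<beta>N: "complex_of_real (hN $ r $ s) = magnetic h \<beta> $ r $ s" if "r \<in> N" "s \<in> N" for r s
      using \<beta>(3) that unfolding restr by blast
    have cis\<beta>: "cis (\<beta> $ r $ s) = cis (\<alpha>0 $ r $ s)" if "r \<in> N" "s \<in> N" "(r, s) \<in> E" for r s
      using \<beta>N[OF that(1,2)] hN(1)[OF that(1,2)] edge[OF that(3)] by (simp add: magnetic_nth)
    \<comment> \<open>\<open>\<beta>\<close> already agrees with \<open>\<alpha>0\<close> in phase
      on the edges in \<open>N\<close>, so the path phases are trivial and \<open>dirn\<close> reads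
      off the phases of \<open>\<beta>\<close>.\<close>
    have p1: "cis (p s (\<beta> - \<alpha>0)) = 1" if "s \<in> N" for s
    proof -
      have "cis (p s (\<beta> - \<alpha>0)) = cis ((\<lambda>_. 0) s - (\<lambda>_. 0) root)"
        by (rule p_gauge[OF _ that]) (simp add: cis_divide[symmetric] cis\<beta>)
      then show ?thesis by simp
    qed
    have "cis (holonomy r s (\<beta> - \<alpha>0)) = 1" if e: "r \<in> N" "s \<in> N" "(r, s) \<in> E" for r s
      unfolding holonomy_def using e by (simp add: cis_divide[symmetric] p1 cis\<beta>)
    moreover have "closed_up (nbrs r) (m r) (\<lambda>s. dirn r s \<beta>)" if r: "r \<notin> N" for r
    proof -
      have "dirn r s \<beta> = of_real (\<tau> r s) * cis (\<beta> $ r $ s)" if "s \<in> nbrs r" for s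
        using that by (simp add: dirn_def cis_mult[symmetric] p1 nbrs_def)
      then have "(\<Sum>s\<in>nbrs r. of_real (m r s) * dirn r s \<beta>) =
          (\<Sum>s\<in>nbrs r. of_real (m r s) * (of_real (\<tau> r s) * cis (\<beta> $ r $ s)))"
        by simp
      also have "\<dots> = (\<Sum>s\<in>nbrs r. of_real (h $ r $ s * u $ s) * cis (\<beta> $ r $ s))"
        by (rule m_sum[OF r, symmetric])
      also have "\<dots> = 0"
        using magnetic_eigenvector_iff[where \<beta> = \<beta>, OF h(1) \<beta>N u \<psi>] \<beta>(4) r by blast
      finally show ?thesis .
    qed
    ultimately have "\<beta> \<in> linkages m" using \<beta>(2) by (simp add: linkages_def)
    moreover have "gauge_eq E \<beta> \<alpha>"
      using \<beta>(1) gauge_class_eq_iff[OF h \<alpha> \<beta>(2)] gauge_eq_sym by blast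
    ultimately show "\<alpha> \<in> linkages m" using linkages_gauge \<alpha> by blast
  next
    assume L: "\<alpha> \<in> linkages m"
    \<comment> \<open>The explicit gauge transformation to \<open>\<alpha>0\<close> on
      \<open>N\<close>. Its value 0 outside \<open>N\<close> matches the convention of
      \<open>dirn\<close> for the outer end.\<close>
    define \<eta> where "\<eta> r = (if r \<in> N then p r (\<alpha> - \<alpha>0) else 0)" for r
    define \<beta> :: "real^'v^'v" where
      "\<beta> = (\<chi> r s. if (r, s) \<in> E then \<alpha> $ r $ s - (\<eta> r - \<eta> s) else 0)"
    have \<beta>A: "\<beta> \<in> antisymmetric_space E"
      unfolding antisymmetric_space_iff
    proof (intro conjI allI impI)
      fix r s
      have "\<alpha> $ s $ r = - \<alpha> $ r $ s" using \<alpha> unfolding antisymmetric_space_iff by blast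
      moreover have "(s, r) \<in> E \<longleftrightarrow> (r, s) \<in> E" using sym_E by blast
      ultimately show "\<beta> $ s $ r = - \<beta> $ r $ s" by (simp add: \<beta>_def)
    qed (simp add: \<beta>_def)
    have "gauge_eq E \<alpha> \<beta>"
      unfolding gauge_eq_def by (intro exI[of _ \<eta>]) (simp add: \<beta>_def cis_mult)
    then have gc: "gauge_class E h \<alpha> = gauge_class E h \<beta>"
      using gauge_class_eq_iff[OF h \<alpha> \<beta>A] by blast
    have \<beta>N: "complex_of_real (hN $ r $ s) = magnetic h \<beta> $ r $ s" if rs: "r \<in> N" "s \<in> N" for r s
    proof (cases "(r, s) \<in> E")
      case True
      have "\<beta> $ r $ s = \<alpha>0 $ r $ s + holonomy r s (\<alpha> - \<alpha>0)"
        using True rs by (simp add: \<beta>_def \<eta>_def holonomy_def)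
      moreover have "cis (holonomy r s (\<alpha> - \<alpha>0)) = 1" using L rs True by (simp add: linkages_def)
      ultimately have "cis (\<beta> $ r $ s) = cis (\<alpha>0 $ r $ s)" by (simp add: cis_mult[symmetric])
      then show ?thesis using hN(1)[OF rs] by (simp add: magnetic_nth)
    next
      case False
      then have "r = s \<or> h $ r $ s = 0" using h(2) by (auto simp: strictly_supported_def)
      then show ?thesis using hN(1)[OF rs] diag[OF \<alpha>0] diag[OF \<beta>A] by (auto simp: magnetic_nth)
    qed
    have "(\<Sum>s\<in>nbrs r. of_real (h $ r $ s * u $ s) * cis (\<beta> $ r $ s)) = 0" if r: "r \<notin> N" for r
    proof -
      have "dirn r s \<alpha> = of_real (\<tau> r s) * cis (\<beta> $ r $ s)" if "s \<in> nbrs r" for s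
        using that r by (simp add: dirn_def nbrs_def \<beta>_def \<eta>_def)
      then have "(\<Sum>s\<in>nbrs r. of_real (m r s) * dirn r s \<alpha>) =
          (\<Sum>s\<in>nbrs r. of_real (m r s) * (of_real (\<tau> r s) * cis (\<beta> $ r $ s)))"
        by simp
      then show ?thesis using L r unfolding m_sum[OF r] by (simp add: linkages_def)
    qed
    then have "magnetic h \<beta> *v \<psi> = of_real \<mu> *s \<psi>"
      using magnetic_eigenvector_iff[where \<beta> = \<beta>, OF h(1) \<beta>N u \<psi>] by blast
    moreover have "restrict_matrix N (magnetic h \<beta>) = map_matrix complex_of_real hN"
      unfolding restr using \<beta>N by blast
    ultimately show "gauge_class E h \<alpha> \<in> critical_set E h N hN \<psi> \<mu>"
      unfolding critical_set_def gc using \<beta>A by blast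
  qed
qed

lemma critical_set_subset_torus: "critical_set E h N hN \<psi> \<mu> \<subseteq> magnetic_torus E h"
  by (auto simp: critical_set_def magnetic_torus_def)

end

section \<open>Genericity and nondegeneracy of the linkages\<close>

lemma generic_eigenvector_nonzero:
  assumes "generic E h" "induces_connected E J" "is_signing (restrict_matrix J h) h'"
    and "is_eigenvector_on J h' \<mu> \<psi>" "r \<in> J"
  shows "\<psi> $ r \<noteq> 0"
proof -
  have "\<exists>!C. C \<in> graph_components E J \<and> (\<forall>r\<in>C. \<psi> $ r \<noteq> 0)"
  proof -
    have "\<forall>J h'. is_signing (restrict_matrix J h) h' \<longrightarrow> simple_spectrum_on J h' \<and>
        (\<forall>\<mu> \<psi>. is_eigenvector_on J h' \<mu> \<psi> \<longrightarrow>
          (\<exists>!C. C \<in> graph_components E J \<and> (\<forall>r\<in>C. \<psi> $ r \<noteq> 0)))"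
      using assms(1) unfolding generic_def by (elim conjE)
    from this[THEN spec, THEN spec, THEN mp, OF assms(3), THEN conjunct2, THEN spec, THEN spec,
        THEN mp, OF assms(4)]
    show ?thesis .
  qed
  then show ?thesis using assms(5) by (auto simp: graph_components_connected[OF assms(2)])
qed

text \<open>A degenerate linkage at \<open>r\<close> would give an eigenvector of a signing on \<open>insert r N\<close> vanishing
  at \<open>r\<close>.\<close>

lemma generic_nondegenerate:
  assumes "sym E" "generic E h" "induces_connected E N" "r \<notin> N"
    and hN: "is_signing (restrict_matrix N h) hN" "is_eigenvector_on N hN \<mu> \<psi>"
    and u: "\<And>s. \<psi> $ s = c * of_real (u $ s)"
    and B: "B = {s \<in> N. (r, s) \<in> E}" "B \<noteq> {}"
    and \<tau>: "\<And>s. \<tau> s = 1 \<or> \<tau> s = - 1"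
  shows "nondegenerate B (\<lambda>s. \<tau> s * (h $ r $ s * u $ s))"
  unfolding nondegenerate_def
proof (intro allI impI notI)
  fix \<sigma> :: "'a \<Rightarrow> real"
  assume \<sigma>: "\<forall>s\<in>B. \<sigma> s = 1 \<or> \<sigma> s = - 1" and sum0: "(\<Sum>s\<in>B. \<sigma> s * (\<tau> s * (h $ r $ s * u $ s))) = 0"
  define \<rho> where "\<rho> s = (if s \<in> B then \<sigma> s * \<tau> s else 1)" for s
  have \<rho>: "\<rho> s = 1 \<or> \<rho> s = - 1" for s
    using \<sigma> \<tau>[of s] by (auto simp: \<rho>_def)
  \<comment> \<open>Row and column \<open>r\<close> carry the signs \<open>\<rho>\<close>, the rest
    is \<open>hN\<close>. As \<open>\<psi>\<close> vanishes at \<open>r\<close>, the new column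
    leaves the other rows of the eigenvalue equation intact, and row \<open>r\<close> becomes the
    vanishing sum.\<close>
  define h' where "h' = (\<chi> a b. if a = r \<and> b = r then h $ r $ r
    else if a = r \<and> b \<in> N then \<rho> b * h $ r $ b
    else if b = r \<and> a \<in> N then \<rho> a * h $ r $ a else hN $ a $ b)"
  define J where "J = insert r N"
  obtain s where "s \<in> B" using B(2) by blast
  then have conn: "induces_connected E J"
    unfolding J_def using assms(1,3) B(1) by (intro induces_connected_insert[of E N s r]) auto
  have hsym: "h $ a $ b = h $ b $ a" for a b
    using assms(2) by (auto simp: generic_def symmetric_space_def transpose_def vec_eq_iff)
  have supp: "h $ a $ b = 0" if "a \<noteq> b" "(a, b) \<notin> E" for a b
    using assms(2) that by (auto simp: generic_def symmetric_space_def supported_def)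
  have hNsym: "hN $ a $ b = hN $ b $ a" for a b
    using hN(1) by (auto simp: is_signing_def transpose_def vec_eq_iff)
  have hNd: "hN $ a $ a = restrict_matrix N h $ a $ a" for a
    using hN(1) by (auto simp: is_signing_def)
  have hNe: "hN $ a $ b = restrict_matrix N h $ a $ b \<or> hN $ a $ b = - restrict_matrix N h $ a $ b" for a b
    using hN(1) hNd[of a] by (cases "a = b") (auto simp: is_signing_def)
  have hN0: "hN $ a $ b = 0" if "a \<notin> N \<or> b \<notin> N" for a b
    using hNe[of a b] that by (auto simp: restrict_matrix_def)
  have "is_signing (restrict_matrix J h) h'"
    unfolding is_signing_def
  proof (intro conjI allI impI)
    show "transpose h' = h'"
      by (auto simp: vec_eq_iff transpose_def h'_def hNsym)
    show "h' $ a $ a = restrict_matrix J h $ a $ a" for a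
      using assms(4) hNd[of a] by (auto simp: h'_def J_def restrict_matrix_def)
    show "h' $ a $ b = restrict_matrix J h $ a $ b \<or> h' $ a $ b = - restrict_matrix J h $ a $ b"
      if "a \<noteq> b" for a b
      using assms(4) hNe[of a b] \<rho>[of a] \<rho>[of b] hsym[of a b] hN0[of a b] that
      by (auto simp: h'_def J_def restrict_matrix_def)
  qed
  moreover have "is_eigenvector_on J h' \<mu> \<psi>"
  proof -
    have \<psi>: "\<psi> \<noteq> 0" "\<And>s. s \<notin> N \<Longrightarrow> \<psi> $ s = 0"
      "\<And>a. (\<Sum>s\<in>UNIV. of_real (hN $ a $ s) * \<psi> $ s) = of_real \<mu> * \<psi> $ a"
      using hN(2) by (auto simp: is_eigenvector_on_def eigenspace_on_iff)
    have "(\<Sum>s\<in>UNIV. of_real (h' $ a $ s) * \<psi> $ s) = of_real \<mu> * \<psi> $ a" for a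
    proof (cases "a = r")
      case True
      have "(\<Sum>s\<in>UNIV. of_real (h' $ r $ s) * \<psi> $ s) = (\<Sum>s\<in>B. of_real (h' $ r $ s) * \<psi> $ s)"
      proof (rule sum.mono_neutral_right)
        show "\<forall>s\<in>UNIV - B. of_real (h' $ r $ s) * \<psi> $ s = 0"
          using supp[of r] assms(4) \<psi>(2) B(1) by (auto simp: h'_def)
      qed auto
      also have "\<dots> = (\<Sum>s\<in>B. c * of_real (\<sigma> s * (\<tau> s * (h $ r $ s * u $ s))))"
        using assms(4) B(1) by (intro sum.cong refl) (auto simp: h'_def \<rho>_def u)
      also have "\<dots> = 0"
        unfolding sum_distrib_left[symmetric] of_real_sum[symmetric] sum0 by simp
      finally show ?thesis using True \<psi>(2)[OF assms(4)] by simp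
    next
      case False
      have "of_real (h' $ a $ s) * \<psi> $ s = of_real (hN $ a $ s) * \<psi> $ s" for s
        using False \<psi>(2)[OF assms(4)] by (auto simp: h'_def)
      then have "(\<Sum>s\<in>UNIV. of_real (h' $ a $ s) * \<psi> $ s) = (\<Sum>s\<in>UNIV. of_real (hN $ a $ s) * \<psi> $ s)"
        by (rule sum.cong[OF refl])
      then show ?thesis using \<psi>(3)[of a] by simp
    qed
    then show ?thesis
      using \<psi>(1,2) by (simp add: is_eigenvector_on_def eigenspace_on_iff J_def)
  qed
  ultimately have "\<psi> $ r \<noteq> 0"
    using generic_eigenvector_nonzero[OF assms(2) conn] by (auto simp: J_def)
  then show False
    using hN(2) assms(4) by (auto simp: is_eigenvector_on_def eigenspace_on_iff)
qed

theorem theorem3p9: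
  fixes E :: "('v::finite \<times> 'v) set"
    and h hN :: "real^'v^'v"
    and VN :: "'v set"
    and \<psi>N :: "complex^'v"
    and lam \<epsilon> :: real
  assumes "simple_graph E" and "induces_connected E UNIV"
    and "generic E h"
    and "critical_data E h VN hN \<psi>N lam"
    and "critical_set E h VN hN \<psi>N lam \<noteq> {}"
    and "\<epsilon> > 0"
  shows "\<exists>U. openin (top_of_set (symmetric_space E)) U \<and> h \<in> U \<and>
    (\<forall>h'\<in>U. strictly_supported E h' \<and>
      (\<exists>hN' \<psi>N' lam'. critical_data E h' VN hN' \<psi>N' lam' \<and>
        torus_submanifold E h' (critical_set E h' VN hN' \<psi>N' lam') \<and>
        torus_diffeomorphic E h (critical_set E h VN hN \<psi>N lam)
          h' (critical_set E h' VN hN' \<psi>N' lam') \<and>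
        norm (hN' - hN) < \<epsilon> \<and> norm (\<psi>N' - \<psi>N) < \<epsilon> \<and> \<bar>lam' - lam\<bar> < \<epsilon>))"
proof -
  have symE: "sym E" and irrefl: "(r, r) \<notin> E" for r
    using assms(1) by (auto simp: simple_graph_def irrefl_def)
  have h: "h \<in> symmetric_space E" "strictly_supported E h"
    using assms(3) by (auto simp: generic_def)
  have adm: "admissible_support E VN" and conn: "induces_connected E VN"
    and sg: "is_signing (restrict_matrix VN h) hN" and ev: "is_eigenvector_on VN hN lam \<psi>N"
    using assms(4) by (auto simp: critical_data_def admissible_support_def)
  have \<psi>N: "\<psi>N \<in> eigenspace_on VN hN lam" "\<psi>N \<noteq> 0"
    using ev by (auto simp: is_eigenvector_on_def)
  have nz: "\<psi>N $ r \<noteq> 0" if "r \<in> VN" for r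
    using generic_eigenvector_nonzero[OF assms(3) conn sg ev that] .
  obtain root where root: "root \<in> VN" using conn by (auto simp: induces_connected_def)
  have "simple_spectrum_on VN hN" using assms(3) sg unfolding generic_def by meson
  then have dim: "vec.dim (eigenspace_on VN hN lam) = 1"
    using ev by (auto simp: simple_spectrum_on_def)
  obtain c u where c: "c \<noteq> 0" and u: "\<And>s. \<psi>N $ s = c * of_real (u $ s)" and hNu: "hN *v u = lam *\<^sub>R u"
    and simple: "\<And>v. (\<And>r. r \<notin> VN \<Longrightarrow> v $ r = 0) \<Longrightarrow> hN *v v = lam *\<^sub>R v \<Longrightarrow> \<exists>k. v = k *\<^sub>R u"
    using real_eigenvector[OF dim \<psi>N(1) nz[OF root]] by metis
  have u0: "u $ r = 0" if "r \<notin> VN" for r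
    using \<psi>N(1) that u[of r] c by (simp add: eigenspace_on_iff)
  have u_nz: "u $ r \<noteq> 0" if "r \<in> VN" for r using nz[OF that] u[of r] by auto
  have "u \<noteq> 0" using u_nz[OF root] by auto
  have hN_sym: "transpose hN = hN" using sg by (simp add: is_signing_def)
  have hN_cases: "hN $ r $ s = restrict_matrix VN h $ r $ s \<or> hN $ r $ s = - restrict_matrix VN h $ r $ s" for r s
    using sg by (cases "r = s") (auto simp: is_signing_def)
  have hN0: "hN $ r $ s = 0" if "r \<notin> VN \<or> s \<notin> VN" for r s
    using hN_cases[of r s] that by (auto simp: restrict_matrix_def)
  \<comment> \<open>Nonemptiness of the critical set enters here: a representative provides phases
    realising the signing \<open>hN\<close>, which are kept for every nearby
    \<open>h'\<close>.\<close>
  obtain \<alpha>0 where \<alpha>0: "\<alpha>0 \<in> antisymmetric_space E"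
    "restrict_matrix VN (magnetic h \<alpha>0) = map_matrix complex_of_real hN"
    using assms(5) by (auto simp: critical_set_def)
  have mag0: "complex_of_real (hN $ r $ s) = magnetic h \<alpha>0 $ r $ s" if "r \<in> VN" "s \<in> VN" for r s
  proof -
    have "restrict_matrix VN (magnetic h \<alpha>0) $ r $ s = map_matrix complex_of_real hN $ r $ s"
      by (simp only: \<alpha>0(2))
    then show ?thesis using that by (simp add: restrict_matrix_def map_matrix_def)
  qed
  have \<alpha>0_sym: "\<alpha>0 $ s $ r = - \<alpha>0 $ r $ s" for r s
    using \<alpha>0(1) unfolding antisymmetric_space_iff by blast
  have \<alpha>0_diag: "\<alpha>0 $ r $ r = 0" for r using \<alpha>0_sym[of r r] by simp
  \<comment> \<open>On edges within the support the phase is real, because \<open>hN\<close> and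
    \<open>h\<close> are, so \<open>\<kappa>\<close> is the sign pattern of \<open>hN\<close>; on
    the diagonal it is 1.\<close>
  define \<kappa> where "\<kappa> r s = Re (cis (\<alpha>0 $ r $ s))" for r s
  have h_edge: "h $ r $ s \<noteq> 0" if "(r, s) \<in> E" for r s
    using h(2) irrefl that by (cases "r = s") (auto simp: strictly_supported_def)
  have cis_\<kappa>: "cis (\<alpha>0 $ r $ s) = of_real (\<kappa> r s) \<and> \<bar>\<kappa> r s\<bar> = 1" if rs: "r \<in> VN" "s \<in> VN" "(r, s) \<in> E" for r s
  proof -
    have "of_real (hN $ r $ s) = cis (\<alpha>0 $ r $ s) * of_real (h $ r $ s)"
      using mag0[OF rs(1,2)] by (simp add: magnetic_nth)
    then have "cis (\<alpha>0 $ r $ s) = of_real (hN $ r $ s / h $ r $ s)"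
      using h_edge[OF rs(3)] by (simp add: field_simps)
    then have *: "cis (\<alpha>0 $ r $ s) = of_real (\<kappa> r s)" by (simp add: \<kappa>_def)
    from arg_cong[OF *, of norm] have "\<bar>\<kappa> r s\<bar> = 1" by simp
    then show ?thesis using * by simp
  qed
  define hN' where "hN' h' = (\<chi> r s. if r \<in> VN \<and> s \<in> VN then \<kappa> r s * h' $ r $ s else 0)"
    for h' :: "real^'v^'v"
  have mag': "complex_of_real (hN' h' $ r $ s) = magnetic h' \<alpha>0 $ r $ s"
    if "r \<in> VN" "s \<in> VN" "h' \<in> symmetric_space E" for r s h'
  proof -
    have "(r, s) \<in> E \<or> r = s \<or> h' $ r $ s = 0"
      using that(3) by (auto simp: symmetric_space_def supported_def)
    then show ?thesis
      using that cis_\<kappa>[of r s] by (auto simp: hN'_def magnetic_nth \<kappa>_def \<alpha>0_diag)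
  qed
  have hN'_h: "hN' h = hN"
  proof (intro vec_eq_iff[THEN iffD2] allI)
    fix r s
    show "hN' h $ r $ s = hN $ r $ s"
    proof (cases "r \<in> VN \<and> s \<in> VN")
      case True
      then have "complex_of_real (hN' h $ r $ s) = of_real (hN $ r $ s)"
        using mag'[of r s h] mag0[of r s] h(1) by simp
      then show ?thesis by (simp only: of_real_eq_iff)
    next
      case False
      then show ?thesis using hN0[of r s] by (auto simp: hN'_def)
    qed
  qed
  have hN'0: "hN' h' $ r $ s = 0" if "r \<notin> VN \<or> s \<notin> VN" for h' r s
    using that by (auto simp: hN'_def)
  have signing': "is_signing (restrict_matrix VN h') (hN' h')" if "h' \<in> symmetric_space E" for h'
  proof -
    have hs: "h' $ s $ r = h' $ r $ s" for r s
      using that by (auto simp: symmetric_space_def transpose_def vec_eq_iff)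
    have \<kappa>s: "\<kappa> s r = \<kappa> r s" for r s by (simp add: \<kappa>_def \<alpha>0_sym[of s r])
    show ?thesis
      unfolding is_signing_def
    proof (intro conjI allI impI)
      show "transpose (hN' h') = hN' h'"
        by (simp add: transpose_def vec_eq_iff hN'_def hs \<kappa>s conj_commute)
      show "hN' h' $ r $ r = restrict_matrix VN h' $ r $ r" for r
        by (simp add: hN'_def restrict_matrix_def \<kappa>_def \<alpha>0_diag)
      show "hN' h' $ r $ s = restrict_matrix VN h' $ r $ s \<or> hN' h' $ r $ s = - restrict_matrix VN h' $ r $ s"
        if "r \<noteq> s" for r s
      proof (cases "r \<in> VN \<and> s \<in> VN \<and> (r, s) \<in> E")
        case True
        then have "\<kappa> r s = 1 \<or> \<kappa> r s = - 1" using cis_\<kappa>[of r s] by auto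
        then show ?thesis using True by (auto simp: hN'_def restrict_matrix_def)
      next
        case False
        then have "h' $ r $ s = 0 \<or> \<not> (r \<in> VN \<and> s \<in> VN)"
          using \<open>h' \<in> symmetric_space E\<close> \<open>r \<noteq> s\<close> by (auto simp: symmetric_space_def supported_def)
        then show ?thesis by (auto simp: hN'_def restrict_matrix_def)
      qed
    qed
  qed
  obtain p where lin_p: "\<forall>s. linear (p s)"
    and p: "\<forall>\<gamma> \<eta>. (\<forall>r\<in>VN. \<forall>t\<in>VN. (r, t) \<in> E \<longrightarrow> cis (\<gamma> $ r $ t) = cis (\<eta> r - \<eta> t)) \<longrightarrow>
      (\<forall>s\<in>VN. cis (p s \<gamma>) = cis (\<eta> s - \<eta> root))"
      "\<forall>(\<gamma> :: real^'v^'v) s. (\<forall>r\<in>VN. \<forall>t\<in>VN. \<gamma> $ r $ t = 0) \<longrightarrow> p s \<gamma> = 0"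
    using path_functionals_exist[OF conn root] by (elim exE conjE)
  \<comment> \<open>Signs are taken at the unperturbed \<open>h\<close> and then fixed, so that
    \<open>dirn\<close> is the same function for all \<open>h'\<close>; near \<open>h\<close> the
    lengths \<open>m h' (v h')\<close> remain positive on the relevant edges.\<close>
  define \<tau> where "\<tau> r s = (if h $ r $ s * u $ s \<ge> 0 then 1 else - 1 :: real)" for r s
  have \<tau>: "\<tau> r s = 1 \<or> \<tau> r s = - 1" for r s by (simp add: \<tau>_def)
  interpret gauge_fixing E VN root p \<alpha>0 \<tau>
  proof (rule gauge_fixing.intro)
    show "(s, r) \<in> E" if "(r, s) \<in> E" for r s using symE that by (rule symD)
    show "linear (p s)" for s using lin_p by blast
    show "cis (p s \<gamma>) = cis (\<eta> s - \<eta> root)"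
      if "\<And>r t. r \<in> VN \<Longrightarrow> t \<in> VN \<Longrightarrow> (r, t) \<in> E \<Longrightarrow> cis (\<gamma> $ r $ t) = cis (\<eta> r - \<eta> t)" "s \<in> VN"
      for \<gamma> :: "real^'v^'v" and s and \<eta> :: "'v \<Rightarrow> real"
      using p(1) that by blast
    show "p s \<gamma> = 0" if "\<And>r t. r \<in> VN \<Longrightarrow> t \<in> VN \<Longrightarrow> \<gamma> $ r $ t = 0" for \<gamma> :: "real^'v^'v" and s
      using p(2) that by blast
    show "\<bar>\<tau> r s\<bar> = 1" for r s by (simp add: \<tau>_def)
  qed
  define m where "m h' v r s = \<tau> r s * (h' $ r $ s * v $ s)" for h' :: "real^'v^'v" and v :: "real^'v" and r s
  have m_pos: "m h u r s > 0" if "r \<notin> VN" "s \<in> nbrs r" for r s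
  proof -
    have "h $ r $ s * u $ s \<noteq> 0" using that h_edge[of r s] u_nz[of s] by (simp add: nbrs_def)
    moreover have "x \<noteq> 0 \<Longrightarrow> (if x \<ge> 0 then 1 else - 1) * x > 0" for x :: real by auto
    ultimately show ?thesis unfolding m_def \<tau>_def by blast
  qed
  have nondeg: "nondegenerate (nbrs r) (m h u r)" if "r \<notin> VN" "nbrs r \<noteq> {}" for r
    using generic_nondegenerate[OF symE assms(3) conn that(1) sg ev u nbrs_def that(2) \<tau>]
    by (simp add: m_def[abs_def])
  have "\<exists>d>0. bent r \<longrightarrow>
    (\<forall>m'. (\<forall>j\<in>nbrs r. \<bar>m' j - m h u r j\<bar> \<le> d) \<longrightarrow> nondegenerate (nbrs r) m' \<and> (\<forall>j\<in>nbrs r. m' j > 0)) \<and>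
    (\<forall>m1 m2. (\<forall>j\<in>nbrs r. \<bar>m1 j - m h u r j\<bar> \<le> d) \<longrightarrow> (\<forall>j\<in>nbrs r. \<bar>m2 j - m h u r j\<bar> \<le> d) \<longrightarrow>
      good_pair (nbrs r) m1 m2)" for r
  proof (cases "bent r")
    case True
    then have r: "r \<notin> VN" "nbrs r \<noteq> {}" by (auto simp: bent_def)
    show ?thesis
      using nondegenerate_perturb[OF _ nondeg[OF r] m_pos[OF r(1)]] True by simp
  qed (auto intro: exI[of _ 1])
  then have "\<forall>r. \<exists>d>0. bent r \<longrightarrow>
    (\<forall>m'. (\<forall>j\<in>nbrs r. \<bar>m' j - m h u r j\<bar> \<le> d) \<longrightarrow> nondegenerate (nbrs r) m' \<and> (\<forall>j\<in>nbrs r. m' j > 0)) \<and>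
    (\<forall>m1 m2. (\<forall>j\<in>nbrs r. \<bar>m1 j - m h u r j\<bar> \<le> d) \<longrightarrow> (\<forall>j\<in>nbrs r. \<bar>m2 j - m h u r j\<bar> \<le> d) \<longrightarrow>
      good_pair (nbrs r) m1 m2)" ..
  from choice[OF this] obtain d where d: "\<And>r. d r > 0"
    "\<And>r m'. bent r \<Longrightarrow> \<forall>j\<in>nbrs r. \<bar>m' j - m h u r j\<bar> \<le> d r \<Longrightarrow>
      nondegenerate (nbrs r) m' \<and> (\<forall>j\<in>nbrs r. m' j > 0)"
    "\<And>r m1 m2. bent r \<Longrightarrow> \<forall>j\<in>nbrs r. \<bar>m1 j - m h u r j\<bar> \<le> d r \<Longrightarrow>
      \<forall>j\<in>nbrs r. \<bar>m2 j - m h u r j\<bar> \<le> d r \<Longrightarrow> good_pair (nbrs r) m1 m2"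
    by blast
  obtain u' l' where u': "(u' \<longlongrightarrow> u) (nhds hN)" "(l' \<longlongrightarrow> lam) (nhds hN)"
    "\<forall>\<^sub>F A in nhds hN. (\<forall>r s. r \<notin> VN \<or> s \<notin> VN \<longrightarrow> A $ r $ s = 0) \<longrightarrow>
      A *v u' A = l' A *\<^sub>R u' A \<and> (\<forall>r. r \<notin> VN \<longrightarrow> u' A $ r = 0)"
    by (rule eigenpair_perturb[of hN VN u lam])
      (use hN_sym hN0 u0 \<open>u \<noteq> 0\<close> hNu simple that in blast)+
  define v where "v h' = u' (hN' h')" for h'
  \<comment> \<open>The complex factor \<open>c\<close> of the given eigenvector is retained, so
    that \<open>\<psi>'\<close> converges to \<open>\<psi>N\<close> and not just to a multiple of
    it.\<close>
  define \<psi>' where "\<psi>' h' = (\<chi> s. c * complex_of_real (v h' $ s))" for h'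
  define lam' where "lam' h' = l' (hN' h')" for h'
  have nth: "((\<lambda>h'. h' $ r $ s) \<longlongrightarrow> h $ r $ s) (nhds h)" for r s
    by (intro tendsto_vec_nth) (simp add: filterlim_ident)
  have "(hN' \<longlongrightarrow> hN' h) (nhds h)"
    unfolding hN'_def
  proof (intro tendsto_vec_lambda)
    show "((\<lambda>h'. if r \<in> VN \<and> s \<in> VN then \<kappa> r s * h' $ r $ s else 0) \<longlongrightarrow>
        (if r \<in> VN \<and> s \<in> VN then \<kappa> r s * h $ r $ s else 0)) (nhds h)" for r s
      by (cases "r \<in> VN \<and> s \<in> VN") (auto intro!: tendsto_intros nth)
  qed
  then have lim: "(hN' \<longlongrightarrow> hN) (nhds h)" by (simp only: hN'_h)
  have v_lim: "(v \<longlongrightarrow> u) (nhds h)"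
    unfolding v_def by (rule filterlim_compose[OF u'(1) lim])
  have lam_lim: "(lam' \<longlongrightarrow> lam) (nhds h)"
    unfolding lam'_def by (rule filterlim_compose[OF u'(2) lim])
  have "(\<psi>' \<longlongrightarrow> (\<chi> s. c * complex_of_real (u $ s))) (nhds h)"
    unfolding \<psi>'_def by (intro tendsto_vec_lambda tendsto_intros tendsto_vec_nth v_lim)
  then have \<psi>_lim: "(\<psi>' \<longlongrightarrow> \<psi>N) (nhds h)" by (simp add: u[symmetric])
  have m_lim: "((\<lambda>h'. m h' (v h') r s) \<longlongrightarrow> m h u r s) (nhds h)" for r s
    unfolding m_def by (intro tendsto_intros nth tendsto_vec_nth v_lim)
  \<comment> \<open>Nonzero entries persist, while entries off the edges stay zero because the
    neighbourhood lies in \<open>symmetric_space E\<close>; together these keep \<open>h'\<close>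
    strictly supported.\<close>
  have "\<forall>\<^sub>F h' in nhds h. \<forall>r s. h $ r $ s \<noteq> 0 \<longrightarrow> h' $ r $ s \<noteq> 0"
  proof (intro eventually_all_finite)
    show "\<forall>\<^sub>F h' in nhds h. h $ r $ s \<noteq> 0 \<longrightarrow> h' $ r $ s \<noteq> 0" for r s
      using tendsto_imp_eventually_ne[OF nth[of r s], of 0]
      by (cases "h $ r $ s = 0") auto
  qed
  moreover have "\<forall>\<^sub>F h' in nhds h. \<forall>r s. \<bar>m h' (v h') r s - m h u r s\<bar> < d r"
    using m_lim d(1) by (intro eventually_all_finite) (auto simp: tendsto_iff dist_real_def)
  moreover have "\<forall>\<^sub>F h' in nhds h. (\<forall>r s. r \<notin> VN \<or> s \<notin> VN \<longrightarrow> hN' h' $ r $ s = 0) \<longrightarrow>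
      hN' h' *v v h' = lam' h' *\<^sub>R v h' \<and> (\<forall>r. r \<notin> VN \<longrightarrow> v h' $ r = 0)"
    unfolding v_def lam'_def by (rule eventually_compose_filterlim[OF u'(3) lim])
  moreover have "\<forall>\<^sub>F h' in nhds h. \<psi>' h' \<noteq> 0"
    using tendsto_imp_eventually_ne[OF \<psi>_lim \<psi>N(2)] .
  moreover have "\<forall>\<^sub>F h' in nhds h. norm (hN' h' - hN) < \<epsilon>" "\<forall>\<^sub>F h' in nhds h. norm (\<psi>' h' - \<psi>N) < \<epsilon>"
    "\<forall>\<^sub>F h' in nhds h. \<bar>lam' h' - lam\<bar> < \<epsilon>"
    using lim \<psi>_lim lam_lim \<open>\<epsilon> > 0\<close> by (auto simp: tendsto_iff dist_norm)
  ultimately have "\<forall>\<^sub>F h' in nhds h. (\<forall>r s. h $ r $ s \<noteq> 0 \<longrightarrow> h' $ r $ s \<noteq> 0) \<and>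
      (\<forall>r s. \<bar>m h' (v h') r s - m h u r s\<bar> < d r) \<and>
      hN' h' *v v h' = lam' h' *\<^sub>R v h' \<and> (\<forall>r. r \<notin> VN \<longrightarrow> v h' $ r = 0) \<and> \<psi>' h' \<noteq> 0 \<and>
      norm (hN' h' - hN) < \<epsilon> \<and> norm (\<psi>' h' - \<psi>N) < \<epsilon> \<and> \<bar>lam' h' - lam\<bar> < \<epsilon>"
    by eventually_elim (simp add: hN'0)
  then obtain T where T: "open T" "h \<in> T"
    and near: "\<forall>h'\<in>T. (\<forall>r s. h $ r $ s \<noteq> 0 \<longrightarrow> h' $ r $ s \<noteq> 0) \<and>
      (\<forall>r s. \<bar>m h' (v h') r s - m h u r s\<bar> < d r) \<and>
      hN' h' *v v h' = lam' h' *\<^sub>R v h' \<and> (\<forall>r. r \<notin> VN \<longrightarrow> v h' $ r = 0) \<and> \<psi>' h' \<noteq> 0 \<and>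
      norm (hN' h' - hN) < \<epsilon> \<and> norm (\<psi>' h' - \<psi>N) < \<epsilon> \<and> \<bar>lam' h' - lam\<bar> < \<epsilon>"
    unfolding eventually_nhds by (elim exE conjE)
  have iff0: "gauge_class E h \<alpha> \<in> critical_set E h VN hN \<psi>N lam \<longleftrightarrow> \<alpha> \<in> linkages (m h u)"
    if "\<alpha> \<in> antisymmetric_space E" for \<alpha>
  proof (rule critical_set_iff[OF irrefl \<alpha>0(1) h mag0 hN0 u c \<psi>N(1) _ that])
    show "\<tau> r s * m h u r s = h $ r $ s * u $ s" for r s
      by (simp add: m_def \<tau>_def)
  qed
  show ?thesis
  proof (intro exI[of _ "symmetric_space E \<inter> T"] conjI ballI)
    show "openin (top_of_set (symmetric_space E)) (symmetric_space E \<inter> T)"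
      using T(1) by (rule openin_open_Int)
    show "h \<in> symmetric_space E \<inter> T" using h(1) T(2) by blast
    fix h' assume "h' \<in> symmetric_space E \<inter> T"
    then have h': "h' \<in> symmetric_space E" and "h' \<in> T" by auto
    from near[THEN bspec, OF \<open>h' \<in> T\<close>] have n: "(\<forall>r s. h $ r $ s \<noteq> 0 \<longrightarrow> h' $ r $ s \<noteq> 0)"
      "\<And>r s. \<bar>m h' (v h') r s - m h u r s\<bar> < d r" "hN' h' *v v h' = lam' h' *\<^sub>R v h'"
      "\<And>r. r \<notin> VN \<Longrightarrow> v h' $ r = 0" "\<psi>' h' \<noteq> 0"
      "norm (hN' h' - hN) < \<epsilon>" "norm (\<psi>' h' - \<psi>N) < \<epsilon>" "\<bar>lam' h' - lam\<bar> < \<epsilon>"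
      by simp_all
    show strict': "strictly_supported E h'"
      using h' h(2) n(1) by (auto simp: strictly_supported_def symmetric_space_def supported_def)
    have near_m: "\<forall>j\<in>nbrs r. \<bar>m h' (v h') r j - m h u r j\<bar> \<le> d r" for r
      using n(2) less_imp_le by blast
    have self: "\<forall>j\<in>nbrs r. \<bar>m h u r j - m h u r j\<bar> \<le> d r" for r
      using d(1)[of r] by simp
    have eig': "\<psi>' h' \<in> eigenspace_on VN (hN' h') (lam' h')"
      unfolding eigenspace_on_iff
    proof (intro conjI allI impI)
      show "\<psi>' h' $ r = 0" if "r \<notin> VN" for r using n(4)[OF that] by (simp add: \<psi>'_def)
      show "(\<Sum>s\<in>UNIV. of_real (hN' h' $ r $ s) * \<psi>' h' $ s) = of_real (lam' h') * \<psi>' h' $ r" for r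
      proof -
        have "(\<Sum>s\<in>UNIV. hN' h' $ r $ s * v h' $ s) = lam' h' * v h' $ r"
          using n(3) by (simp add: vec_eq_iff matrix_vector_mult_def)
        from arg_cong[OF this, of "\<lambda>x. c * complex_of_real x"]
        show ?thesis by (simp add: \<psi>'_def sum_distrib_left mult_ac)
      qed
    qed
    have crit': "critical_data E h' VN (hN' h') (\<psi>' h') (lam' h')"
      using adm signing'[OF h'] eig' n(5) by (simp add: critical_data_def is_eigenvector_on_def)
    have iff': "gauge_class E h' \<alpha> \<in> critical_set E h' VN (hN' h') (\<psi>' h') (lam' h') \<longleftrightarrow>
        \<alpha> \<in> linkages (m h' (v h'))" if "\<alpha> \<in> antisymmetric_space E" for \<alpha>
    proof (rule critical_set_iff[OF irrefl \<alpha>0(1) h' strict' mag'[OF _ _ h'] hN'0 _ c eig' _ that])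
      show "\<psi>' h' $ s = c * of_real (v h' $ s)" for s by (simp add: \<psi>'_def)
      show "\<tau> r s * m h' (v h') r s = h' $ r $ s * v h' $ s" for r s
        by (simp add: m_def \<tau>_def)
    qed
    have "{\<alpha> \<in> antisymmetric_space E. gauge_class E h' \<alpha> \<in> critical_set E h' VN (hN' h') (\<psi>' h') (lam' h')} =
        linkages (m h' (v h'))"
      using iff' linkages_antisymmetric by blast
    moreover have "smooth_submanifold (dim slice_space - dim row_space) (linkages (m h' (v h')))"
      using d(2)[OF _ near_m] by (intro smooth_submanifold_linkages) (simp add: bent_def)
    ultimately have sub': "torus_submanifold E h' (critical_set E h' VN (hN' h') (\<psi>' h') (lam' h'))"
      unfolding torus_submanifold_def using critical_set_subset_torus by metis
    \<comment> \<open>Both directions use the same tolerance: the original lengths have distance 0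
      from themselves, the perturbed ones at most \<open>d r\<close>.\<close>
    have "transportable (m h u) (m h' (v h'))" "transportable (m h' (v h')) (m h u)"
      unfolding transportable_def using d(3) near_m self by blast+
    then have diff: "torus_diffeomorphic E h (critical_set E h VN hN \<psi>N lam)
        h' (critical_set E h' VN (hN' h') (\<psi>' h') (lam' h'))"
      by (rule torus_diffeomorphic_linkages[OF _ _ gauge_class_eq_iff[OF h] gauge_class_eq_iff[OF h' strict']
            critical_set_subset_torus iff0 critical_set_subset_torus iff'])
    show "\<exists>hN' \<psi>N' lam'. critical_data E h' VN hN' \<psi>N' lam' \<and>
        torus_submanifold E h' (critical_set E h' VN hN' \<psi>N' lam') \<and>
        torus_diffeomorphic E h (critical_set E h VN hN \<psi>N lam)
          h' (critical_set E h' VN hN' \<psi>N' lam') \<and>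
        norm (hN' - hN) < \<epsilon> \<and> norm (\<psi>N' - \<psi>N) < \<epsilon> \<and> \<bar>lam' - lam\<bar> < \<epsilon>"
      using crit' sub' diff n(6-8)
      by (intro exI[of _ "hN' h'"] exI[of _ "\<psi>' h'"] exI[of _ "lam' h'"]) simp
  qed
qed

end
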